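(* Let $0<\alpha\le1/2$, let $h\in L^2(\nu)$ with $\|h\|_{L^2(\nu)}=1$, and put $$\theta=\langle h,S_\alpha h\rangle,\qquad \sigma^2=\|S_\alpha h-\theta h\|_{L^2(\nu)}^2,\qquad \beta=(Q_3-\theta^3)^{1/3}.$$ If $\theta>\beta$, then $$\theta\le\lambda_{\max}(S_\alpha)\le\theta+\frac{\sigma^2}{\theta-\beta}.$$ In particular, the separation condition $\theta>\beta$ holds whenever $\theta\ge a_0$. All quantities in this enclosure have explicit finite formulas when $h$ is a finite linear combination of exponentials.
   Context: Let $\nu(du)=e^{-u}\,du$ on $[0,\infty)$. For $0<\alpha<1$, $S_\alpha$ is the positive compact self-adjoint operator on $L^2(\nu)$ given by $(S_\alpha h)(u)=\int_0^\infty|u-v|^{-\alpha}h(v)\,\nu(dv)$, and $\lambda_{\max}(S_\alpha)$ is its largest eigenvalue; $\langle\cdot,\cdot\rangle$ is the inner product of $L^2(\nu)$. Constants: $a_0=\Gamma(1-\alpha)$ and $$Q_3=\frac{\Gamma(1-\alpha)^2\,\Gamma(1-3\alpha/2)}{\Gamma(1-\alpha/2)},$$ where $\Gamma$ is the gamma function. Exponentials are functions of the form $u\mapsto e^{-tu}$ with rate $t\ge0$. *)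

theory Defs
  imports "HOL-Analysis.Analysis"
begin

text \<open>Elements of real \<open>L\<^sup>2(M)\<close> are represented by functions; identities between
  elements are stated almost everywhere.\<close>

definition L2 :: "'a measure \<Rightarrow> ('a \<Rightarrow> real) set" where
  "L2 M = {f \<in> borel_measurable M. integrable M (\<lambda>x. (f x)\<^sup>2)}"

definition l2_inner :: "'a measure \<Rightarrow> ('a \<Rightarrow> real) \<Rightarrow> ('a \<Rightarrow> real) \<Rightarrow> real" where
  "l2_inner M f g = (LINT x|M. f x * g x)"

definition l2_norm :: "'a measure \<Rightarrow> ('a \<Rightarrow> real) \<Rightarrow> real" where
  "l2_norm M f = sqrt (l2_inner M f f)"

text \<open>A measure on all of \<open>\<real>\<close> that gives no mass to the negative half-line, so values of
  functions at negative arguments are irrelevant.\<close>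

definition nu :: "real measure" where
  "nu = density lborel (\<lambda>u. ennreal (indicator {0..} u * exp (- u)))"

text \<open>Since \<open>0 powr a = 0\<close>, the kernel vanishes on the diagonal instead of being infinite
  there; this changes the integrand only on the null set \<open>{u}\<close>.\<close>

definition S_op :: "real \<Rightarrow> (real \<Rightarrow> real) \<Rightarrow> real \<Rightarrow> real" where
  "S_op \<alpha> h u = (LINT v|nu. \<bar>u - v\<bar> powr (- \<alpha>) * h v)"

definition S_eigenvalue :: "real \<Rightarrow> real \<Rightarrow> bool" where
  "S_eigenvalue \<alpha> l \<longleftrightarrow>
     (\<exists>f \<in> L2 nu. \<not> (AE u in nu. f u = 0) \<and> (AE u in nu. S_op \<alpha> f u = l * f u))"

definition lambda_max :: "real \<Rightarrow> real" where
  "lambda_max \<alpha> = (GREATEST l. S_eigenvalue \<alpha> l)"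

definition a0 :: "real \<Rightarrow> real" where
  "a0 \<alpha> = Gamma (1 - \<alpha>)"

definition Q3 :: "real \<Rightarrow> real" where
  "Q3 \<alpha> = (Gamma (1 - \<alpha>))\<^sup>2 * Gamma (1 - 3 * \<alpha> / 2) / Gamma (1 - \<alpha> / 2)"

text \<open>Closed forms of the pairings of exponentials, writing \<open>e\<^sub>s(u) = exp (- s u)\<close>:
  \<open>exp_gram s t = \<langle>e\<^sub>s, e\<^sub>t\<rangle>\<close>, \<open>exp_form \<alpha> s t = \<langle>e\<^sub>s, S\<^sub>\<alpha> e\<^sub>t\<rangle>\<close> and
  \<open>exp_sq \<alpha> s t = \<langle>S\<^sub>\<alpha> e\<^sub>s, S\<^sub>\<alpha> e\<^sub>t\<rangle>\<close>.
  For \<open>exp_sq\<close> expand the pairing as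
  \<open>\<integral>\<integral>\<integral> |u-v|\<^sup>-\<^sup>\<alpha> |u-w|\<^sup>-\<^sup>\<alpha> exp (- u - (1+s)v - (1+t)w) du dv dw\<close> and split by the order of
  \<open>u, v, w\<close>. The region \<open>u < min v w\<close> and the two regions where \<open>u\<close> lies between \<open>v\<close> and
  \<open>w\<close> give the three products of powers. The region \<open>u > max v w\<close> gives the two
  \<open>hyp_term\<close> summands, by the Euler-type integral
  \<open>\<integral>\<^sub>0\<^sup>1 z\<^sup>-\<^sup>\<alpha> (1 - x z) powr (2\<alpha>-2) dz = \<^sub>2F\<^sub>1(2-2\<alpha>, 1-\<alpha>; 2-\<alpha>; x) / (1-\<alpha>)\<close>
  at \<open>x = (1+t)/(2+t) < 1\<close>.\<close>

definition hyp2F1 :: "real \<Rightarrow> real \<Rightarrow> real \<Rightarrow> real \<Rightarrow> real" where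
  "hyp2F1 a b c x = eval_fps (fps_hypergeo [a, b] [c] 1) x"

definition exp_gram :: "real \<Rightarrow> real \<Rightarrow> real" where
  "exp_gram s t = 1 / (1 + s + t)"

definition exp_form :: "real \<Rightarrow> real \<Rightarrow> real \<Rightarrow> real" where
  "exp_form \<alpha> s t =
     Gamma (1 - \<alpha>) * ((1 + s) powr (\<alpha> - 1) + (1 + t) powr (\<alpha> - 1)) / (2 + s + t)"

definition hyp_term :: "real \<Rightarrow> real \<Rightarrow> real" where
  "hyp_term \<alpha> t = Gamma (2 - 2 * \<alpha>) / (1 - \<alpha>) * (2 + t) powr (2 * \<alpha> - 2)
     * hyp2F1 (2 - 2 * \<alpha>) (1 - \<alpha>) (2 - \<alpha>) ((1 + t) / (2 + t))"

definition exp_sq :: "real \<Rightarrow> real \<Rightarrow> real \<Rightarrow> real" where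
  "exp_sq \<alpha> s t =
     ((Gamma (1 - \<alpha>))\<^sup>2 * ((1 + s) powr (\<alpha> - 1) * (1 + t) powr (\<alpha> - 1)
        + (1 + s) powr (\<alpha> - 1) * (2 + s) powr (\<alpha> - 1)
        + (1 + t) powr (\<alpha> - 1) * (2 + t) powr (\<alpha> - 1))
      + hyp_term \<alpha> s + hyp_term \<alpha> t) / (3 + s + t)"

end

theory Submission
  imports Defs
begin

text \<open>The exponent 3 is the smallest that serves the whole range of \<open>\<alpha>\<close>: for \<open>\<alpha> = 1 / 2\<close> the operator
  \<open>S\<^sub>\<alpha>\<close> is no longer Hilbert-Schmidt, but \<open>S\<^sub>\<alpha>\<^sup>3\<close> has a finite trace, and that trace is \<open>Q3 \<alpha>\<close>.
  Splitting off the smallest of the three variables and passing to the sum of the two gaps above it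
  turns the trace integral into a Beta integral, which the duplication formula brings to the form of
  \<open>Q3\<close> (\<open>nu_trace_integral\<close>).

  The operator is positive, so the top eigenvalue \<open>l\<close> satisfies \<open>l ^ 3 \<ge> \<theta> ^ 3\<close>, and on the
  orthogonal complement of the top eigenvector only \<open>Q3 - l ^ 3 \<le> \<beta> ^ 3\<close> is left for the cubes of
  the other eigenvalues. They are at most \<open>\<beta>\<close>. With this gap, Temple's inequality
  (\<open>kato_temple\<close>) is the claimed enclosure.

  The trace enters through its bound on orthonormal pairs,
  \<open>\<langle>f, S\<^sup>3 f\<rangle> + \<langle>g, S\<^sup>3 g\<rangle> \<le> Q3\<close>. It follows from a factorization
  \<open>\<bar>u - v\<bar>\<^sup>-\<^sup>\<alpha> = \<integral> a(u, w) a(v, w) dw\<close> with a one-sided fractional kernel \<open>a\<close>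
  (\<open>riesz_factorization\<close>): then \<open>\<langle>f, S\<^sup>3 f\<rangle>\<close> is an integral over \<open>w\<close> of squared coefficients of \<open>f\<close>, to
  which Bessel's inequality applies (\<open>factored_kernel.trace_bound\<close>). The separation \<open>\<beta> < \<theta>\<close> means
  \<open>Q3 < 2 * \<theta> ^ 3\<close>, so two orthogonal unit vectors cannot both be nearly optimal. By the
  parallelogram law a maximizing sequence for \<open>\<langle>f, S\<^sup>3 f\<rangle>\<close> is therefore Cauchy up to signs, and the
  top eigenvector exists by completeness of \<open>L\<^sup>2(\<nu>)\<close> (\<open>top_eigenvector\<close>).

  The separation for \<open>\<theta> \<ge> a0 \<alpha>\<close> is an inequality between Gamma values (\<open>Q3_less_a0_cube\<close>). The
  explicit formulas come from bilinearity and three pairings of exponentials. These again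
  split off the smallest variable, which the exponential measure, having no memory, integrates out.\<close>

section \<open>Temple's inequality from a bound on orthonormal pairs\<close>

lemma cube_less_cube_iff: "x ^ 3 < y ^ 3 \<longleftrightarrow> x < (y::real)"
  using real_root_less_iff[of 3 "x ^ 3" "y ^ 3"] by (simp add: odd_real_root_power_cancel)

lemma cube_le_cube_iff: "x ^ 3 \<le> y ^ 3 \<longleftrightarrow> x \<le> (y::real)"
  using cube_less_cube_iff[of y x] by (simp add: linorder_not_less[symmetric])

text \<open>For unit vectors \<open>x\<close> and \<open>y\<close> the vectors \<open>x + y\<close> and \<open>x - y\<close> are orthogonal, so the bound on
  orthonormal pairs applies to them after normalisation. By the parallelogram law the form takes
  on \<open>x + y\<close> and \<open>x - y\<close> together twice its values at \<open>x\<close> and \<open>y\<close>. When both values are nearly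
  maximal this leaves almost no room for \<open>x - y\<close>. If \<open>2 * \<mu> > Q\<close> this estimate makes
  maximizing sequences converge, up to sign.\<close>

lemma near_maximizers_are_close:
  fixes P :: "'a::real_inner \<Rightarrow> 'a"
  assumes lin: "linear P"
    and pair: "\<And>f g. norm f = 1 \<Longrightarrow> norm g = 1 \<Longrightarrow> f \<bullet> g = 0 \<Longrightarrow> f \<bullet> P f + g \<bullet> P g \<le> Q"
    and max: "\<And>y. y \<bullet> P y \<le> \<mu> * (norm y)\<^sup>2"
    and x: "norm x = 1" "\<mu> - e \<le> x \<bullet> P x"
    and y: "norm y = 1" "\<mu> - e \<le> y \<bullet> P y"
    and xy: "0 \<le> x \<bullet> y"
  shows "(2 * \<mu> - Q) * (norm (x - y))\<^sup>2 \<le> 4 * e"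
proof (cases "x = y")
  case True
  then show ?thesis using max[of x] x by simp
next
  case False
  interpret linear P by fact
  define u v where "u = x + y" and "v = x - y"
  define s d where "s = (norm u)\<^sup>2" and "d = (norm v)\<^sup>2"
  have xx: "x \<bullet> x = 1" "y \<bullet> y = 1"
    using x y by (auto simp: norm_eq_1)
  have s: "s = 2 + 2 * (x \<bullet> y)" and d: "d = 2 - 2 * (x \<bullet> y)"
    unfolding s_def d_def u_def v_def power2_norm_eq_inner
    using xx by (auto simp: inner_simps inner_commute)
  have "d > 0" using False by (simp add: d_def v_def)
  have "s > 0" "d \<le> s" using s d xy by auto
  have ortho: "u \<bullet> v = 0" unfolding u_def v_def using xx by (simp add: inner_simps inner_commute)
  have scale: "(c *\<^sub>R z) \<bullet> P (c *\<^sub>R z) = c\<^sup>2 * (z \<bullet> P z)" for c z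
    by (simp add: scale power2_eq_square)
  define p r where "p = (u \<bullet> P u) / s" and "r = (v \<bullet> P v) / d"
  have "p + r \<le> Q"
  proof -
    have "norm u \<noteq> 0" "norm v \<noteq> 0" using \<open>s > 0\<close> \<open>d > 0\<close> by (auto simp: s_def d_def)
    then have "((1 / norm u) *\<^sub>R u) \<bullet> P ((1 / norm u) *\<^sub>R u)
        + ((1 / norm v) *\<^sub>R v) \<bullet> P ((1 / norm v) *\<^sub>R v) \<le> Q"
      by (intro pair) (auto simp: ortho)
    then show ?thesis
      unfolding scale p_def r_def s_def d_def by (simp add: power_divide)
  qed
  have "p \<le> \<mu>"
    using max[of u] \<open>s > 0\<close> by (simp add: p_def s_def field_simps)
  have "p * s + r * d = u \<bullet> P u + v \<bullet> P v"
    using \<open>s > 0\<close> \<open>d > 0\<close> by (simp add: p_def r_def)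
  also have "\<dots> = 2 * (x \<bullet> P x) + 2 * (y \<bullet> P y)"
    unfolding u_def v_def by (simp add: add diff inner_simps)
  finally have "4 * (\<mu> - e) \<le> p * s + r * d" using x y by simp
  also have "\<dots> \<le> p * s + (Q - p) * d"
    using \<open>p + r \<le> Q\<close> \<open>d > 0\<close> by (intro add_left_mono mult_right_mono) auto
  also have "\<dots> = p * (s - d) + Q * d" by (simp add: algebra_simps)
  also have "\<dots> \<le> \<mu> * (s - d) + Q * d"
    using \<open>p \<le> \<mu>\<close> \<open>d \<le> s\<close> by (intro add_right_mono mult_right_mono) auto
  also have "s - d = 4 - 2 * d" using s d by simp
  finally show ?thesis by (simp add: d_def v_def algebra_simps)
qed

text \<open>A nonnegative quadratic form has vanishing gradient where it vanishes. For the form of \<open>\<mu> - P\<close>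
  the gradient at \<open>x\<close> is twice \<open>w = \<mu> x - P x\<close>, and a short step from \<open>x\<close> in the direction
  \<open>- w\<close> would make the form negative unless \<open>w = 0\<close>.\<close>

lemma semidefinite_kernel:
  fixes P :: "'a::real_inner \<Rightarrow> 'a"
  assumes lin: "linear P" and sym: "\<And>x y. P x \<bullet> y = x \<bullet> P y"
    and max: "\<And>y. y \<bullet> P y \<le> \<mu> * (norm y)\<^sup>2"
    and x: "x \<bullet> P x = \<mu> * (norm x)\<^sup>2"
  shows "P x = \<mu> *\<^sub>R x"
proof -
  interpret linear P by fact
  define w where "w = \<mu> *\<^sub>R x - P x"
  define a where "a = w \<bullet> w"
  define b where "b = \<mu> * (w \<bullet> w) - w \<bullet> P w"
  have "b \<ge> 0" using max[of w] by (simp add: b_def power2_norm_eq_inner)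
  \<comment> \<open>The nonnegative form \<open>y \<bullet> (\<mu> y - P y)\<close> takes the value \<open>t\<^sup>2 b - 2 t a\<close> at \<open>y = x - t w\<close>.\<close>
  have ineq: "2 * t * a \<le> t\<^sup>2 * b" for t :: real
  proof -
    have 1: "x \<bullet> P x = \<mu> * (x \<bullet> x)" using x by (simp add: power2_norm_eq_inner)
    have 2: "w \<bullet> P x = \<mu> * (x \<bullet> w) - a" "x \<bullet> P w = \<mu> * (x \<bullet> w) - a"
      using sym[of x w] by (simp_all add: w_def a_def inner_simps inner_commute algebra_simps)
    have "(x - t *\<^sub>R w) \<bullet> P (x - t *\<^sub>R w)
        = x \<bullet> P x - t * (w \<bullet> P x) - t * (x \<bullet> P w) + t\<^sup>2 * (w \<bullet> P w)"
      by (simp add: diff scale inner_simps power2_eq_square algebra_simps)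
    moreover have "(norm (x - t *\<^sub>R w))\<^sup>2 = x \<bullet> x - 2 * t * (x \<bullet> w) + t\<^sup>2 * (w \<bullet> w)"
      unfolding power2_norm_eq_inner
      by (simp add: inner_simps power2_eq_square inner_commute algebra_simps)
    ultimately have "x \<bullet> P x - t * (w \<bullet> P x) - t * (x \<bullet> P w) + t\<^sup>2 * (w \<bullet> P w)
        \<le> \<mu> * (x \<bullet> x - 2 * t * (x \<bullet> w) + t\<^sup>2 * (w \<bullet> w))"
      using max[of "x - t *\<^sub>R w"] by simp
    then show ?thesis unfolding 1 2 by (simp add: b_def algebra_simps)
  qed
  have "a \<le> 0"
  proof (rule ccontr)
    assume "\<not> a \<le> 0"
    \<comment> \<open>A positive step below \<open>2 a / b\<close>; the 1 covers the case \<open>b = 0\<close>.\<close>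
    define t where "t = a / (b + 1)"
    have t: "t > 0" using \<open>\<not> a \<le> 0\<close> \<open>b \<ge> 0\<close> by (simp add: t_def)
    have "2 * a \<le> t * b" using ineq[of t] t by (simp add: power2_eq_square)
    also have "t * b \<le> a" using \<open>b \<ge> 0\<close> \<open>\<not> a \<le> 0\<close> by (simp add: t_def field_simps)
    finally show False using \<open>\<not> a \<le> 0\<close> by simp
  qed
  then have "w = 0" unfolding a_def by (metis inner_eq_zero_iff inner_ge_zero antisym)
  then show ?thesis by (simp add: w_def)
qed

lemma bounded_quadratic_form:
  fixes P :: "'a::real_inner \<Rightarrow> 'a"
  assumes "bounded_linear P"
  obtains C where "\<And>x. norm x = 1 \<Longrightarrow> x \<bullet> P x \<le> C"
proof -
  obtain K where K: "\<And>x. norm (P x) \<le> norm x * K" using bounded_linear.bounded[OF assms] by blast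
  have "x \<bullet> P x \<le> K" if "norm x = 1" for x
    using norm_cauchy_schwarz[of x "P x"] K[of x] that by simp
  then show ?thesis using that by blast
qed

text \<open>A maximizing sequence of the quadratic form on the unit sphere is Cauchy once its signs are
  aligned with a fixed near-maximizer \<open>x0\<close>. Completeness gives a maximizer, and the first variation
  shows that it is an eigenvector.\<close>

lemma top_eigenvector:
  fixes P :: "'a::{real_inner,complete_space} \<Rightarrow> 'a"
  assumes bl: "bounded_linear P" and sym: "\<And>x y. P x \<bullet> y = x \<bullet> P y"
    and pair: "\<And>f g. norm f = 1 \<Longrightarrow> norm g = 1 \<Longrightarrow> f \<bullet> g = 0 \<Longrightarrow> f \<bullet> P f + g \<bullet> P g \<le> Q"
    and h: "norm h = 1" and dominant: "Q < 2 * (h \<bullet> P h)"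
  obtains x \<mu> where "norm x = 1" "P x = \<mu> *\<^sub>R x" "\<And>y. y \<bullet> P y \<le> \<mu> * (norm y)\<^sup>2"
proof -
  interpret bounded_linear P by fact
  define A where "A = (\<lambda>x. x \<bullet> P x) ` sphere 0 1"
  define \<mu> where "\<mu> = Sup A"
  obtain C where C: "\<And>x. norm x = 1 \<Longrightarrow> x \<bullet> P x \<le> C" using bounded_quadratic_form[OF bl] by blast
  have bdd: "bdd_above A" unfolding A_def using C by (auto intro!: bdd_aboveI[where M=C])
  have hA: "h \<bullet> P h \<in> A" using h by (auto simp: A_def)
  have up: "x \<bullet> P x \<le> \<mu>" if "norm x = 1" for x
    unfolding \<mu>_def by (rule cSup_upper[OF _ bdd]) (use that in \<open>auto simp: A_def\<close>)
  have max: "y \<bullet> P y \<le> \<mu> * (norm y)\<^sup>2" for y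
  proof (cases "y = 0")
    case False
    then have "norm ((1 / norm y) *\<^sub>R y) = 1" by simp
    from up[OF this] have "(1 / norm y)\<^sup>2 * (y \<bullet> P y) \<le> \<mu>" by (simp add: scaleR power2_eq_square)
    then show ?thesis using False by (simp add: power_divide pos_divide_le_eq)
  qed (simp add: zero)
  define \<delta> where "\<delta> = 2 * \<mu> - Q"
  have "\<delta> > 0" using up[OF h] dominant by (simp add: \<delta>_def)
  have ex: "\<exists>x. norm x = 1 \<and> \<mu> - e < x \<bullet> P x" if "e > 0" for e
  proof -
    have "A \<noteq> {}" using hA by blast
    then have "\<exists>a\<in>A. \<mu> - e < a" using less_cSupD[of A "\<mu> - e"] that by (simp add: \<mu>_def)
    then show ?thesis by (auto simp: A_def)
  qed
  have close: "(norm (x - y))\<^sup>2 \<le> 4 * e / \<delta>"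
    if "norm x = 1" "norm y = 1" "\<mu> - e \<le> x \<bullet> P x" "\<mu> - e \<le> y \<bullet> P y" "0 \<le> x \<bullet> y" for x y e
  proof -
    have "\<delta> * (norm (x - y))\<^sup>2 \<le> 4 * e"
      unfolding \<delta>_def
      by (rule near_maximizers_are_close[OF linear_axioms pair max that(1,3,2,4,5)])
    then show ?thesis using \<open>\<delta> > 0\<close> by (simp add: pos_le_divide_eq mult.commute)
  qed
  obtain x0 where x0: "norm x0 = 1" "\<mu> - \<delta> / 16 < x0 \<bullet> P x0"
    using ex[of "\<delta> / 16"] \<open>\<delta> > 0\<close> by auto
  \<comment> \<open>Errors of at most \<open>\<delta> / 16\<close> keep every term within \<open>1 / 2\<close> of \<open>x0\<close>, so that any two terms
    enclose an acute angle, as \<open>close\<close> requires.\<close>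
  define e where "e n = \<delta> / 16 * inverse (real (Suc n))" for n
  have e: "e n > 0" "e n \<le> \<delta> / 16" for n
    using \<open>\<delta> > 0\<close> by (auto simp: e_def field_simps)
  have "\<exists>x. norm x = 1 \<and> \<mu> - e n < x \<bullet> P x \<and> 0 \<le> x \<bullet> x0" for n
  proof -
    obtain x where x: "norm x = 1" "\<mu> - e n < x \<bullet> P x" using ex[OF e(1)] by blast
    show ?thesis
    proof (cases "0 \<le> x \<bullet> x0")
      case False
      then show ?thesis using x by (intro exI[of _ "- x"]) (auto simp: neg)
    qed (use x in blast)
  qed
  then obtain X where X: "\<And>n. norm (X n) = 1" "\<And>n. \<mu> - e n < X n \<bullet> P (X n)" "\<And>n. 0 \<le> X n \<bullet> x0"
    by metis
  have half: "norm (X n - x0) \<le> 1 / 2" for n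
  proof (rule power2_le_imp_le)
    have "(norm (X n - x0))\<^sup>2 \<le> 4 * (\<delta> / 16) / \<delta>"
      using X[of n] x0 e[of n] by (intro close) auto
    then show "(norm (X n - x0))\<^sup>2 \<le> (1 / 2)\<^sup>2" using \<open>\<delta> > 0\<close> by (simp add: power2_eq_square)
  qed simp
  have angle: "0 \<le> X m \<bullet> X n" for m n
  proof -
    have "norm (X m - X n) \<le> norm (X m - x0) + norm (X n - x0)"
      using norm_triangle_ineq4[of "X m - x0" "X n - x0"] by simp
    then have "norm (X m - X n) \<le> 1" using half[of m] half[of n] by simp
    then have "(norm (X m - X n))\<^sup>2 \<le> 1" by (simp add: power_le_one)
    moreover have "(norm (X m - X n))\<^sup>2 = 2 - 2 * (X m \<bullet> X n)"
      using X(1)[of m] X(1)[of n]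
      by (simp add: power2_norm_eq_inner inner_simps inner_commute norm_eq_1)
    ultimately show ?thesis by simp
  qed
  have "Cauchy X"
  proof (rule metric_CauchyI)
    fix \<epsilon> :: real assume "\<epsilon> > 0"
    then have "\<epsilon>\<^sup>2 > 0" by simp
    then obtain N where N: "inverse (real (Suc N)) < 4 * \<epsilon>\<^sup>2" using reals_Archimedean[of "4 * \<epsilon>\<^sup>2"] by auto
    show "\<exists>M. \<forall>m\<ge>M. \<forall>n\<ge>M. dist (X m) (X n) < \<epsilon>"
    proof (intro exI allI impI)
      fix m n assume mn: "N \<le> m" "N \<le> n"
      have mono: "e k \<le> e N" if "N \<le> k" for k
        using that \<open>\<delta> > 0\<close> unfolding e_def by (intro mult_left_mono le_imp_inverse_le) auto
      have "(norm (X m - X n))\<^sup>2 \<le> 4 * e N / \<delta>"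
        using X[of n] X[of m] mono[OF mn(1)] mono[OF mn(2)] angle by (intro close) auto
      also have "\<dots> = inverse (real (Suc N)) / 4" using \<open>\<delta> > 0\<close> by (simp add: e_def)
      also have "\<dots> < \<epsilon>\<^sup>2" using N by simp
      finally show "dist (X m) (X n) < \<epsilon>"
        using \<open>\<epsilon> > 0\<close> by (simp add: dist_norm power2_less_imp_less)
    qed
  qed
  then obtain x where lim: "X \<longlonglongrightarrow> x" by (auto simp: Cauchy_convergent_iff convergent_def)
  have "(\<lambda>n. norm (X n)) \<longlonglongrightarrow> norm x" by (intro tendsto_norm lim)
  then have nx: "norm x = 1" using X(1) by (simp add: LIMSEQ_const_iff)
  have "(\<lambda>n. X n \<bullet> P (X n)) \<longlonglongrightarrow> x \<bullet> P x" by (intro tendsto_inner tendsto lim)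
  moreover have "(\<lambda>n. \<mu> - e n) \<longlonglongrightarrow> \<mu> - \<delta> / 16 * 0"
    unfolding e_def by (intro tendsto_intros LIMSEQ_inverse_real_of_nat)
  ultimately have "\<mu> \<le> x \<bullet> P x"
    using X(2) by (intro LIMSEQ_le) (auto intro: less_imp_le)
  then have "x \<bullet> P x = \<mu> * (norm x)\<^sup>2" using max[of x] nx by simp
  then have "P x = \<mu> *\<^sub>R x"
    using semidefinite_kernel[OF linear_axioms sym max] by blast
  with nx max show ?thesis using that by blast
qed

text \<open>Jensen's inequality for the spectral measure of \<open>T\<close> at \<open>g\<close>, from two
  positivity statements.\<close>

lemma cube_le_moment:
  fixes T :: "'a::real_inner \<Rightarrow> 'a"
  assumes lin: "linear T" and sym: "\<And>x y. T x \<bullet> y = x \<bullet> T y" and pos: "\<And>x. 0 \<le> x \<bullet> T x"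
    and g: "norm g = 1"
  shows "(g \<bullet> T g) ^ 3 \<le> g \<bullet> T (T (T g))"
proof -
  interpret linear T by fact
  define m where "m = g \<bullet> T g"
  have gg: "g \<bullet> g = 1" using g by (simp add: norm_eq_1)
  \<comment> \<open>\<open>T g - m g\<close> is the part of \<open>T g\<close> orthogonal to \<open>g\<close>; positivity of \<open>T\<close> there bounds
    the third moment below, and positivity of its norm bounds the second.\<close>
  have "0 \<le> (T g - m *\<^sub>R g) \<bullet> T (T g - m *\<^sub>R g)" by (rule pos)
  also have "\<dots> = g \<bullet> T (T (T g)) - 2 * m * (T g \<bullet> T g) + m\<^sup>2 * m"
    by (simp add: diff scale inner_simps sym m_def power2_eq_square algebra_simps)
  finally have 1: "2 * m * (T g \<bullet> T g) \<le> g \<bullet> T (T (T g)) + m ^ 3" by (simp add: power3_eq_cube power2_eq_square)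
  have "0 \<le> (T g - m *\<^sub>R g) \<bullet> (T g - m *\<^sub>R g)" by simp
  also have "\<dots> = T g \<bullet> T g - m\<^sup>2"
    using gg by (simp add: inner_simps inner_commute m_def power2_eq_square algebra_simps)
  finally have "m\<^sup>2 \<le> T g \<bullet> T g" by simp
  moreover have "m \<ge> 0" using pos by (simp add: m_def)
  ultimately have "2 * m * m\<^sup>2 \<le> 2 * m * (T g \<bullet> T g)" by (intro mult_left_mono) auto
  with 1 show ?thesis by (simp add: m_def power3_eq_cube power2_eq_square)
qed

text \<open>Temple's inequality. On the orthogonal complement of \<open>f\<close>, where the form of \<open>T\<close> is at most
  \<open>\<beta>\<close>, the product \<open>(T - l) (T - \<beta>) = (\<beta> - T)\<^sup>2 + (l - \<beta>) (\<beta> - T)\<close> is nonnegative; expanding it at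
  \<open>h\<close> gives the bound.\<close>

lemma kato_temple:
  fixes T :: "'a::real_inner \<Rightarrow> 'a"
  assumes lin: "linear T" and sym: "\<And>x y. T x \<bullet> y = x \<bullet> T y"
    and f: "norm f = 1" "T f = l *\<^sub>R f"
    and gap: "\<And>g. norm g = 1 \<Longrightarrow> f \<bullet> g = 0 \<Longrightarrow> g \<bullet> T g \<le> \<beta>"
    and le: "\<beta> \<le> l"
    and h: "norm h = 1" and \<theta>: "\<theta> = h \<bullet> T h"
  shows "(l - \<theta>) * (\<theta> - \<beta>) \<le> (norm (T h - \<theta> *\<^sub>R h))\<^sup>2"
proof -
  interpret linear T by fact
  have ff: "f \<bullet> f = 1" and hh: "h \<bullet> h = 1" using f h by (auto simp: norm_eq_1)
  define g where "g = h - (f \<bullet> h) *\<^sub>R f"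
  have fg: "f \<bullet> g = 0" using ff by (simp add: g_def inner_simps)
  have gT: "g \<bullet> T g \<le> \<beta> * (g \<bullet> g)"
  proof (cases "g = 0")
    case False
    then have "((1 / norm g) *\<^sub>R g) \<bullet> T ((1 / norm g) *\<^sub>R g) \<le> \<beta>" using fg by (intro gap) auto
    with False show ?thesis by (simp add: scale field_simps power2_norm_eq_inner[symmetric] power2_eq_square)
  qed (simp add: zero)
  \<comment> \<open>\<open>(T - l) (T - \<beta>)\<close> annihilates \<open>f\<close>, so only the component \<open>g\<close> contributes to its form at \<open>h\<close>.\<close>
  have hg: "h = (f \<bullet> h) *\<^sub>R f + g" by (simp add: g_def)
  have 1: "T h - l *\<^sub>R h = T g - l *\<^sub>R g"
    by (subst (1 2) hg) (simp add: add scale f scaleR_add_right)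
  have fTg: "f \<bullet> T g = 0" using sym[of f g] f fg by simp
  have 2: "T h - \<beta> *\<^sub>R h = ((f \<bullet> h) * (l - \<beta>)) *\<^sub>R f + (T g - \<beta> *\<^sub>R g)"
    by (subst (1 2) hg) (simp add: add scale f algebra_simps)
  have "(T h - l *\<^sub>R h) \<bullet> (T h - \<beta> *\<^sub>R h) = (T g - l *\<^sub>R g) \<bullet> (T g - \<beta> *\<^sub>R g)"
    unfolding 1 2 using fTg fg by (simp add: inner_simps inner_commute)
  also have "\<dots> = (T g - \<beta> *\<^sub>R g) \<bullet> (T g - \<beta> *\<^sub>R g) + (l - \<beta>) * (\<beta> * (g \<bullet> g) - g \<bullet> T g)"
    by (simp add: inner_simps inner_commute algebra_simps)
  also have "\<dots> \<ge> 0" using gT le by (intro add_nonneg_nonneg mult_nonneg_nonneg) auto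
  finally have "0 \<le> (T h - l *\<^sub>R h) \<bullet> (T h - \<beta> *\<^sub>R h)" .
  also have "\<dots> = T h \<bullet> T h - (l + \<beta>) * \<theta> + l * \<beta>"
    using hh by (simp add: inner_simps inner_commute \<theta> algebra_simps)
  finally have 3: "0 \<le> T h \<bullet> T h - (l + \<beta>) * \<theta> + l * \<beta>" .
  have "(norm (T h - \<theta> *\<^sub>R h))\<^sup>2 = T h \<bullet> T h - \<theta>\<^sup>2"
    unfolding power2_norm_eq_inner using hh by (simp add: inner_simps inner_commute \<theta> power2_eq_square algebra_simps)
  with 3 show ?thesis by (simp add: algebra_simps power2_eq_square)
qed

text \<open>The separation \<open>\<beta> < \<theta>\<close> says \<open>Q < 2 * \<theta> ^ 3\<close>, so the cube of \<open>T\<close> has a top eigenvector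
  \<open>f\<close>, and \<open>f\<close> is an eigenvector of \<open>T\<close> for the positive cube root \<open>l\<close>. For a unit vector \<open>g\<close>
  orthogonal to \<open>f\<close> the pair bound leaves at most \<open>Q - l ^ 3 \<le> \<beta> ^ 3\<close> for its third moment.
  By Jensen's inequality the form of \<open>T\<close> is then at most \<open>\<beta>\<close> on the complement of \<open>f\<close>, which is the
  spectral gap that Temple's inequality needs.\<close>

theorem kato_temple_from_trace_bound:
  fixes T :: "'a::{real_inner,complete_space} \<Rightarrow> 'a"
  assumes bl: "bounded_linear T" and sym: "\<And>x y. T x \<bullet> y = x \<bullet> T y" and pos: "\<And>x. 0 \<le> x \<bullet> T x"
    and trace: "\<And>f g. norm f = 1 \<Longrightarrow> norm g = 1 \<Longrightarrow> f \<bullet> g = 0 \<Longrightarrow>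
        f \<bullet> T (T (T f)) + g \<bullet> T (T (T g)) \<le> Q"
    and h: "norm h = 1" and \<theta>: "\<theta> = h \<bullet> T h" and \<beta>: "\<beta> = root 3 (Q - \<theta> ^ 3)"
    and sep: "\<beta> < \<theta>" and Q: "0 \<le> Q"
  obtains f l where "norm f = 1" "T f = l *\<^sub>R f" "\<And>x m. x \<noteq> 0 \<Longrightarrow> T x = m *\<^sub>R x \<Longrightarrow> m \<le> l"
    "\<theta> \<le> l" "(l - \<theta>) * (\<theta> - \<beta>) \<le> (norm (T h - \<theta> *\<^sub>R h))\<^sup>2"
proof -
  interpret bounded_linear T by fact
  have \<beta>3: "\<beta> ^ 3 = Q - \<theta> ^ 3" by (simp add: \<beta> odd_real_root_pow)
  have "\<beta> ^ 3 < \<theta> ^ 3" using sep by (simp add: cube_less_cube_iff)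
  then have two: "Q < 2 * \<theta> ^ 3" using \<beta>3 by simp
  have "\<theta> ^ 3 > 0" using two Q by linarith
  then have "\<theta> > 0" by (simp add: zero_less_power_eq)
  define P where "P = (\<lambda>x. T (T (T x)))"
  have blP: "bounded_linear P"
    unfolding P_def by (intro bounded_linear_compose[OF bl] bl)
  have symP: "P x \<bullet> y = x \<bullet> P y" for x y unfolding P_def by (simp add: sym)
  have "\<theta> ^ 3 \<le> h \<bullet> P h"
    unfolding P_def \<theta> by (rule cube_le_moment[OF linear_axioms sym pos h])
  then have "Q < 2 * (h \<bullet> P h)" using two by simp
  have traceP: "f \<bullet> P f + g \<bullet> P g \<le> Q" if "norm f = 1" "norm g = 1" "f \<bullet> g = 0" for f g
    unfolding P_def by (rule trace[OF that])
  from \<open>Q < 2 * (h \<bullet> P h)\<close> obtain f \<mu> where f: "norm f = 1" and Pf: "P f = \<mu> *\<^sub>R f" and max: "\<And>y. y \<bullet> P y \<le> \<mu> * (norm y)\<^sup>2"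
    using top_eigenvector[OF blP symP traceP h] by blast
  define l where "l = root 3 \<mu>"
  have l3: "l ^ 3 = \<mu>" by (simp add: l_def odd_real_root_pow)
  have "\<theta> ^ 3 \<le> l ^ 3" using \<open>\<theta> ^ 3 \<le> h \<bullet> P h\<close> max[of h] h l3 by simp
  then have \<theta>l: "\<theta> \<le> l" by (simp add: cube_le_cube_iff)
  then have "l > 0" using \<open>\<theta> > 0\<close> by simp
  \<comment> \<open>\<open>T\<^sup>3 - l\<^sup>3 = (T\<^sup>2 + l T + l\<^sup>2) (T - l)\<close>, and the first factor is positive definite.\<close>
  have Tf: "T f = l *\<^sub>R f"
  proof -
    define z where "z = T f - l *\<^sub>R f"
    have "T (T z) + l *\<^sub>R T z + l\<^sup>2 *\<^sub>R z = P f - l ^ 3 *\<^sub>R f"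
      unfolding z_def P_def
      by (simp add: diff scaleR scaleR_diff_right power2_eq_square power3_eq_cube)
    also have "\<dots> = 0" using Pf l3 by simp
    finally have "z \<bullet> (T (T z) + l *\<^sub>R T z + l\<^sup>2 *\<^sub>R z) = 0" by simp
    then have "T z \<bullet> T z + l * (z \<bullet> T z) + l\<^sup>2 * (z \<bullet> z) = 0"
      by (simp add: inner_simps sym)
    moreover have "0 \<le> l * (z \<bullet> T z)" using pos \<open>l > 0\<close> by simp
    ultimately have "l\<^sup>2 * (z \<bullet> z) \<le> 0" using inner_ge_zero[of "T z"] by linarith
    then have "z \<bullet> z \<le> 0" using \<open>l > 0\<close> by (simp add: mult_le_0_iff)
    then have "z = 0" by (metis inner_eq_zero_iff inner_ge_zero antisym)
    then show ?thesis by (simp add: z_def)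
  qed
  have greatest: "m \<le> l" if "x \<noteq> 0" "T x = m *\<^sub>R x" for x m
  proof -
    have "P x = m ^ 3 *\<^sub>R x" unfolding P_def by (simp add: that scaleR power3_eq_cube)
    then have "m ^ 3 * (norm x)\<^sup>2 \<le> l ^ 3 * (norm x)\<^sup>2"
      using max[of x] l3 by (simp add: power2_norm_eq_inner)
    then have "m ^ 3 \<le> l ^ 3" using that(1) by simp
    then show ?thesis by (simp add: cube_le_cube_iff)
  qed
  have gap: "g \<bullet> T g \<le> \<beta>" if g: "norm g = 1" "f \<bullet> g = 0" for g
  proof -
    have "(g \<bullet> T g) ^ 3 \<le> g \<bullet> P g"
      unfolding P_def by (rule cube_le_moment[OF linear_axioms sym pos g(1)])
    also have "\<dots> \<le> Q - f \<bullet> P f" using trace[OF f g] by (simp add: P_def)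
    also have "f \<bullet> P f = l ^ 3" using f by (simp add: Pf l3 norm_eq_1)
    also have "Q - l ^ 3 \<le> \<beta> ^ 3" using \<beta>3 \<open>\<theta> ^ 3 \<le> l ^ 3\<close> by simp
    finally have "(g \<bullet> T g) ^ 3 \<le> \<beta> ^ 3" .
    then show ?thesis by (simp add: cube_le_cube_iff)
  qed
  have "(l - \<theta>) * (\<theta> - \<beta>) \<le> (norm (T h - \<theta> *\<^sub>R h))\<^sup>2"
    using kato_temple[OF linear_axioms sym f Tf gap _ h \<theta>] sep \<theta>l by simp
  with f Tf greatest \<theta>l show ?thesis using that by blast
qed

section \<open>The Hilbert space \<open>L\<^sup>2(\<nu>)\<close>\<close>

lemma L2_iff: "f \<in> L2 M \<longleftrightarrow> f \<in> borel_measurable M \<and> integrable M (\<lambda>x. (f x)\<^sup>2)"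
  by (simp add: L2_def)

lemma L2_measurable: "f \<in> L2 M \<Longrightarrow> f \<in> borel_measurable M"
  by (simp add: L2_def)

lemma L2_integrable_mult:
  assumes "f \<in> L2 M" "g \<in> L2 M"
  shows "integrable M (\<lambda>x. f x * g x)"
proof (rule Bochner_Integration.integrable_bound)
  show "integrable M (\<lambda>x. (f x)\<^sup>2 + (g x)\<^sup>2)" using assms by (simp add: L2_iff)
  show "(\<lambda>x. f x * g x) \<in> borel_measurable M" using assms by (auto simp: L2_iff)
  have "\<bar>a * b\<bar> \<le> a\<^sup>2 + b\<^sup>2" for a b :: real
    using sum_squares_bound[of "\<bar>a\<bar>" "\<bar>b\<bar>"] zero_le_power2[of a] zero_le_power2[of b] unfolding abs_mult power2_abs by linarith
  then show "AE x in M. norm (f x * g x) \<le> norm ((f x)\<^sup>2 + (g x)\<^sup>2)" by simp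
qed

lemma L2_add: "f \<in> L2 M \<Longrightarrow> g \<in> L2 M \<Longrightarrow> (\<lambda>x. f x + g x) \<in> L2 M"
  using L2_integrable_mult[of f M g] by (auto simp: L2_iff power2_sum mult.assoc)

lemma L2_scale: "f \<in> L2 M \<Longrightarrow> (\<lambda>x. c * f x) \<in> L2 M"
  by (auto simp: L2_iff power_mult_distrib)

lemma L2_zero: "(\<lambda>x. 0) \<in> L2 M"
  by (auto simp: L2_iff)

lemma L2_iff_nn: "f \<in> L2 M \<longleftrightarrow> f \<in> borel_measurable M \<and> (\<integral>\<^sup>+x. ennreal ((f x)\<^sup>2) \<partial>M) < \<infinity>"
  by (auto simp: L2_iff integrable_iff_bounded)

lemma l2_inner_cong_AE:
  assumes "AE x in M. f x = f' x" "AE x in M. g x = g' x"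
    "f \<in> borel_measurable M" "f' \<in> borel_measurable M" "g \<in> borel_measurable M" "g' \<in> borel_measurable M"
  shows "l2_inner M f g = l2_inner M f' g'"
  unfolding l2_inner_def using assms by (intro integral_cong_AE) auto

lemma l2_inner_self: "l2_inner M f f = (LINT x|M. (f x)\<^sup>2)"
  by (simp add: l2_inner_def power2_eq_square)

lemma l2_norm_power2: "(l2_norm M f)\<^sup>2 = (LINT x|M. (f x)\<^sup>2)"
  by (simp add: l2_norm_def l2_inner_self)

lemma sets_nu [simp, measurable_cong]: "sets nu = sets borel"
  by (simp add: nu_def)

lemma space_nu [simp]: "space nu = UNIV"
  by (simp add: nu_def)

lemma nn_integral_nu:
  "f \<in> borel_measurable borel \<Longrightarrow>
    (\<integral>\<^sup>+u. f u \<partial>nu) = (\<integral>\<^sup>+u. ennreal (indicator {0..} u * exp (- u)) * f u \<partial>lborel)"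
  unfolding nu_def by (subst nn_integral_density) auto

lemma emeasure_nu_UNIV: "emeasure nu UNIV = 1"
proof -
  have "emeasure nu UNIV = (\<integral>\<^sup>+u. 1 \<partial>nu)" by simp
  also have "\<dots> = (\<integral>\<^sup>+u. ennreal (indicator {0..} u * u powr (1 - 1) / exp u) \<partial>lborel)"
  proof (subst nn_integral_nu)
    have "AE u in lborel. u \<noteq> (0::real)" by (rule AE_lborel_singleton)
    then show "(\<integral>\<^sup>+u. ennreal (indicator {0..} u * exp (- u)) * 1 \<partial>lborel)
        = (\<integral>\<^sup>+u. ennreal (indicator {0..} u * u powr (1 - 1) / exp u) \<partial>lborel)"
      by (intro nn_integral_cong_AE) (auto simp: exp_minus divide_inverse)
  qed simp
  also have "\<dots> = 1" using Gamma_conv_nn_integral_real[of 1] by simp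
  finally show ?thesis .
qed

interpretation nu: finite_measure nu
  by (rule finite_measureI) (simp add: emeasure_nu_UNIV)

text \<open>The space \<open>L2 nu\<close> modulo equality almost everywhere, as a type, so that the
  type classes of Hilbert space theory apply to it.\<close>

quotient_type L2nu = "real \<Rightarrow> real" / partial:
  "\<lambda>f g. f \<in> L2 nu \<and> g \<in> L2 nu \<and> (AE u in nu. f u = g u)"
proof (rule part_equivpI)
  show "\<exists>f. f \<in> L2 nu \<and> f \<in> L2 nu \<and> (AE u in nu. f u = f u)"
    using L2_zero[of nu] by auto
  show "symp (\<lambda>f g. f \<in> L2 nu \<and> g \<in> L2 nu \<and> (AE u in nu. f u = g u))"
    by (auto intro!: sympI)
  show "transp (\<lambda>f g. f \<in> L2 nu \<and> g \<in> L2 nu \<and> (AE u in nu. f u = g u))"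
    by (rule transpI) auto
qed

instantiation L2nu :: real_vector
begin

lift_definition zero_L2nu :: L2nu is "\<lambda>_. 0" by (simp add: L2_zero)
lift_definition plus_L2nu :: "L2nu \<Rightarrow> L2nu \<Rightarrow> L2nu" is "\<lambda>f g x. f x + g x"
  by (auto intro: L2_add)
lift_definition scaleR_L2nu :: "real \<Rightarrow> L2nu \<Rightarrow> L2nu" is "\<lambda>c f x. c * f x"
  by (auto intro: L2_scale)
definition uminus_L2nu :: "L2nu \<Rightarrow> L2nu" where "- f = (- 1) *\<^sub>R f" for f :: L2nu
definition minus_L2nu :: "L2nu \<Rightarrow> L2nu \<Rightarrow> L2nu" where "f - g = f + (- g)" for f g :: L2nu

instance
proof
  fix a b c :: L2nu and r s :: real
  show "a + b + c = a + (b + c)" by transfer (auto intro!: L2_add simp: add.assoc)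
  show "a + b = b + a" by transfer (auto intro!: L2_add simp: add.commute)
  show "0 + a = a" by transfer auto
  show "- a + a = 0" unfolding uminus_L2nu_def by transfer (auto intro!: L2_add L2_scale[of _ _ "-1", simplified] L2_zero)
  show "a - b = a + - b" by (simp add: minus_L2nu_def)
  show "r *\<^sub>R (a + b) = r *\<^sub>R a + r *\<^sub>R b" by transfer (auto intro!: L2_add L2_scale simp: algebra_simps)
  show "(r + s) *\<^sub>R a = r *\<^sub>R a + s *\<^sub>R a" by transfer (auto intro!: L2_add L2_scale simp: distrib_right)
  show "r *\<^sub>R s *\<^sub>R a = (r * s) *\<^sub>R a" by transfer (auto intro!: L2_scale simp: mult.assoc)
  show "1 *\<^sub>R a = a" by transfer auto
qed

end

instantiation L2nu :: real_inner
begin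

lift_definition inner_L2nu :: "L2nu \<Rightarrow> L2nu \<Rightarrow> real" is "l2_inner nu"
  by (rule l2_inner_cong_AE) (auto intro: L2_measurable)
definition norm_L2nu :: "L2nu \<Rightarrow> real" where "norm_L2nu f = sqrt (f \<bullet> f)"
definition sgn_L2nu :: "L2nu \<Rightarrow> L2nu" where "sgn_L2nu f = inverse (norm f) *\<^sub>R f"
definition dist_L2nu :: "L2nu \<Rightarrow> L2nu \<Rightarrow> real" where "dist_L2nu f g = norm (f - g)"
definition uniformity_L2nu :: "(L2nu \<times> L2nu) filter" where
  "uniformity_L2nu = (INF e\<in>{0 <..}. principal {(x, y). dist x y < e})"
definition open_L2nu :: "L2nu set \<Rightarrow> bool" where
  "open_L2nu U = (\<forall>x\<in>U. eventually (\<lambda>(x', y). x' = x \<longrightarrow> y \<in> U) uniformity)"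

instance
proof
  fix f g h :: L2nu and r :: real and U :: "L2nu set"
  show "dist f g = norm (f - g)" by (simp add: dist_L2nu_def)
  show "uniformity = (INF e\<in>{0 <..}. principal {(x::L2nu, y). dist x y < e})"
    by (simp add: uniformity_L2nu_def)
  show "open U = (\<forall>x\<in>U. \<forall>\<^sub>F (x', y) in uniformity. x' = x \<longrightarrow> y \<in> U)"
    by (simp add: open_L2nu_def)
  show "sgn f = f /\<^sub>R norm f" by (simp add: sgn_L2nu_def)
  show "norm f = sqrt (f \<bullet> f)" by (simp add: norm_L2nu_def)
  show "f \<bullet> g = g \<bullet> f" by transfer (simp add: l2_inner_def mult.commute)
  show "(f + g) \<bullet> h = f \<bullet> h + g \<bullet> h"
    by transfer (simp add: l2_inner_def distrib_right L2_integrable_mult)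
  show "(r *\<^sub>R f) \<bullet> g = r * (f \<bullet> g)"
    by transfer (simp add: l2_inner_def mult.assoc L2_integrable_mult)
  show "0 \<le> f \<bullet> f" by transfer (simp add: l2_inner_self)
  show "(f \<bullet> f = 0) \<longleftrightarrow> f = 0"
  proof transfer
    fix f assume "f \<in> L2 nu \<and> f \<in> L2 nu \<and> (AE u in nu. f u = f u)"
    then have f: "f \<in> L2 nu" by simp
    have "l2_inner nu f f = 0 \<longleftrightarrow> (AE x in nu. (f x)\<^sup>2 = 0)"
      unfolding l2_inner_self using f by (intro integral_nonneg_eq_0_iff_AE) (auto simp: L2_iff)
    then show "(l2_inner nu f f = 0) \<longleftrightarrow> (f \<in> L2 nu \<and> (\<lambda>_. 0) \<in> L2 nu \<and> (AE u in nu. f u = 0))"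
      using f L2_zero[of nu] by simp
  qed
qed

end

lift_definition l2_class :: "(real \<Rightarrow> real) \<Rightarrow> L2nu" is "\<lambda>f. if f \<in> L2 nu then f else (\<lambda>_. 0)"
  by (simp add: L2_zero)

lemma l2_class_eq_iff:
  assumes "f \<in> L2 nu" "g \<in> L2 nu"
  shows "l2_class f = l2_class g \<longleftrightarrow> (AE u in nu. f u = g u)"
  using assms by transfer simp

lemma l2_class_surj: obtains f where "f \<in> L2 nu" "x = l2_class f"
proof -
  have "\<exists>f. f \<in> L2 nu \<and> x = l2_class f" by transfer auto
  then show ?thesis using that by blast
qed

lemma inner_l2_class: "f \<in> L2 nu \<Longrightarrow> g \<in> L2 nu \<Longrightarrow> l2_class f \<bullet> l2_class g = l2_inner nu f g"
  by transfer simp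

lemma norm_l2_class: "f \<in> L2 nu \<Longrightarrow> norm (l2_class f) = l2_norm nu f"
  by (simp add: norm_eq_sqrt_inner inner_l2_class l2_norm_def)

lemma l2_class_add: "f \<in> L2 nu \<Longrightarrow> g \<in> L2 nu \<Longrightarrow> l2_class f + l2_class g = l2_class (\<lambda>x. f x + g x)"
  by transfer (simp add: L2_add)

lemma l2_class_scale: "f \<in> L2 nu \<Longrightarrow> c *\<^sub>R l2_class f = l2_class (\<lambda>x. c * f x)"
  by transfer (simp add: L2_scale)

lemma L2_diff: "f \<in> L2 M \<Longrightarrow> g \<in> L2 M \<Longrightarrow> (\<lambda>x. f x - g x) \<in> L2 M"
  using L2_add[of f M "\<lambda>x. (-1) * g x"] L2_scale[of g M "-1"] by simp

lemma l2_class_diff: "f \<in> L2 nu \<Longrightarrow> g \<in> L2 nu \<Longrightarrow> l2_class f - l2_class g = l2_class (\<lambda>x. f x - g x)"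
  using l2_class_add[of f "\<lambda>x. (-1) * g x"] l2_class_scale[of g "-1"] L2_scale[of g nu "-1"]
  by (simp add: diff_conv_add_uminus del: add_uminus_conv_diff)

lemma l2_class_eq_0_iff: "f \<in> L2 nu \<Longrightarrow> l2_class f = 0 \<longleftrightarrow> (AE u in nu. f u = 0)"
  by transfer (simp add: L2_zero)

lemma norm_l2_class_nn:
  assumes "f \<in> L2 nu"
  shows "ennreal ((norm (l2_class f))\<^sup>2) = (\<integral>\<^sup>+u. ennreal ((f u)\<^sup>2) \<partial>nu)"
  using assms by (simp add: norm_l2_class l2_norm_power2 nn_integral_eq_integral L2_iff)

lemma ennreal_power2_le_imp_le:
  assumes "x\<^sup>2 \<le> (ennreal c)\<^sup>2" "0 \<le> c"
  shows "x \<le> ennreal c"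
proof (cases x)
  case (real y)
  then have "y\<^sup>2 \<le> c\<^sup>2" using assms by (simp add: ennreal_power)
  then show ?thesis using real assms power2_le_imp_le[of y c] by simp
qed (use assms in \<open>simp add: power2_eq_square ennreal_mult[symmetric] top_unique\<close>)

text \<open>The total mass of \<open>nu\<close> is 1, so convergence in norm controls convergence in mean.\<close>

lemma nn_integral_abs_le_norm:
  assumes "f \<in> L2 nu"
  shows "(\<integral>\<^sup>+u. ennreal \<bar>f u\<bar> \<partial>nu) \<le> ennreal (norm (l2_class f))"
proof -
  have [measurable]: "f \<in> borel_measurable nu" using assms by (rule L2_measurable)
  have "(\<integral>\<^sup>+u. ennreal \<bar>f u\<bar> * 1 \<partial>nu)\<^sup>2 \<le> (\<integral>\<^sup>+u. (ennreal \<bar>f u\<bar>)\<^sup>2 \<partial>nu) * (\<integral>\<^sup>+u. 1\<^sup>2 \<partial>nu)"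
    by (rule Cauchy_Schwarz_nn_integral) auto
  also have "\<dots> = (ennreal (norm (l2_class f)))\<^sup>2"
    using norm_l2_class_nn[OF assms] by (simp add: ennreal_power emeasure_nu_UNIV)
  finally show ?thesis by (intro ennreal_power2_le_imp_le) auto
qed

lemma summable_if_nn_suminf_finite:
  fixes a :: "nat \<Rightarrow> real"
  assumes "(\<Sum>n. ennreal \<bar>a n\<bar>) < \<infinity>"
  shows "summable a"
  using assms by (intro summable_rabs_cancel[OF summable_suminf_not_top]) auto

text \<open>Completeness is the Riesz-Fischer theorem. A rapidly converging subsequence has summable
  increments in mean, hence converges almost everywhere, and Fatou's lemma turns the pointwise limit
  into a limit in norm.\<close>

instance L2nu :: complete_space
proof
  fix X :: "nat \<Rightarrow> L2nu"
  assume X: "Cauchy X"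
  have "\<forall>k. \<exists>M. \<forall>m\<ge>M. \<forall>n\<ge>M. dist (X m) (X n) < (1 / 2) ^ k"
    using X by (auto intro!: metric_CauchyD)
  then obtain M where M: "\<And>k m n. M k \<le> m \<Longrightarrow> M k \<le> n \<Longrightarrow> dist (X m) (X n) < (1 / 2) ^ k"
    by metis
  \<comment> \<open>A strictly increasing sequence that stays above \<open>M\<close>.\<close>
  define r where "r k = (\<Sum>i\<le>k. M i) + k" for k
  have r_ge: "M k \<le> r k" for k
    unfolding r_def by (rule trans_le_add1) (auto intro: member_le_sum)
  have "r k < r (Suc k)" for k by (simp add: r_def)
  then have r: "strict_mono r" by (simp add: strict_mono_Suc_iff)
  have close: "dist (X (r m)) (X (r n)) < (1 / 2) ^ k" if "k \<le> m" "k \<le> n" for k m n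
    using that r_ge[of k] r by (intro M) (meson order_trans strict_mono_less_eq)+
  have "\<forall>n. \<exists>f. f \<in> L2 nu \<and> X (r n) = l2_class f" using l2_class_surj by metis
  then obtain F where F: "\<And>n. F n \<in> L2 nu" and XF: "\<And>n. X (r n) = l2_class (F n)" by metis
  have F_meas [measurable]: "F n \<in> borel_measurable nu" for n using F by (rule L2_measurable)
  define d where "d n u = F (Suc n) u - F n u" for n u
  have d: "d n \<in> L2 nu" for n unfolding d_def using F by (intro L2_diff)
  have d_meas [measurable]: "d n \<in> borel_measurable nu" for n using d by (rule L2_measurable)
  have norm_d: "norm (l2_class (d n)) \<le> (1 / 2) ^ n" for n
    using close[of n "Suc n" n] l2_class_diff[OF F F, of "Suc n" n] unfolding d_def XF dist_norm by simp
  have "(\<integral>\<^sup>+u. (\<Sum>n. ennreal \<bar>d n u\<bar>) \<partial>nu) = (\<Sum>n. \<integral>\<^sup>+u. ennreal \<bar>d n u\<bar> \<partial>nu)"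
    by (intro nn_integral_suminf) auto
  also have "\<dots> \<le> (\<Sum>n. ennreal ((1 / 2) ^ n))"
    by (intro suminf_le order_trans[OF nn_integral_abs_le_norm[OF d]] ennreal_leI norm_d) auto
  also have "\<dots> = ennreal (\<Sum>n. (1 / 2) ^ n)"
    by (intro suminf_ennreal2) auto
  finally have "(\<integral>\<^sup>+u. (\<Sum>n. ennreal \<bar>d n u\<bar>) \<partial>nu) < \<infinity>" by (rule le_less_trans) simp
  then have "AE u in nu. (\<Sum>n. ennreal \<bar>d n u\<bar>) \<noteq> \<infinity>"
    by (intro nn_integral_PInf_AE) auto
  then have conv: "AE u in nu. convergent (\<lambda>n. F n u)"
  proof eventually_elim
    case (elim u)
    then have "summable (\<lambda>n. d n u)" by (intro summable_if_nn_suminf_finite) (simp add: less_top)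
    then have "convergent (\<lambda>n. \<Sum>i<n. d i u)" by (simp add: summable_iff_convergent)
    moreover have "(\<Sum>i<n. d i u) = F n u - F 0 u" for n
      unfolding d_def by (rule sum_lessThan_telescope)
    ultimately have "convergent (\<lambda>n. (F n u - F 0 u) + F 0 u)"
      by (intro convergent_add) (auto intro: convergent_const)
    then show ?case by simp
  qed
  define f where "f u = lim (\<lambda>n. F n u)" for u
  have f_meas [measurable]: "f \<in> borel_measurable nu"
    unfolding f_def by (rule borel_measurable_lim_metric) auto
  have lim: "AE u in nu. (\<lambda>n. F n u) \<longlonglongrightarrow> f u"
    using conv by eventually_elim (simp add: f_def convergent_LIMSEQ_iff)
  have tail: "(\<integral>\<^sup>+u. ennreal ((f u - F n u)\<^sup>2) \<partial>nu) \<le> ennreal (((1 / 2) ^ n)\<^sup>2)" for n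
  proof -
    have "(\<integral>\<^sup>+u. ennreal ((f u - F n u)\<^sup>2) \<partial>nu)
        = (\<integral>\<^sup>+u. liminf (\<lambda>m. ennreal ((F m u - F n u)\<^sup>2)) \<partial>nu)"
    proof (intro nn_integral_cong_AE)
      show "AE u in nu. ennreal ((f u - F n u)\<^sup>2) = liminf (\<lambda>m. ennreal ((F m u - F n u)\<^sup>2))"
        using lim
      proof eventually_elim
        case (elim u)
        have "(\<lambda>m. ennreal ((F m u - F n u)\<^sup>2)) \<longlonglongrightarrow> ennreal ((f u - F n u)\<^sup>2)"
          by (intro tendsto_ennrealI tendsto_intros elim)
        from lim_imp_Liminf[OF _ this] show ?case by simp
      qed
    qed
    also have "\<dots> \<le> liminf (\<lambda>m. \<integral>\<^sup>+u. ennreal ((F m u - F n u)\<^sup>2) \<partial>nu)"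
      by (rule nn_integral_liminf) auto
    also have "\<dots> \<le> liminf (\<lambda>m. ennreal (((1 / 2) ^ n)\<^sup>2))"
    proof (intro Liminf_mono eventually_sequentiallyI[of n])
      fix m assume "n \<le> m"
      have "norm (l2_class (\<lambda>u. F m u - F n u)) \<le> (1 / 2) ^ n"
        using close[of n m n] \<open>n \<le> m\<close> l2_class_diff[OF F F, of m n] unfolding XF dist_norm by simp
      then show "(\<integral>\<^sup>+u. ennreal ((F m u - F n u)\<^sup>2) \<partial>nu) \<le> ennreal (((1 / 2) ^ n)\<^sup>2)"
        by (subst norm_l2_class_nn[symmetric]) (auto intro!: L2_diff F power_mono)
    qed
    finally show ?thesis by (simp add: Liminf_const)
  qed
  have diff: "(\<lambda>u. f u - F n u) \<in> L2 nu" for n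
    unfolding L2_iff_nn using tail[of n] by (auto intro: le_less_trans)
  have "f \<in> L2 nu" using L2_add[OF diff[of 0] F[of 0]] by simp
  have "(\<lambda>n. X (r n)) \<longlonglongrightarrow> l2_class f"
  proof (rule metric_LIMSEQ_I)
    fix e :: real assume "e > 0"
    then obtain N where N: "(1 / 2) ^ N < e" using real_arch_pow_inv[of e "1 / 2"] by auto
    show "\<exists>N. \<forall>n\<ge>N. dist (X (r n)) (l2_class f) < e"
    proof (intro exI allI impI)
      fix n assume "N \<le> n"
      have "ennreal ((norm (l2_class f - l2_class (F n)))\<^sup>2) \<le> ennreal (((1 / 2) ^ n)\<^sup>2)"
        using tail[of n] by (simp add: l2_class_diff[OF \<open>f \<in> L2 nu\<close> F] norm_l2_class_nn[OF diff])
      then have "(norm (l2_class f - l2_class (F n)))\<^sup>2 \<le> ((1 / 2) ^ n)\<^sup>2"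
        by (subst (asm) ennreal_le_iff) auto
      then have "norm (l2_class f - l2_class (F n)) \<le> (1 / 2) ^ n"
        by (rule power2_le_imp_le) simp
      also have "\<dots> \<le> (1 / 2) ^ N" using \<open>N \<le> n\<close> by (intro power_decreasing) auto
      also note N
      finally show "dist (X (r n)) (l2_class f) < e" by (simp add: XF dist_norm norm_minus_commute)
    qed
  qed
  then have "X \<longlonglongrightarrow> l2_class f"
    using Cauchy_converges_subseq[OF X r] by (simp add: o_def)
  then show "convergent X" by (auto simp: convergent_def)
qed

section \<open>Positive integral operators with a factored kernel\<close>

lemma l2_bessel:
  assumes b: "b \<in> L2 M" and f: "f \<in> L2 M" and g: "g \<in> L2 M"
    and ff: "l2_inner M f f = 1" and gg: "l2_inner M g g = 1" and fg: "l2_inner M f g = 0"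
  shows "(l2_inner M b f)\<^sup>2 + (l2_inner M b g)\<^sup>2 \<le> l2_inner M b b"
proof -
  define x y where "x = l2_inner M b f" and "y = l2_inner M b g"
  note int = L2_integrable_mult[OF b b] L2_integrable_mult[OF f f] L2_integrable_mult[OF g g]
    L2_integrable_mult[OF b f] L2_integrable_mult[OF b g] L2_integrable_mult[OF f g]
  have "0 \<le> (LINT u|M. (b u - x * f u - y * g u)\<^sup>2)" by simp
  also have "\<dots> = (LINT u|M. b u * b u + x\<^sup>2 * (f u * f u) + y\<^sup>2 * (g u * g u)
      - 2 * x * (b u * f u) - 2 * y * (b u * g u) + 2 * x * y * (f u * g u))"
    by (intro Bochner_Integration.integral_cong refl) (simp add: power2_eq_square algebra_simps)
  also have "\<dots> = l2_inner M b b + x\<^sup>2 * l2_inner M f f + y\<^sup>2 * l2_inner M g g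
      - 2 * x * l2_inner M b f - 2 * y * l2_inner M b g + 2 * x * y * l2_inner M f g"
    unfolding l2_inner_def using int by simp
  also have "\<dots> = l2_inner M b b - x\<^sup>2 - y\<^sup>2"
    unfolding ff gg fg x_def y_def by (simp add: power2_eq_square)
  finally show ?thesis by (simp add: x_def y_def)
qed

text \<open>The kernel \<open>k\<close> of an integral operator together with an explicit root \<open>a\<close>, which makes the
  operator positive, and a bound \<open>C\<close> on its row sums, which makes it bounded. The operator itself
  may fail to be Hilbert-Schmidt: at \<open>\<alpha> = 1 / 2\<close> the kernel \<open>\<bar>u - v\<bar>\<^sup>-\<^sup>\<alpha>\<close> is not square
  integrable. The factorization is an almost-everywhere condition because at \<open>u = v\<close> the integral
  over \<open>w\<close> may be infinite.\<close>

locale factored_kernel = M: finite_measure M + N: sigma_finite_measure N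
  for M :: "'a measure" and N :: "'b measure" +
  fixes k :: "'a \<Rightarrow> 'a \<Rightarrow> real" and a :: "'a \<Rightarrow> 'b \<Rightarrow> real" and C :: real
  assumes k_measurable [measurable]: "case_prod k \<in> borel_measurable (M \<Otimes>\<^sub>M M)"
    and a_measurable [measurable]: "case_prod a \<in> borel_measurable (M \<Otimes>\<^sub>M N)"
    and k_nonneg: "\<And>u v. 0 \<le> k u v" and a_nonneg: "\<And>u w. 0 \<le> a u w"
    and k_sym: "\<And>u v. k u v = k v u"
    and schur: "\<And>u. u \<in> space M \<Longrightarrow> (\<integral>\<^sup>+v. ennreal (k u v) \<partial>M) \<le> ennreal C"
    and C_nonneg: "0 \<le> C"
    and factorization: "\<And>u. u \<in> space M \<Longrightarrow>
      AE v in M. (\<integral>\<^sup>+w. ennreal (a u w) * ennreal (a v w) \<partial>N) = ennreal (k u v)"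
begin

sublocale MM: pair_sigma_finite M M ..
sublocale MN: pair_sigma_finite M N ..
sublocale MMN: pair_sigma_finite "M \<Otimes>\<^sub>M M" N ..

definition op :: "('a \<Rightarrow> real) \<Rightarrow> 'a \<Rightarrow> real" where
  "op h u = (LINT v|M. k u v * h v)"

text \<open>The row sums of \<open>k\<close> bound its column sums as well, by symmetry.\<close>

lemma schur_nn:
  assumes [measurable]: "f \<in> borel_measurable M"
  shows "(\<integral>\<^sup>+u. \<integral>\<^sup>+v. ennreal (k u v) * f u \<partial>M \<partial>M) \<le> ennreal C * (\<integral>\<^sup>+u. f u \<partial>M)" (is ?A)
    and "(\<integral>\<^sup>+u. \<integral>\<^sup>+v. ennreal (k u v) * f v \<partial>M \<partial>M) \<le> ennreal C * (\<integral>\<^sup>+u. f u \<partial>M)" (is ?B)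
proof -
  have "(\<integral>\<^sup>+u. \<integral>\<^sup>+v. ennreal (k u v) * f u \<partial>M \<partial>M) = (\<integral>\<^sup>+u. (\<integral>\<^sup>+v. ennreal (k u v) \<partial>M) * f u \<partial>M)"
    by (intro nn_integral_cong nn_integral_multc) auto
  also have "\<dots> \<le> (\<integral>\<^sup>+u. ennreal C * f u \<partial>M)"
    by (intro nn_integral_mono mult_right_mono schur) auto
  also have "\<dots> = ennreal C * (\<integral>\<^sup>+u. f u \<partial>M)" by (intro nn_integral_cmult) auto
  finally show ?A .
  have "(\<integral>\<^sup>+u. \<integral>\<^sup>+v. ennreal (k u v) * f v \<partial>M \<partial>M) = (\<integral>\<^sup>+v. \<integral>\<^sup>+u. ennreal (k u v) * f v \<partial>M \<partial>M)"
    by (rule MM.Fubini') measurable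
  also have "\<dots> = (\<integral>\<^sup>+u. \<integral>\<^sup>+v. ennreal (k u v) * f u \<partial>M \<partial>M)"
    by (simp add: k_sym)
  finally show ?B using \<open>?A\<close> by simp
qed

lemma form_nn_le:
  assumes [measurable]: "f \<in> borel_measurable M" "g \<in> borel_measurable M"
  shows "(\<integral>\<^sup>+u. \<integral>\<^sup>+v. ennreal (k u v) * (f u * g v) \<partial>M \<partial>M)
    \<le> ennreal C * (\<integral>\<^sup>+u. (f u)\<^sup>2 \<partial>M) + ennreal C * (\<integral>\<^sup>+u. (g u)\<^sup>2 \<partial>M)"
proof -
  have le: "x * y \<le> x\<^sup>2 + y\<^sup>2" for x y :: ennreal
  proof (cases "x \<le> y")
    case True
    then have "x * y \<le> y * y" by (intro mult_right_mono) auto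
    then show ?thesis by (simp add: power2_eq_square add_increasing)
  next
    case False
    then have "x * y \<le> x * x" by (intro mult_left_mono) auto
    then show ?thesis by (simp add: power2_eq_square add_increasing2)
  qed
  have "(\<integral>\<^sup>+u. \<integral>\<^sup>+v. ennreal (k u v) * (f u * g v) \<partial>M \<partial>M)
    \<le> (\<integral>\<^sup>+u. \<integral>\<^sup>+v. ennreal (k u v) * (f u)\<^sup>2 + ennreal (k u v) * (g v)\<^sup>2 \<partial>M \<partial>M)"
    unfolding distrib_left[symmetric] by (intro nn_integral_mono mult_left_mono le) auto
  also have "\<dots> = (\<integral>\<^sup>+u. \<integral>\<^sup>+v. ennreal (k u v) * (f u)\<^sup>2 \<partial>M \<partial>M)
      + (\<integral>\<^sup>+u. \<integral>\<^sup>+v. ennreal (k u v) * (g v)\<^sup>2 \<partial>M \<partial>M)"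
    by (subst nn_integral_add[symmetric]) (auto intro!: nn_integral_cong nn_integral_add)
  also have "\<dots> \<le> ennreal C * (\<integral>\<^sup>+u. (f u)\<^sup>2 \<partial>M) + ennreal C * (\<integral>\<^sup>+u. (g u)\<^sup>2 \<partial>M)"
    by (intro add_mono schur_nn) auto
  finally show ?thesis .
qed

lemma form_nn_finite:
  assumes f: "f \<in> L2 M" and g: "g \<in> L2 M"
  shows "(\<integral>\<^sup>+u. \<integral>\<^sup>+v. ennreal (k u v) * (ennreal \<bar>f u\<bar> * ennreal \<bar>g v\<bar>) \<partial>M \<partial>M) < \<infinity>"
proof -
  have [measurable]: "f \<in> borel_measurable M" "g \<in> borel_measurable M"
    using f g by (auto simp: L2_measurable)
  have "(\<integral>\<^sup>+u. (ennreal \<bar>f u\<bar>)\<^sup>2 \<partial>M) < \<infinity>" "(\<integral>\<^sup>+u. (ennreal \<bar>g u\<bar>)\<^sup>2 \<partial>M) < \<infinity>"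
    using f g by (simp_all add: L2_iff_nn ennreal_power)
  then have "ennreal C * (\<integral>\<^sup>+u. (ennreal \<bar>f u\<bar>)\<^sup>2 \<partial>M) + ennreal C * (\<integral>\<^sup>+u. (ennreal \<bar>g u\<bar>)\<^sup>2 \<partial>M) < \<infinity>"
    by (simp add: ennreal_mult_less_top)
  with form_nn_le[of "\<lambda>u. ennreal \<bar>f u\<bar>" "\<lambda>u. ennreal \<bar>g u\<bar>"] show ?thesis
    by (auto intro: le_less_trans)
qed

lemma form_integrable:
  assumes f: "f \<in> L2 M" and g: "g \<in> L2 M"
  shows "integrable (M \<Otimes>\<^sub>M M) (\<lambda>(u, v). k u v * (f u * g v))"
proof (rule integrableI_bounded)
  have [measurable]: "f \<in> borel_measurable M" "g \<in> borel_measurable M"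
    using f g by (auto simp: L2_measurable)
  show "(\<lambda>(u, v). k u v * (f u * g v)) \<in> borel_measurable (M \<Otimes>\<^sub>M M)" by measurable
  have "(\<integral>\<^sup>+p. ennreal (norm (case p of (u, v) \<Rightarrow> k u v * (f u * g v))) \<partial>(M \<Otimes>\<^sub>M M))
      = (\<integral>\<^sup>+u. \<integral>\<^sup>+v. ennreal (k u v) * (ennreal \<bar>f u\<bar> * ennreal \<bar>g v\<bar>) \<partial>M \<partial>M)"
    by (subst M.nn_integral_fst[symmetric]) (auto simp: abs_mult k_nonneg ennreal_mult)
  also have "\<dots> < \<infinity>" by (rule form_nn_finite[OF f g])
  finally show "(\<integral>\<^sup>+p. ennreal (norm (case p of (u, v) \<Rightarrow> k u v * (f u * g v))) \<partial>(M \<Otimes>\<^sub>M M)) < \<infinity>" .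
qed

lemma one_L2: "(\<lambda>_. 1) \<in> L2 M"
  by (simp add: L2_iff)

lemma AE_integrable_op:
  assumes "f \<in> L2 M"
  shows "AE u in M. integrable M (\<lambda>v. k u v * f v)"
  using MM.AE_integrable_fst'[OF form_integrable[OF one_L2 assms]] by simp

lemma op_measurable [measurable]:
  assumes [measurable]: "f \<in> borel_measurable M"
  shows "op f \<in> borel_measurable M"
  unfolding op_def by measurable

lemma abs_op_le: "f \<in> borel_measurable M \<Longrightarrow> u \<in> space M \<Longrightarrow> ennreal \<bar>op f u\<bar> \<le> (\<integral>\<^sup>+v. ennreal (k u v) * ennreal \<bar>f v\<bar> \<partial>M)"
  unfolding op_def
  using integral_norm_bound_ennreal[of M "\<lambda>v. k u v * f v"]
    not_integrable_integral_eq[of M "\<lambda>v. k u v * f v"]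
  by (cases "integrable M (\<lambda>v. k u v * f v)") (auto simp: abs_mult k_nonneg ennreal_mult)

text \<open>Schur's test: the Cauchy-Schwarz inequality for the measures \<open>k u v M(dv)\<close>, whose
  masses are at most \<open>C\<close>.\<close>

lemma nn_op_square_le:
  assumes [measurable]: "f \<in> borel_measurable M"
  shows "(\<integral>\<^sup>+u. (\<integral>\<^sup>+v. ennreal (k u v) * f v \<partial>M)\<^sup>2 \<partial>M) \<le> (ennreal C)\<^sup>2 * (\<integral>\<^sup>+u. (f u)\<^sup>2 \<partial>M)"
proof -
  have "(\<integral>\<^sup>+u. (\<integral>\<^sup>+v. ennreal (k u v) * f v \<partial>M)\<^sup>2 \<partial>M)
      \<le> (\<integral>\<^sup>+u. ennreal C * (\<integral>\<^sup>+v. ennreal (k u v) * (f v)\<^sup>2 \<partial>M) \<partial>M)"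
  proof (rule nn_integral_mono)
    fix u assume u [measurable]: "u \<in> space M"
    have sq: "ennreal (sqrt (k u v)) * ennreal (sqrt (k u v)) = ennreal (k u v)" for v
      by (simp add: ennreal_mult[symmetric] k_nonneg)
    have "(\<integral>\<^sup>+v. ennreal (k u v) * f v \<partial>M)\<^sup>2
        = (\<integral>\<^sup>+v. ennreal (sqrt (k u v)) * (ennreal (sqrt (k u v)) * f v) \<partial>M)\<^sup>2"
      by (simp add: sq mult.assoc[symmetric])
    also have "\<dots> \<le> (\<integral>\<^sup>+v. (ennreal (sqrt (k u v)))\<^sup>2 \<partial>M) * (\<integral>\<^sup>+v. (ennreal (sqrt (k u v)) * f v)\<^sup>2 \<partial>M)"
      by (rule Cauchy_Schwarz_nn_integral) measurable
    also have "\<dots> = (\<integral>\<^sup>+v. ennreal (k u v) \<partial>M) * (\<integral>\<^sup>+v. ennreal (k u v) * (f v)\<^sup>2 \<partial>M)"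
      by (simp add: power_mult_distrib ennreal_power k_nonneg)
    also have "\<dots> \<le> ennreal C * (\<integral>\<^sup>+v. ennreal (k u v) * (f v)\<^sup>2 \<partial>M)"
      by (intro mult_right_mono schur u) auto
    finally show "(\<integral>\<^sup>+v. ennreal (k u v) * f v \<partial>M)\<^sup>2 \<le> ennreal C * (\<integral>\<^sup>+v. ennreal (k u v) * (f v)\<^sup>2 \<partial>M)" .
  qed
  also have "\<dots> = ennreal C * (\<integral>\<^sup>+u. \<integral>\<^sup>+v. ennreal (k u v) * (f v)\<^sup>2 \<partial>M \<partial>M)"
    by (rule nn_integral_cmult) measurable
  also have "\<dots> \<le> ennreal C * (ennreal C * (\<integral>\<^sup>+u. (f u)\<^sup>2 \<partial>M))"
    by (intro mult_left_mono schur_nn) auto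
  finally show ?thesis by (simp add: power2_eq_square mult.assoc)
qed

lemma nn_op_bound:
  assumes [measurable]: "f \<in> borel_measurable M"
  shows "(\<integral>\<^sup>+u. ennreal ((op f u)\<^sup>2) \<partial>M) \<le> (ennreal C)\<^sup>2 * (\<integral>\<^sup>+u. ennreal ((f u)\<^sup>2) \<partial>M)"
proof -
  have "(\<integral>\<^sup>+u. ennreal ((op f u)\<^sup>2) \<partial>M) \<le> (\<integral>\<^sup>+u. (\<integral>\<^sup>+v. ennreal (k u v) * ennreal \<bar>f v\<bar> \<partial>M)\<^sup>2 \<partial>M)"
  proof (intro nn_integral_mono)
    fix u assume "u \<in> space M"
    then have "(ennreal \<bar>op f u\<bar>)\<^sup>2 \<le> (\<integral>\<^sup>+v. ennreal (k u v) * ennreal \<bar>f v\<bar> \<partial>M)\<^sup>2"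
      by (intro power_mono abs_op_le) auto
    then show "ennreal ((op f u)\<^sup>2) \<le> (\<integral>\<^sup>+v. ennreal (k u v) * ennreal \<bar>f v\<bar> \<partial>M)\<^sup>2"
      by (simp add: ennreal_power)
  qed
  also have "\<dots> \<le> (ennreal C)\<^sup>2 * (\<integral>\<^sup>+u. (ennreal \<bar>f u\<bar>)\<^sup>2 \<partial>M)" by (rule nn_op_square_le) auto
  finally show ?thesis by (simp add: ennreal_power)
qed

lemma op_L2: "f \<in> L2 M \<Longrightarrow> op f \<in> L2 M"
  using nn_op_bound[of f]
  by (auto simp: L2_iff_nn ennreal_power C_nonneg ennreal_mult_less_top intro: le_less_trans)

lemma l2_norm_op_le:
  assumes "f \<in> L2 M"
  shows "l2_norm M (op f) \<le> C * l2_norm M f"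
proof (rule power2_le_imp_le)
  have "ennreal ((l2_norm M (op f))\<^sup>2) \<le> ennreal (C\<^sup>2 * (l2_norm M f)\<^sup>2)"
    using nn_op_bound[of f] assms op_L2[OF assms]
    by (simp add: l2_norm_power2 nn_integral_eq_integral L2_iff ennreal_power ennreal_mult C_nonneg)
  then show "(l2_norm M (op f))\<^sup>2 \<le> (C * l2_norm M f)\<^sup>2"
    by (simp add: power_mult_distrib)
  show "0 \<le> C * l2_norm M f"
    by (simp add: C_nonneg l2_norm_def l2_inner_self)
qed

lemma op_add_AE:
  assumes "f \<in> L2 M" "g \<in> L2 M"
  shows "AE u in M. op (\<lambda>x. f x + g x) u = op f u + op g u"
  using AE_integrable_op[OF assms(1)] AE_integrable_op[OF assms(2)]
  by eventually_elim (simp add: op_def distrib_left)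

lemma op_form:
  assumes f: "f \<in> L2 M" and g: "g \<in> L2 M"
  shows "l2_inner M f (op g) = (LINT p|(M \<Otimes>\<^sub>M M). (case p of (u, v) \<Rightarrow> k u v * (f u * g v)))"
proof -
  have "l2_inner M f (op g) = (LINT u|M. LINT v|M. k u v * (f u * g v))"
    unfolding l2_inner_def op_def by (simp add: mult.left_commute)
  then show ?thesis using MM.integral_fst'[OF form_integrable[OF f g]] by simp
qed

lemma op_symmetric:
  assumes f: "f \<in> L2 M" and g: "g \<in> L2 M"
  shows "l2_inner M (op f) g = l2_inner M f (op g)"
proof -
  have "l2_inner M (op f) g = l2_inner M g (op f)" by (simp add: l2_inner_def mult.commute)
  also have "\<dots> = (LINT v|M. LINT u|M. k u v * (f u * g v))"
    unfolding l2_inner_def op_def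
  proof (intro Bochner_Integration.integral_cong refl)
    fix v
    have "g v * (LINT u|M. k v u * f u) = (LINT u|M. g v * (k v u * f u))" by simp
    also have "\<dots> = (LINT u|M. k u v * (f u * g v))"
      by (intro Bochner_Integration.integral_cong refl) (simp add: k_sym[of v] mult_ac)
    finally show "g v * (LINT u|M. k v u * f u) = (LINT u|M. k u v * (f u * g v))" .
  qed
  also have "\<dots> = (LINT u|M. LINT v|M. k u v * (f u * g v))"
    by (rule MM.Fubini_integral[OF form_integrable[OF f g]])
  also have "\<dots> = l2_inner M f (op g)"
    unfolding l2_inner_def op_def by (simp add: mult.left_commute)
  finally show ?thesis .
qed

text \<open>Tonelli's theorem turns the factorization of the kernel into one of its bilinear form.
  Everything that needs absolute convergence below is reduced to this identity for
  nonnegative functions.\<close>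

lemma nn_factorization:
  assumes [measurable]: "g \<in> borel_measurable M" "h \<in> borel_measurable M"
  shows "(\<integral>\<^sup>+w. (\<integral>\<^sup>+u. ennreal (a u w) * g u \<partial>M) * (\<integral>\<^sup>+v. ennreal (a v w) * h v \<partial>M) \<partial>N)
    = (\<integral>\<^sup>+u. \<integral>\<^sup>+v. ennreal (k u v) * (g u * h v) \<partial>M \<partial>M)"
proof -
  have "(\<integral>\<^sup>+w. (\<integral>\<^sup>+u. ennreal (a u w) * g u \<partial>M) * (\<integral>\<^sup>+v. ennreal (a v w) * h v \<partial>M) \<partial>N)
      = (\<integral>\<^sup>+w. \<integral>\<^sup>+u. ennreal (a u w) * g u * (\<integral>\<^sup>+v. ennreal (a v w) * h v \<partial>M) \<partial>M \<partial>N)"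
    by (intro nn_integral_cong nn_integral_multc[symmetric]) measurable
  also have "\<dots> = (\<integral>\<^sup>+u. \<integral>\<^sup>+w. ennreal (a u w) * g u * (\<integral>\<^sup>+v. ennreal (a v w) * h v \<partial>M) \<partial>N \<partial>M)"
    by (rule MN.Fubini') measurable
  also have "\<dots> = (\<integral>\<^sup>+u. \<integral>\<^sup>+w. \<integral>\<^sup>+v. ennreal (a u w) * g u * (ennreal (a v w) * h v) \<partial>M \<partial>N \<partial>M)"
    by (intro nn_integral_cong nn_integral_cmult[symmetric]) measurable
  also have "\<dots> = (\<integral>\<^sup>+u. \<integral>\<^sup>+v. \<integral>\<^sup>+w. ennreal (a u w) * g u * (ennreal (a v w) * h v) \<partial>N \<partial>M \<partial>M)"
    by (intro nn_integral_cong MN.Fubini') measurable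
  also have "\<dots> = (\<integral>\<^sup>+u. \<integral>\<^sup>+v. ennreal (k u v) * (g u * h v) \<partial>M \<partial>M)"
  proof (rule nn_integral_cong)
    fix u assume u [measurable]: "u \<in> space M"
    show "(\<integral>\<^sup>+v. \<integral>\<^sup>+w. ennreal (a u w) * g u * (ennreal (a v w) * h v) \<partial>N \<partial>M)
        = (\<integral>\<^sup>+v. ennreal (k u v) * (g u * h v) \<partial>M)"
    proof (rule nn_integral_cong_AE)
      show "AE v in M. (\<integral>\<^sup>+w. ennreal (a u w) * g u * (ennreal (a v w) * h v) \<partial>N)
          = ennreal (k u v) * (g u * h v)"
        using factorization[OF u] AE_space
      proof eventually_elim
        case (elim v)
        then have [measurable]: "v \<in> space M" by simp
        have "(\<integral>\<^sup>+w. ennreal (a u w) * g u * (ennreal (a v w) * h v) \<partial>N)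
            = (\<integral>\<^sup>+w. (ennreal (a u w) * ennreal (a v w)) * (g u * h v) \<partial>N)"
          by (simp add: mult_ac)
        also have "\<dots> = (\<integral>\<^sup>+w. ennreal (a u w) * ennreal (a v w) \<partial>N) * (g u * h v)"
          by (rule nn_integral_multc) measurable
        finally show ?case using elim by simp
      qed
    qed
  qed
  finally show ?thesis .
qed

text \<open>The operator of the transposed root, from \<open>L\<^sup>2(M)\<close> to \<open>L\<^sup>2(N)\<close>.\<close>

definition half :: "('a \<Rightarrow> real) \<Rightarrow> 'b \<Rightarrow> real" where
  "half f w = (LINT v|M. a v w * f v)"

lemma half_measurable [measurable]:
  assumes [measurable]: "f \<in> borel_measurable M"
  shows "half f \<in> borel_measurable N"
  unfolding half_def by measurable

text \<open>The factorization writes the form of the operator as a square norm. The triple integral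
  converges absolutely because its absolute version is the form at \<open>\<bar>f\<bar>\<close>.\<close>

lemma op_form_half:
  assumes f: "f \<in> L2 M"
  shows "integrable N (\<lambda>w. (half f w)\<^sup>2)" and "l2_inner M f (op f) = (LINT w|N. (half f w)\<^sup>2)"
proof -
  have [measurable]: "f \<in> borel_measurable M" using f by (rule L2_measurable)
  define F where "F = (\<lambda>(p, w). a (fst p) w * a (snd p) w * (f (fst p) * f (snd p)))"
  have F_meas [measurable]: "F \<in> borel_measurable ((M \<Otimes>\<^sub>M M) \<Otimes>\<^sub>M N)" unfolding F_def by measurable
  have "(\<integral>\<^sup>+x. ennreal (norm (F x)) \<partial>((M \<Otimes>\<^sub>M M) \<Otimes>\<^sub>M N))
      = (\<integral>\<^sup>+w. \<integral>\<^sup>+p. ennreal (norm (F (p, w))) \<partial>(M \<Otimes>\<^sub>M M) \<partial>N)"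
    by (rule MMN.nn_integral_snd[symmetric]) measurable
  also have "\<dots> = (\<integral>\<^sup>+w. \<integral>\<^sup>+u. \<integral>\<^sup>+v. (ennreal (a u w) * ennreal \<bar>f u\<bar>) * (ennreal (a v w) * ennreal \<bar>f v\<bar>) \<partial>M \<partial>M \<partial>N)"
  proof (intro nn_integral_cong)
    fix w assume [measurable]: "w \<in> space N"
    show "(\<integral>\<^sup>+p. ennreal (norm (F (p, w))) \<partial>(M \<Otimes>\<^sub>M M))
        = (\<integral>\<^sup>+u. \<integral>\<^sup>+v. (ennreal (a u w) * ennreal \<bar>f u\<bar>) * (ennreal (a v w) * ennreal \<bar>f v\<bar>) \<partial>M \<partial>M)"
      by (subst M.nn_integral_fst[symmetric]) (auto simp: F_def abs_mult a_nonneg ennreal_mult mult_ac)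
  qed
  also have "\<dots> = (\<integral>\<^sup>+w. (\<integral>\<^sup>+u. ennreal (a u w) * ennreal \<bar>f u\<bar> \<partial>M) * (\<integral>\<^sup>+v. ennreal (a v w) * ennreal \<bar>f v\<bar> \<partial>M) \<partial>N)"
    by (intro nn_integral_cong) (simp add: nn_integral_cmult nn_integral_multc)
  also have "\<dots> < \<infinity>"
    by (subst nn_factorization) (auto intro: form_nn_finite[OF f f, unfolded infinity_ennreal_def])
  finally have F_int: "integrable ((M \<Otimes>\<^sub>M M) \<Otimes>\<^sub>M N) (case_prod (\<lambda>p w. F (p, w)))"
    by (intro integrableI_bounded) auto
  have inner_p: "AE w in N. (LINT p|(M \<Otimes>\<^sub>M M). F (p, w)) = (half f w)\<^sup>2"
    using MMN.AE_integrable_snd[OF F_int]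
  proof eventually_elim
    case (elim w)
    then have "integrable (M \<Otimes>\<^sub>M M) (\<lambda>(u, v). F ((u, v), w))" by (simp add: case_prod_unfold)
    from MM.integral_fst'[OF this]
    have "(LINT p|(M \<Otimes>\<^sub>M M). F (p, w)) = (LINT u|M. LINT v|M. F ((u, v), w))"
      by (simp add: case_prod_unfold)
    also have "\<dots> = (LINT u|M. LINT v|M. (a u w * f u) * (a v w * f v))"
      by (simp add: F_def mult_ac)
    also have "\<dots> = half f w * half f w" by (simp add: half_def)
    finally show ?case by (simp add: power2_eq_square)
  qed
  have int: "integrable N (\<lambda>w. LINT p|(M \<Otimes>\<^sub>M M). F (p, w))"
    by (rule MMN.integrable_snd[OF F_int])
  show "integrable N (\<lambda>w. (half f w)\<^sup>2)"
    using int by (rule integrable_cong_AE_imp) (use inner_p in auto)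
  have inner_w: "AE p in M \<Otimes>\<^sub>M M. (LINT w|N. F (p, w)) = (case p of (u, v) \<Rightarrow> k u v * (f u * f v))"
  proof (rule MM.AE_pair_measure)
    show "AE u in M. AE v in M. (LINT w|N. F ((u, v), w)) = (case (u, v) of (u, v) \<Rightarrow> k u v * (f u * f v))"
      using AE_space
    proof eventually_elim
      case (elim u)
      then have [measurable]: "u \<in> space M" by simp
      show ?case using factorization[OF elim] AE_space
      proof eventually_elim
        case (elim v)
        then have [measurable]: "v \<in> space M" by simp
        have "(LINT w|N. a u w * a v w) = enn2real (\<integral>\<^sup>+w. ennreal (a u w * a v w) \<partial>N)"
          by (rule integral_eq_nn_integral) (auto simp: a_nonneg)
        also have "\<dots> = k u v" using elim by (simp add: ennreal_mult a_nonneg k_nonneg)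
        finally show ?case by (simp add: F_def)
      qed
    qed
  qed measurable
  have "l2_inner M f (op f) = (LINT p|(M \<Otimes>\<^sub>M M). LINT w|N. F (p, w))"
    unfolding op_form[OF f f] by (rule integral_cong_AE) (use inner_w in auto)
  also have "\<dots> = (LINT w|N. LINT p|(M \<Otimes>\<^sub>M M). F (p, w))"
    by (rule MMN.Fubini_integral[OF F_int, symmetric])
  also have "\<dots> = (LINT w|N. (half f w)\<^sup>2)"
    by (rule integral_cong_AE) (use inner_p in auto)
  finally show "l2_inner M f (op f) = (LINT w|N. (half f w)\<^sup>2)" .
qed

lemma op_nonneg: "f \<in> L2 M \<Longrightarrow> 0 \<le> l2_inner M f (op f)"
  by (simp add: op_form_half)

text \<open>The kernel of the composition of \<open>half\<close> with \<open>op\<close>. The conversion to a real number replaces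
  the value \<open>\<infinity>\<close> by 0, which happens only on a null set whenever the square integral below is finite.\<close>

definition cascade_nn :: "'a \<Rightarrow> 'b \<Rightarrow> ennreal" where
  "cascade_nn u w = (\<integral>\<^sup>+v. ennreal (a v w) * ennreal (k v u) \<partial>M)"

definition cascade :: "'a \<Rightarrow> 'b \<Rightarrow> real" where
  "cascade u w = enn2real (cascade_nn u w)"

lemma cascade_nn_measurable [measurable]: "case_prod cascade_nn \<in> borel_measurable (M \<Otimes>\<^sub>M N)"
  unfolding cascade_nn_def by measurable

lemma cascade_measurable [measurable]: "case_prod cascade \<in> borel_measurable (M \<Otimes>\<^sub>M N)"
  unfolding cascade_def by measurable

lemma half_op_eq:
  assumes f: "f \<in> L2 M"
  shows "AE w in N. half (op f) w = l2_inner M (\<lambda>u. cascade u w) f"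
proof -
  have [measurable]: "f \<in> borel_measurable M" using f by (rule L2_measurable)
  define g where "g v = (\<integral>\<^sup>+u. ennreal (k v u) * ennreal \<bar>f u\<bar> \<partial>M)" for v
  have [measurable]: "g \<in> borel_measurable M" unfolding g_def by measurable
  have "(\<integral>\<^sup>+v. (g v)\<^sup>2 \<partial>M) \<le> (ennreal C)\<^sup>2 * (\<integral>\<^sup>+u. (ennreal \<bar>f u\<bar>)\<^sup>2 \<partial>M)"
    unfolding g_def by (rule nn_op_square_le) measurable
  also have "\<dots> < \<infinity>" using f by (simp add: L2_iff_nn ennreal_power C_nonneg ennreal_mult_less_top)
  finally have g2: "(\<integral>\<^sup>+v. (g v)\<^sup>2 \<partial>M) < \<infinity>" .
  have "(\<integral>\<^sup>+w. (\<integral>\<^sup>+v. ennreal (a v w) * g v \<partial>M) * (\<integral>\<^sup>+v. ennreal (a v w) * g v \<partial>M) \<partial>N) < \<infinity>"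
  proof (subst nn_factorization)
    have "ennreal C * (\<integral>\<^sup>+u. (g u)\<^sup>2 \<partial>M) + ennreal C * (\<integral>\<^sup>+u. (g u)\<^sup>2 \<partial>M) < \<infinity>"
      using g2 by (simp add: ennreal_mult_less_top)
    then show "(\<integral>\<^sup>+u. \<integral>\<^sup>+v. ennreal (k u v) * (g u * g v) \<partial>M \<partial>M) < \<infinity>"
      by (rule le_less_trans[OF form_nn_le, rotated 2]) measurable
  qed measurable
  then have "AE w in N. (\<integral>\<^sup>+v. ennreal (a v w) * g v \<partial>M) * (\<integral>\<^sup>+v. ennreal (a v w) * g v \<partial>M) \<noteq> \<infinity>"
    by (intro nn_integral_PInf_AE) auto
  then show ?thesis using AE_space
  proof eventually_elim
    case (elim w)
    then have [measurable]: "w \<in> space N" by simp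
    have fin: "(\<integral>\<^sup>+v. ennreal (a v w) * g v \<partial>M) < \<infinity>"
      using elim by (auto simp: less_top ennreal_mult_eq_top_iff)
    have int: "integrable (M \<Otimes>\<^sub>M M) (case_prod (\<lambda>v u. a v w * (k v u * f u)))"
    proof (rule integrableI_bounded)
      have "(\<integral>\<^sup>+p. ennreal (norm (case_prod (\<lambda>v u. a v w * (k v u * f u)) p)) \<partial>(M \<Otimes>\<^sub>M M))
          = (\<integral>\<^sup>+v. \<integral>\<^sup>+u. ennreal (a v w) * (ennreal (k v u) * ennreal \<bar>f u\<bar>) \<partial>M \<partial>M)"
        by (subst M.nn_integral_fst[symmetric]) (auto simp: abs_mult k_nonneg a_nonneg ennreal_mult)
      also have "\<dots> = (\<integral>\<^sup>+v. ennreal (a v w) * g v \<partial>M)"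
        unfolding g_def by (intro nn_integral_cong nn_integral_cmult) measurable
      also note fin
      finally show "(\<integral>\<^sup>+p. ennreal (norm (case_prod (\<lambda>v u. a v w * (k v u * f u)) p)) \<partial>(M \<Otimes>\<^sub>M M)) < \<infinity>" .
    qed measurable
    have "half (op f) w = (LINT v|M. LINT u|M. a v w * (k v u * f u))"
      by (simp add: half_def op_def)
    also have "\<dots> = (LINT u|M. LINT v|M. a v w * (k v u * f u))"
      by (rule MM.Fubini_integral[OF int, symmetric])
    also have "\<dots> = (LINT u|M. cascade u w * f u)"
    proof (rule Bochner_Integration.integral_cong[OF refl])
      fix u assume [measurable]: "u \<in> space M"
      have "(LINT v|M. a v w * k v u) = enn2real (\<integral>\<^sup>+v. ennreal (a v w * k v u) \<partial>M)"
        by (rule integral_eq_nn_integral) (auto simp: a_nonneg k_nonneg)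
      then have "(LINT v|M. a v w * k v u) = cascade u w"
        by (simp add: cascade_def cascade_nn_def ennreal_mult a_nonneg k_nonneg)
      then show "(LINT v|M. a v w * (k v u * f u)) = cascade u w * f u"
        by (simp flip: mult.assoc)
    qed
    finally show ?case by (simp add: l2_inner_def)
  qed
qed

text \<open>The squared Hilbert-Schmidt norm of the cascade is the trace of the third power: one factorization
  restores the third copy of \<open>k\<close>.\<close>

lemma cascade_nn_square_integral:
  "(\<integral>\<^sup>+w. \<integral>\<^sup>+u. (cascade_nn u w)\<^sup>2 \<partial>M \<partial>N)
    = (\<integral>\<^sup>+u. \<integral>\<^sup>+v. \<integral>\<^sup>+v'. ennreal (k v v') * (ennreal (k v u) * ennreal (k v' u)) \<partial>M \<partial>M \<partial>M)"
proof -
  have "(\<integral>\<^sup>+w. \<integral>\<^sup>+u. (cascade_nn u w)\<^sup>2 \<partial>M \<partial>N) = (\<integral>\<^sup>+u. \<integral>\<^sup>+w. (cascade_nn u w)\<^sup>2 \<partial>N \<partial>M)"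
    by (rule MN.Fubini') measurable
  also have "\<dots> = (\<integral>\<^sup>+u. \<integral>\<^sup>+v. \<integral>\<^sup>+v'. ennreal (k v v') * (ennreal (k v u) * ennreal (k v' u)) \<partial>M \<partial>M \<partial>M)"
    unfolding cascade_nn_def power2_eq_square by (intro nn_integral_cong nn_factorization) measurable
  finally show ?thesis .
qed

text \<open>The third moment of \<open>f\<close> is \<open>\<parallel>half (op f)\<parallel>\<^sup>2\<close>, and \<open>half (op f) w\<close> is the
  coefficient of \<open>f\<close> in \<open>u \<mapsto> cascade u w\<close>. Bessel's inequality for each \<open>w\<close> and integration
  over \<open>w\<close> bound the sum for an orthonormal pair by the squared Hilbert-Schmidt norm of the
  cascade.\<close>

theorem trace_bound:
  assumes Q: "(\<integral>\<^sup>+u. \<integral>\<^sup>+v. \<integral>\<^sup>+v'. ennreal (k v v') * (ennreal (k v u) * ennreal (k v' u)) \<partial>M \<partial>M \<partial>M) \<le> ennreal Q"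
    and Q0: "0 \<le> Q"
    and f: "f \<in> L2 M" and g: "g \<in> L2 M"
    and orth: "l2_inner M f f = 1" "l2_inner M g g = 1" "l2_inner M f g = 0"
  shows "l2_inner M f (op (op (op f))) + l2_inner M g (op (op (op g))) \<le> Q"
proof -
  have moment: "l2_inner M h (op (op (op h))) = (LINT w|N. (half (op h) w)\<^sup>2)" if "h \<in> L2 M" for h
    using that by (simp add: op_symmetric[symmetric] op_L2 op_form_half(2)[symmetric])
  have [measurable]: "f \<in> borel_measurable M" "g \<in> borel_measurable M"
    using f g by (auto simp: L2_measurable)
  have fin: "(\<integral>\<^sup>+w. \<integral>\<^sup>+u. (cascade_nn u w)\<^sup>2 \<partial>M \<partial>N) \<le> ennreal Q"
    using Q by (simp add: cascade_nn_square_integral)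
  then have "AE w in N. (\<integral>\<^sup>+u. (cascade_nn u w)\<^sup>2 \<partial>M) \<noteq> \<infinity>"
    by (intro nn_integral_PInf_AE) (auto simp: top_unique)
  then have pointwise: "AE w in N. ennreal ((half (op f) w)\<^sup>2 + (half (op g) w)\<^sup>2) \<le> (\<integral>\<^sup>+u. (cascade_nn u w)\<^sup>2 \<partial>M)"
    using half_op_eq[OF f] half_op_eq[OF g] AE_space
  proof eventually_elim
    case (elim w)
    then have [measurable]: "w \<in> space N" by simp
    have le: "ennreal ((cascade u w)\<^sup>2) \<le> (cascade_nn u w)\<^sup>2" for u
      by (cases "cascade_nn u w") (auto simp: cascade_def ennreal_power)
    have 1: "(\<integral>\<^sup>+u. ennreal ((cascade u w)\<^sup>2) \<partial>M) \<le> (\<integral>\<^sup>+u. (cascade_nn u w)\<^sup>2 \<partial>M)"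
      by (intro nn_integral_mono le)
    then have bw: "(\<lambda>u. cascade u w) \<in> L2 M"
      using elim by (auto simp: L2_iff_nn less_top intro: le_less_trans)
    have "ennreal ((half (op f) w)\<^sup>2 + (half (op g) w)\<^sup>2) \<le> ennreal (l2_inner M (\<lambda>u. cascade u w) (\<lambda>u. cascade u w))"
      unfolding elim by (rule ennreal_leI, rule l2_bessel[OF bw f g orth])
    also have "\<dots> = (\<integral>\<^sup>+u. ennreal ((cascade u w)\<^sup>2) \<partial>M)"
      using bw by (simp add: l2_inner_self nn_integral_eq_integral L2_iff)
    also note 1
    finally show ?case .
  qed
  note int = op_form_half(1)[OF op_L2[OF f]] op_form_half(1)[OF op_L2[OF g]]
  have "ennreal (l2_inner M f (op (op (op f))) + l2_inner M g (op (op (op g))))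
      = ennreal (LINT w|N. (half (op f) w)\<^sup>2 + (half (op g) w)\<^sup>2)"
    using int by (simp add: moment f g)
  also have "\<dots> = (\<integral>\<^sup>+w. ennreal ((half (op f) w)\<^sup>2 + (half (op g) w)\<^sup>2) \<partial>N)"
    using int by (intro nn_integral_eq_integral[symmetric]) auto
  also have "\<dots> \<le> (\<integral>\<^sup>+w. \<integral>\<^sup>+u. (cascade_nn u w)\<^sup>2 \<partial>M \<partial>N)"
    using pointwise by (rule nn_integral_mono_AE)
  also note fin
  finally show ?thesis using Q0 by simp
qed

end

section \<open>Integration against the exponential measure\<close>

lemma AE_nu_neq: "AE v in nu. v \<noteq> u"
  unfolding nu_def using AE_lborel_singleton[of u] by (subst AE_density) (auto elim!: eventually_mono)

lemma AE_nu_nonneg: "AE u in nu. 0 \<le> u"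
  unfolding nu_def by (subst AE_density) (auto simp: indicator_def)

lemma nn_integral_lborel_shift:
  fixes f :: "real \<Rightarrow> ennreal"
  assumes "f \<in> borel_measurable borel"
  shows "(\<integral>\<^sup>+x. f x \<partial>lborel) = (\<integral>\<^sup>+x. f (u + x) \<partial>lborel)"
  using nn_integral_real_affine[of f 1 u] assms by simp

text \<open>The exponential law has no memory: beyond \<open>u\<close> it is a scaled copy of itself.\<close>

lemma nu_shift:
  fixes f :: "real \<Rightarrow> ennreal"
  assumes [measurable]: "f \<in> borel_measurable borel" and u: "0 \<le> u"
  shows "(\<integral>\<^sup>+v. indicator {u<..} v * f v \<partial>nu) = ennreal (exp (- u)) * (\<integral>\<^sup>+x. f (u + x) \<partial>nu)"
proof -
  have "(\<integral>\<^sup>+v. indicator {u<..} v * f v \<partial>nu)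
      = (\<integral>\<^sup>+v. ennreal (indicator {0..} v * exp (- v)) * (indicator {u<..} v * f v) \<partial>lborel)"
    by (rule nn_integral_nu) measurable
  also have "\<dots> = (\<integral>\<^sup>+x. ennreal (indicator {0..} (u + x) * exp (- (u + x))) * (indicator {u<..} (u + x) * f (u + x)) \<partial>lborel)"
    by (rule nn_integral_lborel_shift) measurable
  also have "\<dots> = (\<integral>\<^sup>+x. ennreal (exp (- u)) * (ennreal (indicator {0..} x * exp (- x)) * f (u + x)) \<partial>lborel)"
  proof (rule nn_integral_cong_AE)
    have "AE x in lborel. x \<noteq> (0::real)" by (rule AE_lborel_singleton)
    then show "AE x in lborel. ennreal (indicator {0..} (u + x) * exp (- (u + x))) * (indicator {u<..} (u + x) * f (u + x))
        = ennreal (exp (- u)) * (ennreal (indicator {0..} x * exp (- x)) * f (u + x))"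
    proof eventually_elim
      case (elim x)
      show ?case
      proof (cases "0 < x")
        case True
        then have "ennreal (exp (- (u + x))) = ennreal (exp (- u)) * ennreal (exp (- x))"
          by (simp add: ennreal_mult[symmetric] exp_add[symmetric])
        then show ?thesis using True u by (simp add: mult.assoc)
      qed (use elim in simp)
    qed
  qed
  also have "\<dots> = ennreal (exp (- u)) * (\<integral>\<^sup>+x. ennreal (indicator {0..} x * exp (- x)) * f (u + x) \<partial>lborel)"
    by (rule nn_integral_cmult) measurable
  also have "\<dots> = ennreal (exp (- u)) * (\<integral>\<^sup>+x. f (u + x) \<partial>nu)"
    by (subst nn_integral_nu) measurable
  finally show ?thesis .
qed

lemma nu_gamma:
  assumes p: "0 < p" and t: "0 \<le> t"
  shows "(\<integral>\<^sup>+x. ennreal (x powr (p - 1) * exp (- (t * x))) \<partial>nu) = ennreal (Gamma p * (1 + t) powr (- p))"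
proof -
  define c where "c = 1 + t"
  have c: "c > 0" using t by (simp add: c_def)
  have "ennreal (Gamma p) = (\<integral>\<^sup>+x. ennreal (indicator {0..} x * x powr (p - 1) / exp x) \<partial>lborel)"
    by (rule Gamma_conv_nn_integral_real[OF p])
  also have "\<dots> = ennreal c * (\<integral>\<^sup>+x. ennreal (indicator {0..} (c * x) * (c * x) powr (p - 1) / exp (c * x)) \<partial>lborel)"
    by (subst nn_integral_real_affine[where c = c and t = 0]) (use c in auto)
  also have "(\<integral>\<^sup>+x. ennreal (indicator {0..} (c * x) * (c * x) powr (p - 1) / exp (c * x)) \<partial>lborel)
      = (\<integral>\<^sup>+x. ennreal (c powr (p - 1)) * (ennreal (indicator {0..} x * exp (- x)) * ennreal (x powr (p - 1) * exp (- (t * x)))) \<partial>lborel)"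
  proof (intro nn_integral_cong)
    fix x :: real
    show "ennreal (indicator {0..} (c * x) * (c * x) powr (p - 1) / exp (c * x))
        = ennreal (c powr (p - 1)) * (ennreal (indicator {0..} x * exp (- x)) * ennreal (x powr (p - 1) * exp (- (t * x))))"
    proof (cases "0 \<le> x")
      case True
      have "exp (c * x) = exp x * exp (t * x)" by (simp add: c_def exp_add[symmetric] algebra_simps)
      then show ?thesis using True c
        by (simp add: ennreal_mult[symmetric] powr_mult exp_minus field_simps)
    next
      case False
      then show ?thesis using c by (simp add: indicator_def zero_le_mult_iff)
    qed
  qed
  also have "\<dots> = ennreal (c powr (p - 1)) * (\<integral>\<^sup>+x. ennreal (x powr (p - 1) * exp (- (t * x))) \<partial>nu)"
    by (subst nn_integral_cmult) (auto simp: nn_integral_nu)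
  finally have "ennreal (Gamma p) = ennreal (c powr p) * (\<integral>\<^sup>+x. ennreal (x powr (p - 1) * exp (- (t * x))) \<partial>nu)"
    using c by (simp add: mult.assoc[symmetric] ennreal_mult[symmetric] powr_mult_base)
  then have "ennreal (c powr (- p)) * ennreal (Gamma p)
      = (ennreal (c powr (- p)) * ennreal (c powr p)) * (\<integral>\<^sup>+x. ennreal (x powr (p - 1) * exp (- (t * x))) \<partial>nu)"
    by (simp add: mult.assoc)
  also have "ennreal (c powr (- p)) * ennreal (c powr p) = 1"
    using c by (simp add: ennreal_mult[symmetric] powr_minus)
  finally have "(\<integral>\<^sup>+x. ennreal (x powr (p - 1) * exp (- (t * x))) \<partial>nu) = ennreal (c powr (- p)) * ennreal (Gamma p)"
    by simp
  then show ?thesis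
    using Gamma_real_pos[OF p] by (simp add: c_def ennreal_mult[symmetric] mult.commute)
qed

lemma nu_exp:
  assumes "0 \<le> t"
  shows "(\<integral>\<^sup>+x. ennreal (exp (- (t * x))) \<partial>nu) = ennreal (1 / (1 + t))"
proof -
  have "(\<integral>\<^sup>+x. ennreal (exp (- (t * x))) \<partial>nu) = (\<integral>\<^sup>+x. ennreal (x powr (1 - 1) * exp (- (t * x))) \<partial>nu)"
    using AE_nu_neq[of 0] by (intro nn_integral_cong_AE) (auto elim!: eventually_mono)
  also have "\<dots> = ennreal (Gamma 1 * (1 + t) powr (- 1))" by (rule nu_gamma) (use assms in auto)
  finally show ?thesis using assms by (simp add: powr_minus_divide)
qed

lemma greaterThan_indicator_measurable [measurable]:
  "(\<lambda>(u, v). indicator {u<..} v :: ennreal) \<in> borel_measurable (borel \<Otimes>\<^sub>M (borel :: real measure))"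
proof -
  have "(\<lambda>(u :: real, v). indicator {u<..} v :: ennreal) = (\<lambda>p. if fst p < snd p then 1 else 0 :: ennreal)"
    by (auto simp: indicator_def fun_eq_iff)
  then show ?thesis by (simp only:) measurable
qed

interpretation nu2: pair_sigma_finite nu nu ..

text \<open>Measure both variables from the smaller one. By the lack of memory the smaller variable
  integrates out and contributes the factor \<open>1 / (2 + s)\<close>.\<close>

lemma nu_double_by_min:
  fixes F :: "real \<Rightarrow> real \<Rightarrow> ennreal" and G :: "real \<Rightarrow> ennreal"
  assumes F [measurable]: "case_prod F \<in> borel_measurable (borel \<Otimes>\<^sub>M borel)"
    and G [measurable]: "G \<in> borel_measurable borel" and s: "0 \<le> s"
    and FG: "\<And>u x. 0 \<le> u \<Longrightarrow> 0 < x \<Longrightarrow> F u (u + x) + F (u + x) u = ennreal (exp (- (s * u))) * G x"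
  shows "(\<integral>\<^sup>+u. \<integral>\<^sup>+v. F u v \<partial>nu \<partial>nu) = ennreal (1 / (2 + s)) * (\<integral>\<^sup>+x. G x \<partial>nu)"
proof -
  let ?I = "\<lambda>u v. indicator {u<..} v :: ennreal"
  have "(\<integral>\<^sup>+u. \<integral>\<^sup>+v. F u v \<partial>nu \<partial>nu) = (\<integral>\<^sup>+u. \<integral>\<^sup>+v. ?I u v * F u v + ?I v u * F u v \<partial>nu \<partial>nu)"
  proof (rule nn_integral_cong, rule nn_integral_cong_AE)
    fix u
    show "AE v in nu. F u v = ?I u v * F u v + ?I v u * F u v"
      using AE_nu_neq[of u] by eventually_elim (auto simp: indicator_def)
  qed
  also have "\<dots> = (\<integral>\<^sup>+u. \<integral>\<^sup>+v. ?I u v * F u v \<partial>nu \<partial>nu) + (\<integral>\<^sup>+u. \<integral>\<^sup>+v. ?I v u * F u v \<partial>nu \<partial>nu)"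
    by (subst nn_integral_add[symmetric]) (auto intro!: nn_integral_cong nn_integral_add)
  also have "(\<integral>\<^sup>+u. \<integral>\<^sup>+v. ?I v u * F u v \<partial>nu \<partial>nu) = (\<integral>\<^sup>+v. \<integral>\<^sup>+u. ?I v u * F u v \<partial>nu \<partial>nu)"
    by (rule nu2.Fubini') measurable
  also have "(\<integral>\<^sup>+u. \<integral>\<^sup>+v. ?I u v * F u v \<partial>nu \<partial>nu) + (\<integral>\<^sup>+v. \<integral>\<^sup>+u. ?I v u * F u v \<partial>nu \<partial>nu)
      = (\<integral>\<^sup>+u. \<integral>\<^sup>+v. ?I u v * (F u v + F v u) \<partial>nu \<partial>nu)"
    by (subst nn_integral_add[symmetric]) (auto intro!: nn_integral_cong simp: distrib_left nn_integral_add)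
  also have "\<dots> = (\<integral>\<^sup>+u. ennreal (exp (- ((1 + s) * u))) * (\<integral>\<^sup>+x. G x \<partial>nu) \<partial>nu)"
  proof (rule nn_integral_cong_AE)
    show "AE u in nu. (\<integral>\<^sup>+v. ?I u v * (F u v + F v u) \<partial>nu) = ennreal (exp (- ((1 + s) * u))) * (\<integral>\<^sup>+x. G x \<partial>nu)"
      using AE_nu_nonneg
    proof eventually_elim
      case (elim u)
      have "(\<integral>\<^sup>+v. ?I u v * (F u v + F v u) \<partial>nu) = ennreal (exp (- u)) * (\<integral>\<^sup>+x. F u (u + x) + F (u + x) u \<partial>nu)"
        using elim by (intro nu_shift) measurable
      also have "(\<integral>\<^sup>+x. F u (u + x) + F (u + x) u \<partial>nu) = (\<integral>\<^sup>+x. ennreal (exp (- (s * u))) * G x \<partial>nu)"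
        using AE_nu_nonneg AE_nu_neq[of 0]
        by (intro nn_integral_cong_AE, eventually_elim) (use FG[OF elim] in auto)
      also have "\<dots> = ennreal (exp (- (s * u))) * (\<integral>\<^sup>+x. G x \<partial>nu)"
        by (rule nn_integral_cmult) measurable
      also have "ennreal (exp (- u)) * \<dots> = ennreal (exp (- u) * exp (- (s * u))) * (\<integral>\<^sup>+x. G x \<partial>nu)"
        by (simp add: ennreal_mult mult.assoc)
      also have "exp (- u) * exp (- (s * u)) = exp (- ((1 + s) * u))"
        by (simp add: exp_add[symmetric] algebra_simps)
      finally show ?case .
    qed
  qed
  also have "\<dots> = (\<integral>\<^sup>+u. ennreal (exp (- ((1 + s) * u))) \<partial>nu) * (\<integral>\<^sup>+x. G x \<partial>nu)"
    by (rule nn_integral_multc) measurable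
  also have "(\<integral>\<^sup>+u. ennreal (exp (- ((1 + s) * u))) \<partial>nu) = ennreal (1 / (2 + s))"
    using s by (subst nu_exp) auto
  finally show ?thesis .
qed

text \<open>The same with three variables. The three summands in the hypothesis are the cases in which
  the first, the second or the third argument is the smallest.\<close>

lemma nu_triple_by_min:
  fixes F :: "real \<Rightarrow> real \<Rightarrow> real \<Rightarrow> ennreal" and G :: "real \<Rightarrow> real \<Rightarrow> ennreal"
  assumes F [measurable]: "(\<lambda>(u, v, w). F u v w) \<in> borel_measurable (borel \<Otimes>\<^sub>M borel \<Otimes>\<^sub>M borel)"
    and G [measurable]: "case_prod G \<in> borel_measurable (borel \<Otimes>\<^sub>M borel)" and s: "0 \<le> s"
    and FG: "\<And>u x y. 0 \<le> u \<Longrightarrow> 0 < x \<Longrightarrow> 0 < y \<Longrightarrow>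
      F u (u + x) (u + y) + F (u + x) u (u + y) + F (u + x) (u + y) u = ennreal (exp (- (s * u))) * G x y"
  shows "(\<integral>\<^sup>+u. \<integral>\<^sup>+v. \<integral>\<^sup>+w. F u v w \<partial>nu \<partial>nu \<partial>nu)
    = ennreal (1 / (3 + s)) * (\<integral>\<^sup>+x. \<integral>\<^sup>+y. G x y \<partial>nu \<partial>nu)"
proof -
  let ?L = "\<lambda>u v w. F u v w + F v u w + F v w u"
  have F_comp [measurable]: "(\<lambda>x. F (f x) (g x) (h x)) \<in> borel_measurable M"
    if [measurable]: "f \<in> borel_measurable M" "g \<in> borel_measurable M" "h \<in> borel_measurable M"
    for f g h :: "'b \<Rightarrow> real" and M
  proof -
    have "(\<lambda>x. (f x, g x, h x)) \<in> measurable M (borel \<Otimes>\<^sub>M borel \<Otimes>\<^sub>M borel)" by measurable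
    from measurable_compose[OF this F] show ?thesis by simp
  qed
  let ?I = "\<lambda>u v. indicator {u<..} v :: ennreal"
  define T where "T u v w = ?I u v * (?I u w * F u v w)" for u v w
  define T1 where "T1 u v w = ?I v u * (?I v w * F u v w)" for u v w
  define T2 where "T2 u v w = ?I w u * (?I w v * F u v w)" for u v w
  have "(\<integral>\<^sup>+u. \<integral>\<^sup>+v. \<integral>\<^sup>+w. F u v w \<partial>nu \<partial>nu \<partial>nu)
      = (\<integral>\<^sup>+u. \<integral>\<^sup>+v. \<integral>\<^sup>+w. T u v w + T1 u v w + T2 u v w \<partial>nu \<partial>nu \<partial>nu)"
  proof (rule nn_integral_cong, rule nn_integral_cong_AE)
    fix u
    show "AE v in nu. (\<integral>\<^sup>+w. F u v w \<partial>nu) = (\<integral>\<^sup>+w. T u v w + T1 u v w + T2 u v w \<partial>nu)"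
      using AE_nu_neq[of u]
    proof eventually_elim
      case (elim v)
      show ?case
      proof (rule nn_integral_cong_AE)
        show "AE w in nu. F u v w = T u v w + T1 u v w + T2 u v w"
          using AE_nu_neq[of u] AE_nu_neq[of v]
          by eventually_elim (use elim in \<open>auto simp: indicator_def T_def T1_def T2_def\<close>)
      qed
    qed
  qed
  also have "\<dots> = (\<integral>\<^sup>+u. \<integral>\<^sup>+v. \<integral>\<^sup>+w. T u v w \<partial>nu \<partial>nu \<partial>nu)
      + (\<integral>\<^sup>+u. \<integral>\<^sup>+v. \<integral>\<^sup>+w. T1 u v w \<partial>nu \<partial>nu \<partial>nu) + (\<integral>\<^sup>+u. \<integral>\<^sup>+v. \<integral>\<^sup>+w. T2 u v w \<partial>nu \<partial>nu \<partial>nu)"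
    unfolding T_def T1_def T2_def by (simp add: nn_integral_add)
  also have "(\<integral>\<^sup>+u. \<integral>\<^sup>+v. \<integral>\<^sup>+w. T1 u v w \<partial>nu \<partial>nu \<partial>nu) = (\<integral>\<^sup>+v. \<integral>\<^sup>+u. \<integral>\<^sup>+w. T1 u v w \<partial>nu \<partial>nu \<partial>nu)"
    unfolding T1_def by (rule nu2.Fubini') measurable
  also have "(\<integral>\<^sup>+u. \<integral>\<^sup>+v. \<integral>\<^sup>+w. T2 u v w \<partial>nu \<partial>nu \<partial>nu) = (\<integral>\<^sup>+u. \<integral>\<^sup>+w. \<integral>\<^sup>+v. T2 u v w \<partial>nu \<partial>nu \<partial>nu)"
    unfolding T2_def by (rule nn_integral_cong, rule nu2.Fubini') measurable
  also have "\<dots> = (\<integral>\<^sup>+w. \<integral>\<^sup>+u. \<integral>\<^sup>+v. T2 u v w \<partial>nu \<partial>nu \<partial>nu)"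
    unfolding T2_def by (rule nu2.Fubini') measurable
  also have "(\<integral>\<^sup>+u. \<integral>\<^sup>+v. \<integral>\<^sup>+w. T u v w \<partial>nu \<partial>nu \<partial>nu)
      + (\<integral>\<^sup>+v. \<integral>\<^sup>+u. \<integral>\<^sup>+w. T1 u v w \<partial>nu \<partial>nu \<partial>nu) + (\<integral>\<^sup>+w. \<integral>\<^sup>+u. \<integral>\<^sup>+v. T2 u v w \<partial>nu \<partial>nu \<partial>nu)
      = (\<integral>\<^sup>+u. \<integral>\<^sup>+v. \<integral>\<^sup>+w. T u v w + T1 v u w + T2 v w u \<partial>nu \<partial>nu \<partial>nu)"
    unfolding T_def T1_def T2_def by (simp add: nn_integral_add)
  also have "\<dots> = (\<integral>\<^sup>+u. \<integral>\<^sup>+v. ?I u v * (\<integral>\<^sup>+w. ?I u w * (?L u v w) \<partial>nu) \<partial>nu \<partial>nu)"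
    unfolding T_def T1_def T2_def
    by (intro nn_integral_cong, subst nn_integral_cmult[symmetric]) (auto intro!: nn_integral_cong simp: indicator_def)
  also have "\<dots> = (\<integral>\<^sup>+u. ennreal (exp (- ((2 + s) * u))) * (\<integral>\<^sup>+x. \<integral>\<^sup>+y. G x y \<partial>nu \<partial>nu) \<partial>nu)"
  proof (rule nn_integral_cong_AE)
    show "AE u in nu. (\<integral>\<^sup>+v. ?I u v * (\<integral>\<^sup>+w. ?I u w * (?L u v w) \<partial>nu) \<partial>nu)
        = ennreal (exp (- ((2 + s) * u))) * (\<integral>\<^sup>+x. \<integral>\<^sup>+y. G x y \<partial>nu \<partial>nu)"
      using AE_nu_nonneg
    proof eventually_elim
      case (elim u)
      have "(\<integral>\<^sup>+v. ?I u v * (\<integral>\<^sup>+w. ?I u w * (?L u v w) \<partial>nu) \<partial>nu)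
          = (\<integral>\<^sup>+v. ?I u v * (ennreal (exp (- u)) * (\<integral>\<^sup>+y. F u v (u + y) + F v u (u + y) + F v (u + y) u \<partial>nu)) \<partial>nu)"
        using elim by (intro nn_integral_cong arg_cong2[where f = times] refl nu_shift) measurable
      also have "\<dots> = ennreal (exp (- u)) * (\<integral>\<^sup>+x. ennreal (exp (- u)) *
          (\<integral>\<^sup>+y. ?L u (u + x) (u + y) \<partial>nu) \<partial>nu)"
        using elim by (intro nu_shift) measurable
      also have "(\<integral>\<^sup>+x. ennreal (exp (- u)) *
            (\<integral>\<^sup>+y. ?L u (u + x) (u + y) \<partial>nu) \<partial>nu)
          = (\<integral>\<^sup>+x. ennreal (exp (- u)) * (\<integral>\<^sup>+y. ennreal (exp (- (s * u))) * G x y \<partial>nu) \<partial>nu)"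
        using AE_nu_nonneg AE_nu_neq[of 0]
      proof (intro nn_integral_cong_AE, eventually_elim)
        case (elim x)
        then have x: "0 < x" by simp
        have "(\<integral>\<^sup>+y. ?L u (u + x) (u + y) \<partial>nu)
            = (\<integral>\<^sup>+y. ennreal (exp (- (s * u))) * G x y \<partial>nu)"
          using AE_nu_nonneg AE_nu_neq[of 0]
          by (intro nn_integral_cong_AE, eventually_elim) (use FG[OF \<open>0 \<le> u\<close> x] in auto)
        then show ?case by simp
      qed
      also have "\<dots> = ennreal (exp (- u)) * (ennreal (exp (- (s * u))) * (\<integral>\<^sup>+x. \<integral>\<^sup>+y. G x y \<partial>nu \<partial>nu))"
        by (simp add: nn_integral_cmult)
      also have "ennreal (exp (- u)) * \<dots>
          = ennreal (exp (- u) * exp (- u) * exp (- (s * u))) * (\<integral>\<^sup>+x. \<integral>\<^sup>+y. G x y \<partial>nu \<partial>nu)"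
        by (simp add: ennreal_mult mult.assoc)
      also have "exp (- u) * exp (- u) * exp (- (s * u)) = exp (- ((2 + s) * u))"
        by (simp add: exp_add[symmetric] algebra_simps)
      finally show ?case .
    qed
  qed
  also have "\<dots> = (\<integral>\<^sup>+u. ennreal (exp (- ((2 + s) * u))) \<partial>nu) * (\<integral>\<^sup>+x. \<integral>\<^sup>+y. G x y \<partial>nu \<partial>nu)"
    by (rule nn_integral_multc) measurable
  also have "(\<integral>\<^sup>+u. ennreal (exp (- ((2 + s) * u))) \<partial>nu) = ennreal (1 / (3 + s))"
    using s by (subst nu_exp) auto
  finally show ?thesis .
qed

section \<open>The Riesz kernel\<close>

lemma nn_integral_Beta:
  assumes "0 < a" "0 < (b :: real)"
  shows "(\<integral>\<^sup>+x. indicator {0..1} x * ennreal (x powr (a - 1) * (1 - x) powr (b - 1)) \<partial>lborel) = ennreal (Beta a b)"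
  using nn_integral_has_integral_lebesgue'[OF _ has_integral_Beta_real[OF assms]] by (simp add: mult.commute)

lemma Gamma_legendre_duplication_real:
  fixes x :: real
  assumes "0 < x"
  shows "Gamma x * Gamma (x + 1 / 2) = 2 powr (1 - 2 * x) * sqrt pi * Gamma (2 * x)"
proof -
  have nonpos: "complex_of_real y \<notin> \<int>\<^sub>\<le>\<^sub>0" if "0 < y" for y
    using that by (auto elim!: nonpos_Ints_cases simp: complex_eq_iff)
  have "complex_of_real (Gamma x * Gamma (x + 1 / 2)) = Gamma (complex_of_real x) * Gamma (complex_of_real x + 1 / 2)"
    using Gamma_complex_of_real[of "x + 1/2"] by (simp add: Gamma_complex_of_real)
  also have "\<dots> = exp ((1 - 2 * complex_of_real x) * of_real (ln 2)) * of_real (sqrt pi) * Gamma (2 * complex_of_real x)"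
    using nonpos[of x] nonpos[of "x + 1/2"] assms by (intro Gamma_legendre_duplication) auto
  also have "\<dots> = complex_of_real (exp ((1 - 2 * x) * ln 2) * sqrt pi * Gamma (2 * x))"
    using Gamma_complex_of_real[of "2 * x"] exp_of_real[of "(1 - 2 * x) * ln 2", where 'a = complex]
    by simp
  finally show ?thesis unfolding of_real_eq_iff by (simp add: powr_def)
qed

lemma beta_half:
  assumes \<alpha>: "0 < \<alpha>" "\<alpha> < 1"
  shows "(\<integral>\<^sup>+z. indicator {0..1} z * ennreal (z powr (- \<alpha>) * (1 - z) powr (- \<alpha>) * \<bar>1 - 2 * z\<bar> powr (- \<alpha>)) \<partial>lborel)
    = ennreal (4 powr \<alpha> / 2 * Beta ((1 - \<alpha>) / 2) (1 - \<alpha>))"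
proof -
  let ?f = "\<lambda>z. indicator {0..1} z * ennreal (z powr (- \<alpha>) * (1 - z) powr (- \<alpha>) * \<bar>1 - 2 * z\<bar> powr (- \<alpha>))"
  let ?s = "\<lambda>q. ennreal ((q\<^sup>2) powr ((1 - \<alpha>) / 2 - 1) * (1 - q\<^sup>2) powr (1 - \<alpha> - 1) * (2 * q) * indicator {0..1} q)"
  \<comment> \<open>\<open>z = (1 - q) / 2\<close> turns \<open>z (1 - z)\<close> into \<open>(1 - q\<^sup>2) / 4\<close> and \<open>1 - 2 z\<close> into \<open>q\<close>; by symmetry in
    \<open>q\<close> it then suffices to substitute \<open>x = q\<^sup>2\<close> on the unit interval.\<close>
  define g :: "real \<Rightarrow> ennreal" where
    "g q = indicator {-1..1} q * ennreal (\<bar>q\<bar> powr (- \<alpha>) * (1 - q\<^sup>2) powr (- \<alpha>))" for q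
  have [measurable]: "g \<in> borel_measurable borel" unfolding g_def by measurable
  have "(\<integral>\<^sup>+z. ?f z \<partial>lborel)
      = ennreal (1 / 2) * (\<integral>\<^sup>+q. ?f (1 / 2 - 1 / 2 * q) \<partial>lborel)"
    by (subst nn_integral_real_affine[where c = "- 1 / 2" and t = "1 / 2"]) auto
  also have "(\<integral>\<^sup>+q. ?f (1 / 2 - 1 / 2 * q) \<partial>lborel)
      = (\<integral>\<^sup>+q. ennreal (4 powr \<alpha>) * g q \<partial>lborel)"
  proof (intro nn_integral_cong)
    fix q :: real
    have "(1 / 2 - 1 / 2 * q) powr (- \<alpha>) * (1 - (1 / 2 - 1 / 2 * q)) powr (- \<alpha>) = 4 powr \<alpha> * (1 - q\<^sup>2) powr (- \<alpha>)"
      if "-1 \<le> q" "q \<le> 1"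
    proof -
      have "(1 / 2 - 1 / 2 * q) powr (- \<alpha>) * (1 - (1 / 2 - 1 / 2 * q)) powr (- \<alpha>)
          = ((1 / 2 - 1 / 2 * q) * (1 - (1 / 2 - 1 / 2 * q))) powr (- \<alpha>)"
        by (rule powr_mult[symmetric])
      also have "(1 / 2 - 1 / 2 * q) * (1 - (1 / 2 - 1 / 2 * q)) = (1 / 4) * (1 - q\<^sup>2)"
        by (simp add: field_simps power2_eq_square)
      also have "\<dots> powr (- \<alpha>) = (1 / 4) powr (- \<alpha>) * (1 - q\<^sup>2) powr (- \<alpha>)"
        by (rule powr_mult)
      finally show ?thesis by (simp add: powr_minus powr_divide)
    qed
    then show "?f (1 / 2 - 1 / 2 * q)
        = ennreal (4 powr \<alpha>) * g q"
      by (auto simp: g_def indicator_def ennreal_mult[symmetric] mult_ac)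
  qed
  also have "\<dots> = ennreal (4 powr \<alpha>) * (\<integral>\<^sup>+q. g q \<partial>lborel)" by (rule nn_integral_cmult) measurable
  also have "(\<integral>\<^sup>+q. g q \<partial>lborel) = (\<integral>\<^sup>+q. indicator {0..1} q * g q + indicator {0..1} (- q) * g (- q) \<partial>lborel)"
  proof (rule nn_integral_cong_AE)
    show "AE q in lborel. g q = indicator {0..1} q * g q + indicator {0..1} (- q) * g (- q)"
      using AE_lborel_singleton[of 0]
      by eventually_elim (auto simp: g_def indicator_def)
  qed
  also have "\<dots> = (\<integral>\<^sup>+q. indicator {0..1} q * g q \<partial>lborel) + (\<integral>\<^sup>+q. indicator {0..1} (- q) * g (- q) \<partial>lborel)"
    by (rule nn_integral_add) measurable
  also have "(\<integral>\<^sup>+q. indicator {0..1} (- q) * g (- q) \<partial>lborel) = (\<integral>\<^sup>+q. indicator {0..1} q * g q \<partial>lborel)"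
    by (subst (2) nn_integral_real_affine[where c = "-1" and t = 0]) auto
  also have "(\<integral>\<^sup>+q. indicator {0..1} q * g q \<partial>lborel) + (\<integral>\<^sup>+q. indicator {0..1} q * g q \<partial>lborel)
      = (\<integral>\<^sup>+q. ?s q \<partial>lborel)"
  proof -
    have "(\<integral>\<^sup>+q. indicator {0..1} q * g q \<partial>lborel) + (\<integral>\<^sup>+q. indicator {0..1} q * g q \<partial>lborel)
        = (\<integral>\<^sup>+q. indicator {0..1} q * g q + indicator {0..1} q * g q \<partial>lborel)"
      by (rule nn_integral_add[symmetric]) measurable
    also have "\<dots> = (\<integral>\<^sup>+q. ?s q \<partial>lborel)"
    proof (rule nn_integral_cong_AE)
      show "AE q in lborel. indicator {0..1} q * g q + indicator {0..1} q * g q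
        = ?s q"
        using AE_lborel_singleton[of 0]
      proof eventually_elim
        case (elim q)
        have "(q\<^sup>2) powr ((1 - \<alpha>) / 2 - 1) * q = q powr (- \<alpha>)" if "0 < q"
        proof -
          have "(q\<^sup>2) powr ((1 - \<alpha>) / 2 - 1) = q powr (2 * ((1 - \<alpha>) / 2 - 1))"
            using that by (simp add: powr_powr flip: powr_numeral)
          also have "2 * ((1 - \<alpha>) / 2 - 1) = - 1 - \<alpha>" by (simp add: field_simps)
          finally show ?thesis using that powr_mult_base[of q "- 1 - \<alpha>"] by (simp add: mult.commute)
        qed
        note key = this
        show ?case
        proof (cases "0 < q \<and> q \<le> 1")
          case True
          define m where "m = q powr (- \<alpha>) * (1 - q\<^sup>2) powr (- \<alpha>)"
          have "m \<ge> 0" by (simp add: m_def)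
          have "(q\<^sup>2) powr ((1 - \<alpha>) / 2 - 1) * (1 - q\<^sup>2) powr (1 - \<alpha> - 1) * (2 * q)
              = 2 * ((q\<^sup>2) powr ((1 - \<alpha>) / 2 - 1) * q) * (1 - q\<^sup>2) powr (- \<alpha>)"
            by simp
          also have "\<dots> = m + m" using True by (simp add: key m_def)
          finally have "(q\<^sup>2) powr ((1 - \<alpha>) / 2 - 1) * (1 - q\<^sup>2) powr (1 - \<alpha> - 1) * (2 * q) = m + m" .
          moreover have "g q = ennreal m" using True by (simp add: g_def m_def)
          ultimately show ?thesis using True \<open>m \<ge> 0\<close> by (simp add: ennreal_plus[symmetric] del: ennreal_plus)
        qed (use elim in \<open>auto simp: indicator_def\<close>)
      qed
    qed
    finally show ?thesis .
  qed
  also have "\<dots> = (\<integral>\<^sup>+x. ennreal (x powr ((1 - \<alpha>) / 2 - 1) * (1 - x) powr (1 - \<alpha> - 1) * indicator {0\<^sup>2..1\<^sup>2} x) \<partial>lborel)"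
    by (rule nn_integral_substitution[symmetric, where g = "\<lambda>x. x\<^sup>2" and g' = "\<lambda>x. 2 * x"])
      (auto intro!: derivative_eq_intros continuous_intros simp: set_borel_measurable_def)
  also have "\<dots> = ennreal (Beta ((1 - \<alpha>) / 2) (1 - \<alpha>))"
    using nn_integral_Beta[of "(1 - \<alpha>) / 2" "1 - \<alpha>"] \<alpha>
    by (simp add: indicator_mult_ennreal mult.commute ennreal_mult' ennreal_indicator)
  also have "ennreal (1 / 2) * (ennreal (4 powr \<alpha>) * ennreal (Beta ((1 - \<alpha>) / 2) (1 - \<alpha>)))
      = ennreal (1 / 2 * (4 powr \<alpha> * Beta ((1 - \<alpha>) / 2) (1 - \<alpha>)))"
  proof -
    have "0 \<le> Beta ((1 - \<alpha>) / 2) (1 - \<alpha>)"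
      using \<alpha> by (auto simp: Beta_def intro!: divide_nonneg_nonneg mult_nonneg_nonneg less_imp_le[OF Gamma_real_pos] add_pos_pos)
    then show ?thesis by (simp only: ennreal_mult mult_nonneg_nonneg powr_ge_zero divide_nonneg_nonneg zero_le_one zero_le_numeral)
  qed
  finally show ?thesis by simp
qed

text \<open>Legendre's duplication formula, used at \<open>1 - 3\<alpha>/2\<close> and at \<open>(1 - \<alpha>)/2\<close>.\<close>

lemma Q3_by_duplication:
  assumes \<alpha>: "0 < \<alpha>" "\<alpha> \<le> 1 / 2"
  shows "Gamma (2 - 3 * \<alpha>) * (4 powr \<alpha> / 2 * Beta ((1 - \<alpha>) / 2) (1 - \<alpha>)) = Q3 \<alpha>"
proof -
  define a b c where "a = Gamma (1 - 3 * \<alpha> / 2)" and "b = Gamma (3 / 2 - 3 * \<alpha> / 2)" and "c = Gamma (2 - 3 * \<alpha>)"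
  define d e f where "d = Gamma ((1 - \<alpha>) / 2)" and "e = Gamma (1 - \<alpha> / 2)" and "f = Gamma (1 - \<alpha>)"
  have pos: "a > 0" "b > 0" "c > 0" "d > 0" "e > 0" "f > 0"
    unfolding a_def b_def c_def d_def e_def f_def using \<alpha> by (auto intro!: Gamma_real_pos)
  have 1: "a * b = 2 powr (3 * \<alpha> - 1) * sqrt pi * c"
    using Gamma_legendre_duplication_real[of "1 - 3 * \<alpha> / 2"] \<alpha>
    by (simp add: a_def b_def c_def algebra_simps)
  have 2: "d * e = 2 powr \<alpha> * sqrt pi * f"
  proof -
    have "(1 - \<alpha>) / 2 + 1 / 2 = 1 - \<alpha> / 2" "1 - 2 * ((1 - \<alpha>) / 2) = \<alpha>" "2 * ((1 - \<alpha>) / 2) = 1 - \<alpha>"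
      by (simp_all add: field_simps)
    note eqs = this
    have "0 < (1 - \<alpha>) / 2" using \<alpha> by simp
    from Gamma_legendre_duplication_real[OF this] show ?thesis
      unfolding eqs d_def e_def f_def by simp
  qed
  have beta: "Beta ((1 - \<alpha>) / 2) (1 - \<alpha>) = d * f / b"
    by (simp add: Beta_def d_def f_def b_def field_simps)
  have p4: "4 powr \<alpha> = 2 powr (2 * \<alpha>)" by (simp add: powr_powr[symmetric])
  have p: "2 powr (3 * \<alpha> - 1) = 2 powr (2 * \<alpha>) * 2 powr \<alpha> / 2"
    by (simp add: powr_diff powr_add[symmetric])
  have "c * (4 powr \<alpha> / 2 * (d * f / b)) = f\<^sup>2 * a / e"
  proof -
    define A B S where "A = (2 :: real) powr (2 * \<alpha>)" and "B = (2 :: real) powr \<alpha>" and "S = sqrt pi"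
    have ABS: "A > 0" "B > 0" "S > 0" by (simp_all add: A_def B_def S_def)
    have c: "c = a * b / (A * B / 2 * S)"
      using 1 ABS unfolding p A_def[symmetric] B_def[symmetric] S_def[symmetric] by (simp add: field_simps)
    have d: "d = B * S * f / e" using 2 pos by (simp add: B_def S_def field_simps)
    have "a * b / (A * B / 2 * S) * (A / 2 * (B * S * f / e * f / b)) = f\<^sup>2 * a / e"
      using ABS pos by (simp add: power2_eq_square)
    then show ?thesis unfolding p4 A_def[symmetric] c[symmetric] d[symmetric] .
  qed
  then show ?thesis unfolding beta Q3_def by (simp add: a_def c_def e_def f_def)
qed

text \<open>This is \<open>\<langle>g, S\<^sub>\<alpha> g\<rangle>\<close> for \<open>g(x) = x\<^sup>-\<^sup>\<alpha>\<close>, to which the trace of \<open>S\<^sub>\<alpha>\<^sup>3\<close> reduces.\<close>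

lemma nu_triangle_integral:
  assumes \<alpha>: "0 < \<alpha>" "\<alpha> \<le> 1 / 2"
  shows "(\<integral>\<^sup>+x. \<integral>\<^sup>+y. ennreal (x powr (- \<alpha>) * y powr (- \<alpha>) * \<bar>x - y\<bar> powr (- \<alpha>)) \<partial>nu \<partial>nu) = ennreal (Q3 \<alpha>)"
proof -
  let ?G = "\<lambda>x y. ennreal (x powr (- \<alpha>) * y powr (- \<alpha>) * \<bar>x - y\<bar> powr (- \<alpha>))"
  define f :: "real \<Rightarrow> real \<Rightarrow> ennreal" where
    "f x y = indicator {0..} x * indicator {0..} y * ennreal (exp (- (x + y)) * (x powr (- \<alpha>) * y powr (- \<alpha>) * \<bar>x - y\<bar> powr (- \<alpha>)))" for x y
  have f [measurable]: "case_prod f \<in> borel_measurable (borel \<Otimes>\<^sub>M borel)" unfolding f_def by measurable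
  define D where "D = 4 powr \<alpha> / 2 * Beta ((1 - \<alpha>) / 2) (1 - \<alpha>)"
  have "(\<integral>\<^sup>+x. \<integral>\<^sup>+y. ?G x y \<partial>nu \<partial>nu) = (\<integral>\<^sup>+x. \<integral>\<^sup>+y. f x y \<partial>lborel \<partial>lborel)"
  proof (subst nn_integral_nu)
    show "(\<integral>\<^sup>+x. ennreal (indicator {0..} x * exp (- x)) * (\<integral>\<^sup>+y. ?G x y \<partial>nu) \<partial>lborel)
        = (\<integral>\<^sup>+x. \<integral>\<^sup>+y. f x y \<partial>lborel \<partial>lborel)"
    proof (rule nn_integral_cong)
      fix x :: real
      have "ennreal (indicator {0..} x * exp (- x)) * (\<integral>\<^sup>+y. ?G x y \<partial>nu)
          = (\<integral>\<^sup>+y. ennreal (indicator {0..} x * exp (- x)) * (ennreal (indicator {0..} y * exp (- y)) *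
              ?G x y) \<partial>lborel)"
        by (subst nn_integral_nu) (measurable, rule nn_integral_cmult[symmetric], measurable)
      also have "\<dots> = (\<integral>\<^sup>+y. f x y \<partial>lborel)"
        by (intro nn_integral_cong) (auto simp: f_def indicator_def ennreal_mult[symmetric] exp_add[symmetric] mult_ac)
      finally show "ennreal (indicator {0..} x * exp (- x)) * (\<integral>\<^sup>+y. ?G x y \<partial>nu)
          = (\<integral>\<^sup>+y. f x y \<partial>lborel)" .
    qed
  qed measurable
  \<comment> \<open>Pass to \<open>r = x + y\<close>; the weight then depends on \<open>r\<close> alone, and the scaling \<open>x = r z\<close>
    separates the variables.\<close>
  also have "\<dots> = (\<integral>\<^sup>+x. \<integral>\<^sup>+r. f x (r - x) \<partial>lborel \<partial>lborel)"
  proof (rule nn_integral_cong)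
    fix x :: real
    show "(\<integral>\<^sup>+y. f x y \<partial>lborel) = (\<integral>\<^sup>+r. f x (r - x) \<partial>lborel)"
      using nn_integral_lborel_shift[of "f x" "- x"] by simp
  qed
  also have "\<dots> = (\<integral>\<^sup>+r. \<integral>\<^sup>+x. f x (r - x) \<partial>lborel \<partial>lborel)"
    by (rule lborel_pair.Fubini') measurable
  also have "\<dots> = (\<integral>\<^sup>+r. ennreal (indicator {0..} r * exp (- r)) * (ennreal (r powr (2 - 3 * \<alpha> - 1)) * ennreal D) \<partial>lborel)"
  proof (rule nn_integral_cong_AE)
    show "AE r in lborel. (\<integral>\<^sup>+x. f x (r - x) \<partial>lborel)
        = ennreal (indicator {0..} r * exp (- r)) * (ennreal (r powr (2 - 3 * \<alpha> - 1)) * ennreal D)"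
      using AE_lborel_singleton[of 0]
    proof eventually_elim
      case (elim r)
      show ?case
      proof (cases "0 < r")
        case False
        then have "f x (r - x) = 0" for x using elim by (auto simp: f_def indicator_def)
        then show ?thesis using False elim by (simp add: indicator_def)
      next
        case True
        let ?g = "\<lambda>z. indicator {0..1} z * ennreal (z powr (- \<alpha>) * (1 - z) powr (- \<alpha>) * \<bar>1 - 2 * z\<bar> powr (- \<alpha>))"
        have "(\<integral>\<^sup>+x. f x (r - x) \<partial>lborel) = ennreal r * (\<integral>\<^sup>+z. f (r * z) (r - r * z) \<partial>lborel)"
          using True nn_integral_real_affine[of "\<lambda>x. f x (r - x)" r 0] by simp
        also have "(\<integral>\<^sup>+z. f (r * z) (r - r * z) \<partial>lborel)
            = (\<integral>\<^sup>+z. ennreal (exp (- r) * r powr (- 3 * \<alpha>)) * ?g z \<partial>lborel)"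
        proof (rule nn_integral_cong)
          fix z :: real
          have e: "r - r * z = r * (1 - z)" "r * z - r * (1 - z) = - (r * (1 - 2 * z))" by (simp_all add: algebra_simps)
          have ind: "indicator {0..} (r * z) * indicator {0..} (r * (1 - z)) = (indicator {0..1} z :: ennreal)"
            using True by (auto simp: indicator_def zero_le_mult_iff)
          have "r powr (- 3 * \<alpha>) = r powr (- \<alpha>) * r powr (- \<alpha>) * r powr (- \<alpha>)"
            by (simp add: powr_add[symmetric])
          then have "exp (- (r * z + r * (1 - z))) * ((r * z) powr (- \<alpha>) * (r * (1 - z)) powr (- \<alpha>) * \<bar>- (r * (1 - 2 * z))\<bar> powr (- \<alpha>))
              = (exp (- r) * r powr (- 3 * \<alpha>)) * (z powr (- \<alpha>) * (1 - z) powr (- \<alpha>) * \<bar>1 - 2 * z\<bar> powr (- \<alpha>))"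
            using True by (simp add: powr_mult abs_mult distrib_left[symmetric] mult_ac)
          then show "f (r * z) (r - r * z) = ennreal (exp (- r) * r powr (- 3 * \<alpha>)) * ?g z"
            unfolding f_def e ind by (simp add: ennreal_mult mult_ac)
        qed
        also have "\<dots> = ennreal (exp (- r) * r powr (- 3 * \<alpha>)) * ennreal D"
          using beta_half[of \<alpha>] \<alpha> by (subst nn_integral_cmult) (auto simp: D_def)
        also have "ennreal r * \<dots> = ennreal (r * (exp (- r) * r powr (- 3 * \<alpha>))) * ennreal D"
          using True by (simp add: ennreal_mult mult.assoc)
        also have "r * (exp (- r) * r powr (- 3 * \<alpha>)) = exp (- r) * r powr (2 - 3 * \<alpha> - 1)"
          using True powr_mult_base[of r "- 3 * \<alpha>"] by (simp add: mult_ac)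
        finally show ?thesis using True by (simp add: ennreal_mult mult.assoc)
      qed
    qed
  qed
  also have "\<dots> = (\<integral>\<^sup>+r. ennreal (r powr (2 - 3 * \<alpha> - 1)) * ennreal D \<partial>nu)"
    by (rule nn_integral_nu[symmetric]) measurable
  also have "\<dots> = (\<integral>\<^sup>+r. ennreal (r powr (2 - 3 * \<alpha> - 1) * exp (- (0 * r))) \<partial>nu) * ennreal D"
    by (subst nn_integral_multc) auto
  also have "\<dots> = ennreal (Gamma (2 - 3 * \<alpha>)) * ennreal D"
    using \<alpha> by (subst nu_gamma) auto
  also have "\<dots> = ennreal (Q3 \<alpha>)"
    using \<alpha> Q3_by_duplication[OF \<alpha>] by (simp add: D_def ennreal_mult'[symmetric] Gamma_real_pos less_imp_le)
  finally show ?thesis .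
qed

text \<open>The kernel product is symmetric in the three variables, so each choice of the smallest one
  contributes the same, and the factor 3 cancels the mass \<open>1 / 3\<close> of the smallest variable.\<close>

lemma nu_trace_integral:
  assumes \<alpha>: "0 < \<alpha>" "\<alpha> \<le> 1 / 2"
  shows "(\<integral>\<^sup>+u. \<integral>\<^sup>+v. \<integral>\<^sup>+w. ennreal (\<bar>v - w\<bar> powr (- \<alpha>)) * (ennreal (\<bar>v - u\<bar> powr (- \<alpha>)) * ennreal (\<bar>w - u\<bar> powr (- \<alpha>))) \<partial>nu \<partial>nu \<partial>nu)
    = ennreal (Q3 \<alpha>)"
proof -
  let ?G = "\<lambda>x y :: real. ennreal (3 * (x powr (- \<alpha>) * y powr (- \<alpha>) * \<bar>x - y\<bar> powr (- \<alpha>)))"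
  have "(\<integral>\<^sup>+u. \<integral>\<^sup>+v. \<integral>\<^sup>+w. ennreal (\<bar>v - w\<bar> powr (- \<alpha>)) * (ennreal (\<bar>v - u\<bar> powr (- \<alpha>)) * ennreal (\<bar>w - u\<bar> powr (- \<alpha>))) \<partial>nu \<partial>nu \<partial>nu)
    = ennreal (1 / (3 + 0)) * (\<integral>\<^sup>+x. \<integral>\<^sup>+y. ?G x y \<partial>nu \<partial>nu)"
    by (rule nu_triple_by_min)
      (auto simp: ennreal_mult[symmetric] ennreal_plus[symmetric] abs_minus_commute mult_ac simp del: ennreal_plus)
  also have "(\<integral>\<^sup>+x. \<integral>\<^sup>+y. ?G x y \<partial>nu \<partial>nu) = ennreal 3 * (\<integral>\<^sup>+x. \<integral>\<^sup>+y. ennreal (x powr (- \<alpha>) * y powr (- \<alpha>) * \<bar>x - y\<bar> powr (- \<alpha>)) \<partial>nu \<partial>nu)"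
    by (simp add: ennreal_mult nn_integral_cmult)
  also have "ennreal (1 / (3 + 0)) * \<dots> = (ennreal (1 / 3) * ennreal 3) * ennreal (Q3 \<alpha>)"
    unfolding nu_triangle_integral[OF \<alpha>] by (simp add: mult.assoc)
  also have "ennreal (1 / 3) * ennreal 3 = 1" by (subst ennreal_mult[symmetric]) auto
  finally show ?thesis by simp
qed

lemma nn_integral_abs_gamma:
  assumes "0 < p"
  shows "(\<integral>\<^sup>+x. ennreal (\<bar>x\<bar> powr (p - 1) * exp (- \<bar>x\<bar>)) \<partial>lborel) = ennreal (2 * Gamma p)"
proof -
  let ?g = "\<lambda>x::real. ennreal (indicator {0..} x * x powr (p - 1) / exp x)"
  have g: "(\<integral>\<^sup>+x. ?g x \<partial>lborel) = ennreal (Gamma p)"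
    using Gamma_conv_nn_integral_real[OF assms] by simp
  have "(\<integral>\<^sup>+x. ennreal (\<bar>x\<bar> powr (p - 1) * exp (- \<bar>x\<bar>)) \<partial>lborel) = (\<integral>\<^sup>+x. ?g x + ?g (- x) \<partial>lborel)"
  proof (rule nn_integral_cong_AE)
    show "AE x in lborel. ennreal (\<bar>x\<bar> powr (p - 1) * exp (- \<bar>x\<bar>)) = ?g x + ?g (- x)"
      using AE_lborel_singleton[of 0] by eventually_elim (auto simp: indicator_def exp_minus field_simps)
  qed
  also have "\<dots> = (\<integral>\<^sup>+x. ?g x \<partial>lborel) + (\<integral>\<^sup>+x. ?g (- x) \<partial>lborel)"
    by (rule nn_integral_add) measurable
  also have "(\<integral>\<^sup>+x. ?g (- x) \<partial>lborel) = (\<integral>\<^sup>+x. ?g x \<partial>lborel)"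
    by (subst (2) nn_integral_real_affine[where c = "-1" and t = 0]) auto
  finally show ?thesis unfolding g using Gamma_real_pos[OF assms] by (simp flip: ennreal_plus)
qed

text \<open>Within distance 1 of the singularity the weight \<open>exp (- v) \<le> 1\<close> costs at most a factor \<open>exp 1\<close>
  against \<open>exp (- \<bar>u - v\<bar>)\<close>; farther away the kernel is at most 1.\<close>

lemma riesz_kernel_schur_bound:
  assumes \<alpha>: "0 < \<alpha>" "\<alpha> < 1"
  shows "(\<integral>\<^sup>+v. ennreal (\<bar>u - v\<bar> powr (- \<alpha>)) \<partial>nu) \<le> ennreal (1 + exp 1 * (2 * Gamma (1 - \<alpha>)))"
proof -
  let ?h = "\<lambda>x::real. \<bar>x\<bar> powr (- \<alpha>) * exp (- \<bar>x\<bar>)"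
  have pointwise: "\<bar>x\<bar> powr (- \<alpha>) * exp (- v) \<le> exp (- v) + exp 1 * ?h x" if "0 \<le> v" for x v :: real
  proof (cases "\<bar>x\<bar> \<le> 1")
    case True
    have "\<bar>x\<bar> powr (- \<alpha>) * exp (- v) \<le> \<bar>x\<bar> powr (- \<alpha>) * exp (1 - \<bar>x\<bar>)"
      using True that by (intro mult_left_mono) auto
    also have "exp (1 - \<bar>x\<bar>) = exp 1 * exp (- \<bar>x\<bar>)" by (simp add: exp_add[symmetric])
    finally have "\<bar>x\<bar> powr (- \<alpha>) * exp (- v) \<le> exp 1 * ?h x" by (simp add: mult_ac)
    with exp_gt_zero[of "-v"] show ?thesis by linarith
  next
    case False
    then have "\<bar>x\<bar> powr (- \<alpha>) \<le> 1" using \<alpha> by (simp add: powr_minus inverse_le_1_iff ge_one_powr_ge_zero)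
    then have "\<bar>x\<bar> powr (- \<alpha>) * exp (- v) \<le> 1 * exp (- v)" by (intro mult_right_mono) auto
    then show ?thesis by (simp add: add_increasing2)
  qed
  have "(\<integral>\<^sup>+v. ennreal (\<bar>u - v\<bar> powr (- \<alpha>)) \<partial>nu)
      = (\<integral>\<^sup>+v. ennreal (indicator {0..} v * exp (- v)) * ennreal (\<bar>u - v\<bar> powr (- \<alpha>)) \<partial>lborel)"
    by (rule nn_integral_nu) measurable
  also have "\<dots> \<le> (\<integral>\<^sup>+v. ennreal (indicator {0..} v * exp (- v)) * 1 + ennreal (exp 1) * ennreal (?h (u - v)) \<partial>lborel)"
  proof (rule nn_integral_mono)
    fix v :: real
    show "ennreal (indicator {0..} v * exp (- v)) * ennreal (\<bar>u - v\<bar> powr (- \<alpha>))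
        \<le> ennreal (indicator {0..} v * exp (- v)) * 1 + ennreal (exp 1) * ennreal (?h (u - v))"
      using pointwise[of v "u - v"]
      by (cases "0 \<le> v") (simp_all add: ennreal_mult[symmetric] ennreal_plus[symmetric] mult.commute del: ennreal_plus)
  qed
  also have "\<dots> = (\<integral>\<^sup>+v. ennreal (indicator {0..} v * exp (- v)) * 1 \<partial>lborel) + (\<integral>\<^sup>+v. ennreal (exp 1) * ennreal (?h (u - v)) \<partial>lborel)"
    by (rule nn_integral_add) measurable
  also have "(\<integral>\<^sup>+v. ennreal (indicator {0..} v * exp (- v)) * 1 \<partial>lborel) = 1"
    using nn_integral_nu[of "\<lambda>_. 1"] emeasure_nu_UNIV by simp
  also have "(\<integral>\<^sup>+v. ennreal (exp 1) * ennreal (?h (u - v)) \<partial>lborel) = ennreal (exp 1) * (\<integral>\<^sup>+v. ennreal (?h (u - v)) \<partial>lborel)"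
    by (rule nn_integral_cmult) measurable
  also have "(\<integral>\<^sup>+v. ennreal (?h (u - v)) \<partial>lborel) = (\<integral>\<^sup>+x. ennreal (?h x) \<partial>lborel)"
    using nn_integral_real_affine[of "\<lambda>x. ennreal (?h x)" "-1" u] by simp
  also have "\<dots> = ennreal (2 * Gamma (1 - \<alpha>))"
    using nn_integral_abs_gamma[of "1 - \<alpha>"] \<alpha> by simp
  finally show ?thesis
    using \<alpha> Gamma_real_pos[of "1 - \<alpha>"] by (simp add: ennreal_mult ennreal_plus)
qed

text \<open>Convergence at 0 needs \<open>\<gamma> < 1\<close>, and at infinity \<open>2 * \<gamma> > 1\<close>.\<close>

lemma riesz_constant:
  fixes \<gamma> :: real
  assumes \<gamma>: "1 / 2 < \<gamma>" "\<gamma> < 1"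
  obtains c where "0 < c" "(\<integral>\<^sup>+y. indicator {0<..} y * ennreal (y powr (- \<gamma>) * (1 + y) powr (- \<gamma>)) \<partial>lborel) = ennreal c"
proof -
  define I where "I = (\<integral>\<^sup>+y. indicator {0<..} y * ennreal (y powr (- \<gamma>) * (1 + y) powr (- \<gamma>)) \<partial>lborel)"
  have "I \<le> (\<integral>\<^sup>+y. ennreal (exp 1) * ennreal (\<bar>y\<bar> powr (1 - \<gamma> - 1) * exp (- \<bar>y\<bar>)) + ennreal (y powr (- 2 * \<gamma>)) * indicator {1..} y \<partial>lborel)"
    unfolding I_def
  proof (rule nn_integral_mono)
    fix y :: real
    consider "y \<le> 0" | "0 < y" "y < 1" | "1 \<le> y" by linarith
    then show "indicator {0<..} y * ennreal (y powr (- \<gamma>) * (1 + y) powr (- \<gamma>))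
      \<le> ennreal (exp 1) * ennreal (\<bar>y\<bar> powr (1 - \<gamma> - 1) * exp (- \<bar>y\<bar>)) + ennreal (y powr (- 2 * \<gamma>)) * indicator {1..} y"
    proof cases
      case 2
      have "y powr (- \<gamma>) * (1 + y) powr (- \<gamma>) \<le> y powr (- \<gamma>) * 1"
        using 2 \<gamma> by (intro mult_left_mono) (auto simp: powr_minus inverse_le_1_iff ge_one_powr_ge_zero)
      also have "\<dots> \<le> y powr (- \<gamma>) * exp (1 - y)" using 2 by (intro mult_left_mono) auto
      also have "\<dots> = exp 1 * (y powr (- \<gamma>) * exp (- y))" by (simp add: exp_diff exp_minus field_simps)
      finally show ?thesis using 2 by (simp add: ennreal_mult[symmetric])
    next
      case 3
      have "y powr (- \<gamma>) * (1 + y) powr (- \<gamma>) \<le> y powr (- \<gamma>) * y powr (- \<gamma>)"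
        using 3 \<gamma> by (intro mult_left_mono powr_mono2') auto
      also have "\<dots> = y powr (- 2 * \<gamma>)" by (simp add: powr_add[symmetric])
      finally show ?thesis using 3 by (simp add: add_increasing)
    qed simp
  qed
  also have "\<dots> = (\<integral>\<^sup>+y. ennreal (exp 1) * ennreal (\<bar>y\<bar> powr (1 - \<gamma> - 1) * exp (- \<bar>y\<bar>)) \<partial>lborel)
      + (\<integral>\<^sup>+y. ennreal (y powr (- 2 * \<gamma>)) * indicator {1..} y \<partial>lborel)"
    by (rule nn_integral_add) measurable
  also have "(\<integral>\<^sup>+y. ennreal (exp 1) * ennreal (\<bar>y\<bar> powr (1 - \<gamma> - 1) * exp (- \<bar>y\<bar>)) \<partial>lborel) = ennreal (exp 1) * ennreal (2 * Gamma (1 - \<gamma>))"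
    using \<gamma> nn_integral_abs_gamma[of "1 - \<gamma>"] by (subst nn_integral_cmult) auto
  also have "(\<integral>\<^sup>+y. ennreal (y powr (- 2 * \<gamma>)) * indicator {1..} y \<partial>lborel) = ennreal (- (1 powr (- 2 * \<gamma> + 1)) / (- 2 * \<gamma> + 1))"
    by (rule nn_integral_has_integral_lebesgue') (use has_integral_powr_to_inf[of "- 2 * \<gamma>" 1] \<gamma> in auto)
  finally have "I < \<infinity>" by (rule le_less_trans) (simp add: ennreal_mult_less_top)
  have "(\<integral>\<^sup>+y. ennreal (2 powr (- \<gamma>)) * indicator {0<..<1 :: real} y \<partial>lborel) \<le> I"
    unfolding I_def
  proof (intro nn_integral_mono)
    fix y :: real
    have "2 powr (- \<gamma>) \<le> y powr (- \<gamma>) * (1 + y) powr (- \<gamma>)" if "0 < y" "y < 1"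
    proof -
      have "2 powr (- \<gamma>) \<le> (1 + y) powr (- \<gamma>)" using that \<gamma> by (intro powr_mono2') auto
      moreover have "1 \<le> y powr (- \<gamma>)" using that \<gamma> by (simp add: powr_minus one_le_inverse_iff powr_le1)
      ultimately show ?thesis using mult_mono[of 1 "y powr (- \<gamma>)" "2 powr (- \<gamma>)" "(1 + y) powr (- \<gamma>)"] by simp
    qed
    then show "ennreal (2 powr (- \<gamma>)) * indicator {0<..<1} y \<le> indicator {0<..} y * ennreal (y powr (- \<gamma>) * (1 + y) powr (- \<gamma>))"
      by (auto simp: indicator_def)
  qed
  then have "ennreal (2 powr (- \<gamma>)) \<le> I" by (simp add: nn_integral_cmult_indicator)
  then have "0 < I" by (rule less_le_trans[rotated]) simp
  with \<open>I < \<infinity>\<close> show ?thesis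
    using that[of "enn2real I"] by (cases I) (auto simp: I_def[symmetric])
qed

text \<open>Composing the one-sided fractional kernel \<open>(u - w)\<^sub>+\<^sup>-\<^sup>\<gamma>\<close> with its transpose gives a multiple of
  \<open>\<bar>u - v\<bar>\<close> to the power \<open>1 - 2 * \<gamma> = - \<alpha>\<close>, by scaling. On the diagonal the integral
  diverges.\<close>

lemma riesz_factorization:
  fixes \<alpha> :: real
  assumes \<alpha>: "0 < \<alpha>" "\<alpha> < 1"
  defines "\<gamma> \<equiv> (1 + \<alpha>) / 2"
  obtains c where "0 < c" "\<And>u v. u \<noteq> v \<Longrightarrow>
    (\<integral>\<^sup>+w. ennreal (c * (indicator {..<u} w * (u - w) powr (- \<gamma>))) * ennreal (c * (indicator {..<v} w * (v - w) powr (- \<gamma>))) \<partial>lborel)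
      = ennreal (\<bar>u - v\<bar> powr (- \<alpha>))"
proof -
  have "1 / 2 < \<gamma>" "\<gamma> < 1" using \<alpha> by (auto simp: \<gamma>_def)
  then obtain c where c: "0 < c" and I: "(\<integral>\<^sup>+y. indicator {0<..} y * ennreal (y powr (- \<gamma>) * (1 + y) powr (- \<gamma>)) \<partial>lborel) = ennreal c"
    using riesz_constant by blast
  \<comment> \<open>The constant of the unnormalised convolution is split evenly between the two factors.\<close>
  define b where "b = 1 / sqrt c"
  have b: "0 < b" "b * b * c = 1" using c by (auto simp: b_def)
  let ?a = "\<lambda>u w. b * (indicator {..<u} w * (u - w) powr (- \<gamma>))"
  have less: "(\<integral>\<^sup>+w. ennreal (?a u w) * ennreal (?a v w) \<partial>lborel) = ennreal ((v - u) powr (- \<alpha>))" if "u < v" for u v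
  proof -
    define d where "d = v - u"
    have d: "0 < d" using that by (simp add: d_def)
    have "(\<integral>\<^sup>+w. ennreal (?a u w) * ennreal (?a v w) \<partial>lborel)
        = ennreal d * (\<integral>\<^sup>+y. ennreal (?a u (u - d * y)) * ennreal (?a v (u - d * y)) \<partial>lborel)"
      using d by (subst nn_integral_real_affine[where c = "- d" and t = u]) auto
    also have "(\<integral>\<^sup>+y. ennreal (?a u (u - d * y)) * ennreal (?a v (u - d * y)) \<partial>lborel)
        = (\<integral>\<^sup>+y. ennreal (b * b * d powr (- 2 * \<gamma>)) * (indicator {0<..} y * ennreal (y powr (- \<gamma>) * (1 + y) powr (- \<gamma>))) \<partial>lborel)"
    proof (rule nn_integral_cong)
      fix y :: real
      show "ennreal (?a u (u - d * y)) * ennreal (?a v (u - d * y))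
          = ennreal (b * b * d powr (- 2 * \<gamma>)) * (indicator {0<..} y * ennreal (y powr (- \<gamma>) * (1 + y) powr (- \<gamma>)))"
      proof (cases "0 < y")
        case True
        have v: "v - (u - d * y) = d * (1 + y)" by (simp add: d_def algebra_simps)
        have "0 < d * y" using True d by simp
        then have "u - d * y < u" "u - d * y < v" using that by simp_all
        moreover have "d powr (- 2 * \<gamma>) = d powr (- \<gamma>) * d powr (- \<gamma>)" by (simp add: powr_add[symmetric])
        ultimately show ?thesis
          unfolding v using True b d by (simp add: ennreal_mult[symmetric] powr_mult mult_ac)
      next
        case False
        then have "indicator {..<u} (u - d * y) = (0::real)" using d by (simp add: indicator_def zero_less_mult_iff)
        then show ?thesis using False by simp
      qed
    qed
    also have "\<dots> = ennreal (b * b * d powr (- 2 * \<gamma>)) * ennreal c"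
      unfolding I[symmetric] by (rule nn_integral_cmult) measurable
    also have "ennreal d * \<dots> = ennreal ((b * b * c) * (d * d powr (- 2 * \<gamma>)))"
      using b d c by (simp add: ennreal_mult[symmetric] mult_ac)
    also have "(b * b * c) * (d * d powr (- 2 * \<gamma>)) = d powr (- \<alpha>)"
      using powr_mult_base[of d "- 2 * \<gamma>"] d
    by (simp add: b \<gamma>_def add_divide_distrib diff_divide_distrib)
    finally show ?thesis by (simp add: d_def)
  qed
  have "(\<integral>\<^sup>+w. ennreal (?a u w) * ennreal (?a v w) \<partial>lborel) = ennreal (\<bar>u - v\<bar> powr (- \<alpha>))" if "u \<noteq> v" for u v
    using less[of u v] less[of v u] that by (cases "u < v") (auto simp: mult.commute)
  with b show ?thesis using that by blast
qed

text \<open>The second claim reduces to \<open>\<Gamma>(1 - 3\<alpha>/2) < 2 \<Gamma>(1 - \<alpha>) \<Gamma>(1 - \<alpha>/2)\<close>. Raising the second argument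
  of \<open>B(1 - \<alpha>, 2 - \<alpha>/2)\<close> to 2 decreases it to a rational function of \<open>\<alpha>\<close>, and what remains is the
  polynomial inequality \<open>2 (1 - 2\<alpha>) (2 - \<alpha>) + \<alpha>\<^sup>3 > 0\<close>.\<close>

lemma Q3_less_a0_cube:
  assumes \<alpha>: "0 < \<alpha>" "\<alpha> \<le> 1 / 2"
  shows "0 < Q3 \<alpha>" and "Q3 \<alpha> < 2 * a0 \<alpha> ^ 3"
proof -
  define a b c where "a = Gamma (1 - \<alpha>)" and "b = Gamma (1 - \<alpha> / 2)" and "c = Gamma (1 - 3 * \<alpha> / 2)"
  have pos: "0 < a" "0 < b" "0 < c" unfolding a_def b_def c_def using \<alpha> by (auto intro!: Gamma_real_pos)
  then show "0 < Q3 \<alpha>" by (simp add: Q3_def a_def b_def c_def)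
  have g1: "Gamma (x + 1) = x * Gamma x" if "0 < x" for x :: real
    using that by (intro Gamma_plus1) (auto elim!: nonpos_Ints_cases)
  have b1: "Gamma (2 - \<alpha> / 2) = (1 - \<alpha> / 2) * b"
    using g1[of "1 - \<alpha> / 2"] \<alpha> by (simp add: b_def)
  have c1: "Gamma (3 - 3 * \<alpha> / 2) = (2 - 3 * \<alpha> / 2) * ((1 - 3 * \<alpha> / 2) * c)"
    using g1[of "1 - 3 * \<alpha> / 2"] g1[of "2 - 3 * \<alpha> / 2"] \<alpha> by (simp add: c_def)
  have a1: "Gamma (3 - \<alpha>) = (2 - \<alpha>) * ((1 - \<alpha>) * a)"
    using g1[of "1 - \<alpha>"] g1[of "2 - \<alpha>"] \<alpha> by (simp add: a_def)
  have "Beta (1 - \<alpha>) 2 \<le> Beta (1 - \<alpha>) (2 - \<alpha> / 2)"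
    using \<alpha> by (intro Beta_real_mono) auto
  moreover have "Beta (1 - \<alpha>) 2 = 1 / ((2 - \<alpha>) * (1 - \<alpha>))"
  proof -
    have "(1 - \<alpha>) + 2 = 3 - \<alpha>" by simp
    moreover have "Gamma (2 :: real) = 1" using Gamma_fact[of 1, where 'a = real] by simp
    ultimately show ?thesis using pos by (simp add: Beta_def a1 flip: a_def)
  qed
  moreover have "Beta (1 - \<alpha>) (2 - \<alpha> / 2) = a * ((1 - \<alpha> / 2) * b) / ((2 - 3 * \<alpha> / 2) * ((1 - 3 * \<alpha> / 2) * c))"
  proof -
    have "(1 - \<alpha>) + (2 - \<alpha> / 2) = 3 - 3 * \<alpha> / 2" by (simp add: field_simps)
    then show ?thesis by (simp only: Beta_def b1 c1 a_def[symmetric])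
  qed
  ultimately have "1 / ((2 - \<alpha>) * (1 - \<alpha>)) \<le> a * ((1 - \<alpha> / 2) * b) / ((2 - 3 * \<alpha> / 2) * ((1 - 3 * \<alpha> / 2) * c))"
    by simp
  moreover have "0 < (2 - \<alpha>) * (1 - \<alpha>)" "0 < (2 - 3 * \<alpha> / 2) * ((1 - 3 * \<alpha> / 2) * c)"
    using \<alpha> pos by auto
  ultimately have "(2 - 3 * \<alpha> / 2) * ((1 - 3 * \<alpha> / 2) * c) \<le> a * ((1 - \<alpha> / 2) * b) * ((2 - \<alpha>) * (1 - \<alpha>))"
    by (simp add: pos_divide_le_eq pos_le_divide_eq)
  then have le: "((2 - 3 * \<alpha>) * (4 - 3 * \<alpha>)) * c \<le> ((2 - \<alpha>)\<^sup>2 * (1 - \<alpha>)) * (2 * (a * b))"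
    by (simp add: field_simps power2_eq_square)
  have "(2 - 3 * \<alpha>) * (4 - 3 * \<alpha>) - (2 - \<alpha>)\<^sup>2 * (1 - \<alpha>) = 2 * (1 - 2 * \<alpha>) * (2 - \<alpha>) + \<alpha> ^ 3"
    by (simp add: power2_eq_square power3_eq_cube algebra_simps)
  also have "\<dots> > 0" using \<alpha> by (intro add_nonneg_pos mult_nonneg_nonneg) auto
  finally have "(2 - \<alpha>)\<^sup>2 * (1 - \<alpha>) * c < (2 - 3 * \<alpha>) * (4 - 3 * \<alpha>) * c" using pos by simp
  with le have "(2 - \<alpha>)\<^sup>2 * (1 - \<alpha>) * c < (2 - \<alpha>)\<^sup>2 * (1 - \<alpha>) * (2 * (a * b))" by linarith
  moreover have "0 < (2 - \<alpha>)\<^sup>2 * (1 - \<alpha>)" using \<alpha> by simp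
  ultimately have "c < 2 * (a * b)" by (metis mult_less_cancel_left_pos)
  then have "a\<^sup>2 * c < a\<^sup>2 * (2 * (a * b))" using pos by (intro mult_strict_left_mono) auto
  then have "a\<^sup>2 * c / b < 2 * a ^ 3" using pos by (simp add: pos_divide_less_eq power2_eq_square power3_eq_cube mult_ac)
  then show "Q3 \<alpha> < 2 * a0 \<alpha> ^ 3" by (simp add: Q3_def a0_def a_def b_def c_def)
qed

section \<open>Pairings of exponentials\<close>

lemma nn_integral_powr_unit:
  assumes "0 < p"
  shows "(\<integral>\<^sup>+z. indicator {0..1} z * ennreal (z powr (p - 1)) \<partial>lborel) = ennreal (1 / p)"
proof -
  have "(\<integral>\<^sup>+z. indicator {0..1} z * ennreal (z powr (p - 1)) \<partial>lborel)
      = (\<integral>\<^sup>+z. indicator {0..1} z * ennreal (z powr (p - 1) * (1 - z) powr (1 - 1)) \<partial>lborel)"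
  proof (rule nn_integral_cong_AE)
    show "AE z in lborel. indicator {0..1} z * ennreal (z powr (p - 1))
        = indicator {0..1} z * ennreal (z powr (p - 1) * (1 - z) powr (1 - 1))"
      using AE_lborel_singleton[of 1] by eventually_elim simp
  qed
  also have "\<dots> = ennreal (Beta p 1)" using assms by (intro nn_integral_Beta) auto
  also have "Beta p 1 = 1 / p"
  proof -
    have "Gamma (p + 1) = p * Gamma p" using assms by (intro Gamma_plus1) (auto elim!: nonpos_Ints_cases)
    then show ?thesis using Gamma_real_pos[OF assms] by (simp add: Beta_def)
  qed
  finally show ?thesis .
qed

lemma hyp2F1_coeff:
  fixes p b :: real
  assumes "0 < p"
  shows "fps_nth (fps_hypergeo [b, p] [p + 1] 1) n = p * (pochhammer b n / fact n / (p + real n))"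
proof -
  have "pochhammer p n * (p + real n) = p * pochhammer (p + 1) n"
    using pochhammer_rec[of p n] by (simp add: pochhammer_Suc)
  moreover have "pochhammer (p + 1) n > 0" using assms by (intro pochhammer_pos) auto
  ultimately have "pochhammer p n / pochhammer (p + 1) n = p / (p + real n)"
    using assms by (simp add: field_simps)
  moreover have "fps_nth (fps_hypergeo [b, p] [p + 1] 1) n
      = (pochhammer p n / pochhammer (p + 1) n) * (pochhammer b n / fact n)"
    by simp
  ultimately show ?thesis by simp
qed

lemma neg_binomial_sums:
  fixes b x :: real
  assumes "\<bar>x\<bar> < 1"
  shows "(\<lambda>n. pochhammer b n / fact n * x ^ n) sums (1 - x) powr (- b)"
proof -
  have "(\<lambda>n. (- b gchoose n) * (- x) ^ n) sums (1 + - x) powr (- b)"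
    using assms by (intro gen_binomial_real) auto
  moreover have "(- b gchoose n) * (- x) ^ n = pochhammer b n / fact n * x ^ n" for n
  proof -
    have "(- 1) ^ n * (- x) ^ n = x ^ n" by (simp add: power_mult_distrib[symmetric])
    then show ?thesis by (simp add: gbinomial_pochhammer mult_ac)
  qed
  ultimately show ?thesis by simp
qed

text \<open>Euler's integral for \<open>\<^sub>2F\<^sub>1\<close>: expand the power by the binomial series and
  integrate termwise. All terms are nonnegative.\<close>

lemma hyp2F1_euler_integral:
  assumes p: "0 < p" and b: "0 \<le> b" and x: "0 \<le> x" "x < 1"
  shows "(\<integral>\<^sup>+z. indicator {0..1} z * ennreal (z powr (p - 1) * (1 - x * z) powr (- b)) \<partial>lborel)
      = ennreal (hyp2F1 b p (p + 1) x / p)" and "0 \<le> hyp2F1 b p (p + 1) x"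
proof -
  define c where "c n = pochhammer b n / fact n" for n
  have c: "0 \<le> c n" for n
    using b by (cases "b = 0") (auto simp: c_def pochhammer_0_left intro!: divide_nonneg_pos pochhammer_nonneg)
  define d where "d n = c n * x ^ n / (p + real n)" for n
  have d: "0 \<le> d n" for n using c p x by (simp add: d_def)
  let ?m = "\<lambda>n z. ennreal (c n * x ^ n) * (indicator {0..1} z * ennreal (z powr (p + real n - 1)))"
  have "summable (\<lambda>n. c n * x ^ n / p)"
    using neg_binomial_sums[of x b] x by (intro summable_divide) (auto simp: c_def sums_iff)
  then have summ: "summable d"
  proof (rule summable_comparison_test[rotated], intro exI allI impI)
    fix n
    have "d n \<le> c n * x ^ n / p" unfolding d_def using c p x by (intro divide_left_mono) auto
    then show "norm (d n) \<le> c n * x ^ n / p" using d by simp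
  qed
  have hyp: "hyp2F1 b p (p + 1) x = p * (\<Sum>n. d n)"
  proof -
    have "hyp2F1 b p (p + 1) x = (\<Sum>n. p * d n)"
      unfolding hyp2F1_def eval_fps_def hyp2F1_coeff[OF p] by (simp add: d_def c_def mult_ac)
    then show ?thesis using summ by (simp add: suminf_mult)
  qed
  then show "0 \<le> hyp2F1 b p (p + 1) x" using p d summ by (simp add: suminf_nonneg)
  have "(\<integral>\<^sup>+z. indicator {0..1} z * ennreal (z powr (p - 1) * (1 - x * z) powr (- b)) \<partial>lborel)
      = (\<integral>\<^sup>+z. (\<Sum>n. ?m n z) \<partial>lborel)"
  proof (rule nn_integral_cong_AE)
    show "AE z in lborel. indicator {0..1} z * ennreal (z powr (p - 1) * (1 - x * z) powr (- b))
        = (\<Sum>n. ?m n z)"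
      using AE_lborel_singleton[of 0]
    proof eventually_elim
      case (elim z)
      show ?case
      proof (cases "0 < z \<and> z \<le> 1")
        case True
        then have xz: "0 \<le> x * z" "x * z < 1"
          using x mult_left_le[of z x] by (auto intro: le_less_trans)
        have "(\<lambda>n. z powr (p - 1) * (c n * (x * z) ^ n)) sums (z powr (p - 1) * (1 - x * z) powr (- b))"
          using neg_binomial_sums[of "x * z" b] xz by (intro sums_mult) (simp add: c_def)
        moreover have "z powr (p - 1) * (c n * (x * z) ^ n) = c n * x ^ n * z powr (p + real n - 1)" for n
        proof -
          have "z powr (p + real n - 1) = z powr (p - 1) * z ^ n"
            using True by (simp add: powr_realpow[symmetric] powr_add[symmetric] algebra_simps)
          then show ?thesis by (simp add: power_mult_distrib)
        qed
        ultimately have "(\<lambda>n. c n * x ^ n * z powr (p + real n - 1)) sums (z powr (p - 1) * (1 - x * z) powr (- b))"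
          by simp
        then have "(\<Sum>n. ennreal (c n * x ^ n * z powr (p + real n - 1))) = ennreal (z powr (p - 1) * (1 - x * z) powr (- b))"
          using c x by (intro suminf_ennreal_eq) auto
        then show ?thesis using True c x by (simp add: ennreal_mult)
      qed (use elim in \<open>auto simp: indicator_def\<close>)
    qed
  qed
  also have "\<dots> = (\<Sum>n. \<integral>\<^sup>+z. ?m n z \<partial>lborel)"
    by (rule nn_integral_suminf) measurable
  also have "\<dots> = (\<Sum>n. ennreal (d n))"
  proof (intro suminf_cong)
    fix n
    have "(\<integral>\<^sup>+z. ?m n z \<partial>lborel)
        = ennreal (c n * x ^ n) * ennreal (1 / (p + real n))"
      using nn_integral_powr_unit[of "p + real n"] p by (subst nn_integral_cmult) auto
    then show "(\<integral>\<^sup>+z. ?m n z \<partial>lborel) = ennreal (d n)"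
      using c p x by (simp add: d_def ennreal_mult[symmetric])
  qed
  also have "\<dots> = ennreal (\<Sum>n. d n)" using d summ by (intro suminf_ennreal2)
  also have "(\<Sum>n. d n) = hyp2F1 b p (p + 1) x / p" using hyp p by simp
  finally show "(\<integral>\<^sup>+z. indicator {0..1} z * ennreal (z powr (p - 1) * (1 - x * z) powr (- b)) \<partial>lborel)
      = ennreal (hyp2F1 b p (p + 1) x / p)" .
qed

text \<open>Substitute \<open>y = x (1 - z)\<close> and integrate over \<open>x\<close> first; this leaves Euler's
  integral in \<open>z\<close>.\<close>

lemma hyp_term_integral:
  assumes \<alpha>: "0 < \<alpha>" "\<alpha> < 1" and t: "0 \<le> t"
  shows "(\<integral>\<^sup>+x. \<integral>\<^sup>+y. indicator {y<..} x * ennreal (x powr (- \<alpha>) * \<bar>x - y\<bar> powr (- \<alpha>) * exp (- (t * y))) \<partial>nu \<partial>nu)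
    = ennreal (hyp_term \<alpha> t)" and "0 \<le> hyp_term \<alpha> t"
proof -
  let ?k = "\<lambda>x y. indicator {y<..} x * ennreal (x powr (- \<alpha>) * \<bar>x - y\<bar> powr (- \<alpha>) * exp (- (t * y)))"
  let ?g = "\<lambda>x z. indicator {0..1} z * ennreal (z powr (- \<alpha>) * (x powr (2 - 2 * \<alpha> - 1) * exp (- (((1 + t) * (1 - z)) * x))))"
  interpret NL: pair_sigma_finite lborel nu ..
  define X where "X = (1 + t) / (2 + t)"
  have X: "0 \<le> X" "X < 1" using t by (auto simp: X_def)
  define Hyp where "Hyp = hyp2F1 (2 - 2 * \<alpha>) (1 - \<alpha>) (2 - \<alpha>) X"
  have euler: "(\<integral>\<^sup>+z. indicator {0..1} z * ennreal (z powr (- \<alpha>) * (1 - X * z) powr (2 * \<alpha> - 2)) \<partial>lborel) = ennreal (Hyp / (1 - \<alpha>))"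
    and Hyp: "0 \<le> Hyp"
    using hyp2F1_euler_integral[of "1 - \<alpha>" "2 - 2 * \<alpha>" X] \<alpha> X by (simp_all add: Hyp_def)
  have hyp_term: "hyp_term \<alpha> t = Gamma (2 - 2 * \<alpha>) * (2 + t) powr (2 * \<alpha> - 2) * (Hyp / (1 - \<alpha>))"
    by (simp add: hyp_term_def Hyp_def X_def)
  have G: "0 < Gamma (2 - 2 * \<alpha>)" using \<alpha> by (intro Gamma_real_pos) simp
  show "0 \<le> hyp_term \<alpha> t" unfolding hyp_term using G Hyp \<alpha> by simp
  have "(\<integral>\<^sup>+x. \<integral>\<^sup>+y. ?k x y \<partial>nu \<partial>nu)
      = (\<integral>\<^sup>+x. \<integral>\<^sup>+z. ?g x z \<partial>lborel \<partial>nu)"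
  proof (rule nn_integral_cong_AE)
    show "AE x in nu. (\<integral>\<^sup>+y. ?k x y \<partial>nu)
      = (\<integral>\<^sup>+z. ?g x z \<partial>lborel)"
      using AE_nu_nonneg AE_nu_neq[of 0]
    proof eventually_elim
      case (elim x)
      then have x: "0 < x" by simp
      let ?f = "\<lambda>y. ennreal (indicator {0..} y * exp (- y)) * (?k x y)"
      have "(\<integral>\<^sup>+y. ?k x y \<partial>nu) = (\<integral>\<^sup>+y. ?f y \<partial>lborel)"
        by (rule nn_integral_nu) measurable
      also have "\<dots> = ennreal x * (\<integral>\<^sup>+z. ?f (x - x * z) \<partial>lborel)"
        using x by (subst nn_integral_real_affine[where c = "- x" and t = x]) auto
      also have "\<dots> = (\<integral>\<^sup>+z. ennreal x * ?f (x - x * z) \<partial>lborel)"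
        by (rule nn_integral_cmult[symmetric]) measurable
      also have "\<dots> = (\<integral>\<^sup>+z. ?g x z \<partial>lborel)"
      proof (rule nn_integral_cong_AE)
        show "AE z in lborel. ennreal x * ?f (x - x * z)
          = ?g x z"
          using AE_lborel_singleton[of 0]
        proof eventually_elim
          case (elim z)
          have sgn: "0 \<le> x - x * z \<longleftrightarrow> z \<le> 1" "x - x * z < x \<longleftrightarrow> 0 < z"
            using x by (auto simp: zero_less_mult_iff)
          show ?case
          proof (cases "0 < z \<and> z \<le> 1")
            case True
            have "x powr (2 - 2 * \<alpha> - 1) = x * (x powr (- \<alpha>) * x powr (- \<alpha>))"
              using x powr_mult_base[of x "- \<alpha> + - \<alpha>"] by (simp add: powr_add[symmetric] algebra_simps)
            moreover have "exp (- (((1 + t) * (1 - z)) * x)) = exp (- (x - x * z)) * exp (- (t * (x - x * z)))"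
              by (simp add: exp_add[symmetric] algebra_simps)
            moreover have "\<bar>x - (x - x * z)\<bar> powr (- \<alpha>) = x powr (- \<alpha>) * z powr (- \<alpha>)"
              using x True by (simp add: powr_mult abs_mult)
            ultimately show ?thesis
              using sgn True x by (simp add: ennreal_mult[symmetric] mult_ac)
          next
            case False
            then show ?thesis using sgn elim by (auto simp: indicator_def)
          qed
        qed
      qed
      finally show ?case .
    qed
  qed
  also have "\<dots> = (\<integral>\<^sup>+z. \<integral>\<^sup>+x. ?g x z \<partial>nu \<partial>lborel)"
    by (rule NL.Fubini') measurable
  also have "\<dots> = (\<integral>\<^sup>+z. ennreal (Gamma (2 - 2 * \<alpha>) * (2 + t) powr (2 * \<alpha> - 2)) *
      (indicator {0..1} z * ennreal (z powr (- \<alpha>) * (1 - X * z) powr (2 * \<alpha> - 2))) \<partial>lborel)"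
  proof (rule nn_integral_cong)
    fix z :: real
    show "(\<integral>\<^sup>+x. ?g x z \<partial>nu)
      = ennreal (Gamma (2 - 2 * \<alpha>) * (2 + t) powr (2 * \<alpha> - 2)) *
        (indicator {0..1} z * ennreal (z powr (- \<alpha>) * (1 - X * z) powr (2 * \<alpha> - 2)))"
    proof (cases "z \<in> {0..1}")
      case True
      have "(\<integral>\<^sup>+x. ?g x z \<partial>nu)
          = ennreal (z powr (- \<alpha>)) * (\<integral>\<^sup>+x. ennreal (x powr (2 - 2 * \<alpha> - 1) * exp (- (((1 + t) * (1 - z)) * x))) \<partial>nu)"
        using True by (subst nn_integral_cmult[symmetric]) (auto simp: ennreal_mult)
      also have "\<dots> = ennreal (z powr (- \<alpha>)) * ennreal (Gamma (2 - 2 * \<alpha>) * (1 + (1 + t) * (1 - z)) powr (- (2 - 2 * \<alpha>)))"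
        using True \<alpha> t by (subst nu_gamma) auto
      also have "1 + (1 + t) * (1 - z) = (2 + t) * (1 - X * z)"
        using t by (simp add: X_def field_simps)
      also have "\<dots> powr (- (2 - 2 * \<alpha>)) = (2 + t) powr (2 * \<alpha> - 2) * (1 - X * z) powr (2 * \<alpha> - 2)"
        by (simp add: powr_mult)
      finally show ?thesis using True G by (simp add: ennreal_mult[symmetric] mult_ac)
    qed simp
  qed
  also have "\<dots> = ennreal (Gamma (2 - 2 * \<alpha>) * (2 + t) powr (2 * \<alpha> - 2)) * ennreal (Hyp / (1 - \<alpha>))"
    unfolding euler[symmetric] by (rule nn_integral_cmult) measurable
  also have "\<dots> = ennreal (hyp_term \<alpha> t)"
    unfolding hyp_term using G Hyp \<alpha> by (subst ennreal_mult[symmetric]) auto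
  finally show "(\<integral>\<^sup>+x. \<integral>\<^sup>+y. ?k x y \<partial>nu \<partial>nu)
    = ennreal (hyp_term \<alpha> t)" .
qed

text \<open>The part \<open>y < x\<close> gives the hypergeometric term; in the part \<open>x < y\<close> the lack of memory
  separates the variables.\<close>

lemma min_outer_integral:
  assumes \<alpha>: "0 < \<alpha>" "\<alpha> < 1" and t: "0 \<le> t"
  shows "(\<integral>\<^sup>+x. \<integral>\<^sup>+y. ennreal (x powr (- \<alpha>) * \<bar>x - y\<bar> powr (- \<alpha>) * exp (- (t * y))) \<partial>nu \<partial>nu)
    = ennreal (hyp_term \<alpha> t + (Gamma (1 - \<alpha>))\<^sup>2 * ((1 + t) powr (\<alpha> - 1) * (2 + t) powr (\<alpha> - 1)))"
proof -
  let ?f = "\<lambda>x y. ennreal (x powr (- \<alpha>) * \<bar>x - y\<bar> powr (- \<alpha>) * exp (- (t * y)))"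
  define A where "A = Gamma (1 - \<alpha>)"
  have A: "0 < A" unfolding A_def using \<alpha> by (intro Gamma_real_pos) simp
  have gam: "(\<integral>\<^sup>+x. ennreal (x powr (- \<alpha>) * exp (- (r * x))) \<partial>nu) = ennreal (A * (1 + r) powr (\<alpha> - 1))" if "0 \<le> r" for r
    using nu_gamma[of "1 - \<alpha>" r] \<alpha> that by (simp add: A_def)
  have "(\<integral>\<^sup>+x. \<integral>\<^sup>+y. ?f x y \<partial>nu \<partial>nu)
      = (\<integral>\<^sup>+x. \<integral>\<^sup>+y. indicator {y<..} x * ?f x y + indicator {x<..} y * ?f x y \<partial>nu \<partial>nu)"
  proof (rule nn_integral_cong, rule nn_integral_cong_AE)
    fix x
    show "AE y in nu. ?f x y = indicator {y<..} x * ?f x y + indicator {x<..} y * ?f x y"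
      using AE_nu_neq[of x] by eventually_elim (auto simp: indicator_def)
  qed
  also have "\<dots> = (\<integral>\<^sup>+x. \<integral>\<^sup>+y. indicator {y<..} x * ?f x y \<partial>nu \<partial>nu) + (\<integral>\<^sup>+x. \<integral>\<^sup>+y. indicator {x<..} y * ?f x y \<partial>nu \<partial>nu)"
    by (simp add: nn_integral_add)
  also have "(\<integral>\<^sup>+x. \<integral>\<^sup>+y. indicator {y<..} x * ?f x y \<partial>nu \<partial>nu) = ennreal (hyp_term \<alpha> t)"
    by (rule hyp_term_integral(1)[OF \<alpha> t])
  also have "(\<integral>\<^sup>+x. \<integral>\<^sup>+y. indicator {x<..} y * ?f x y \<partial>nu \<partial>nu)
      = (\<integral>\<^sup>+x. ennreal (x powr (- \<alpha>) * exp (- ((1 + t) * x))) * ennreal (A * (1 + t) powr (\<alpha> - 1)) \<partial>nu)"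
  proof (rule nn_integral_cong_AE)
    show "AE x in nu. (\<integral>\<^sup>+y. indicator {x<..} y * ?f x y \<partial>nu)
        = ennreal (x powr (- \<alpha>) * exp (- ((1 + t) * x))) * ennreal (A * (1 + t) powr (\<alpha> - 1))"
      using AE_nu_nonneg
    proof eventually_elim
      case (elim x)
      have "(\<integral>\<^sup>+y. indicator {x<..} y * ?f x y \<partial>nu) = ennreal (exp (- x)) * (\<integral>\<^sup>+z. ?f x (x + z) \<partial>nu)"
        using elim by (intro nu_shift) measurable
      also have "(\<integral>\<^sup>+z. ?f x (x + z) \<partial>nu)
          = (\<integral>\<^sup>+z. ennreal (x powr (- \<alpha>) * exp (- (t * x))) * ennreal (z powr (- \<alpha>) * exp (- (t * z))) \<partial>nu)"
      proof (rule nn_integral_cong_AE)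
        show "AE z in nu. ?f x (x + z) = ennreal (x powr (- \<alpha>) * exp (- (t * x))) * ennreal (z powr (- \<alpha>) * exp (- (t * z)))"
          using AE_nu_nonneg
        proof eventually_elim
          case (elim z)
          have "exp (- (t * (x + z))) = exp (- (t * x)) * exp (- (t * z))"
            by (simp add: exp_add[symmetric] algebra_simps)
          then show ?case using elim by (simp add: ennreal_mult[symmetric] mult_ac)
        qed
      qed
      also have "\<dots> = ennreal (x powr (- \<alpha>) * exp (- (t * x))) * ennreal (A * (1 + t) powr (\<alpha> - 1))"
        unfolding gam[OF t, symmetric] by (rule nn_integral_cmult) measurable
      also have "ennreal (exp (- x)) * \<dots> = ennreal (exp (- x) * (x powr (- \<alpha>) * exp (- (t * x)))) * ennreal (A * (1 + t) powr (\<alpha> - 1))"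
        by (simp add: ennreal_mult mult.assoc)
      also have "exp (- x) * (x powr (- \<alpha>) * exp (- (t * x))) = x powr (- \<alpha>) * exp (- ((1 + t) * x))"
      proof -
        have "exp (- ((1 + t) * x)) = exp (- x) * exp (- (t * x))" by (simp add: exp_add[symmetric] algebra_simps)
        then show ?thesis by simp
      qed
      finally show ?case .
    qed
  qed
  also have "\<dots> = ennreal (A * (2 + t) powr (\<alpha> - 1)) * ennreal (A * (1 + t) powr (\<alpha> - 1))"
    using gam[of "1 + t"] t by (subst nn_integral_multc) auto
  also have "ennreal (hyp_term \<alpha> t) + \<dots>
      = ennreal (hyp_term \<alpha> t + A\<^sup>2 * ((1 + t) powr (\<alpha> - 1) * (2 + t) powr (\<alpha> - 1)))"
    using A hyp_term_integral(2)[OF \<alpha> t]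
    by (simp add: ennreal_mult[symmetric] ennreal_plus[symmetric] power2_eq_square mult_ac del: ennreal_plus)
  finally show ?thesis by (simp add: A_def)
qed

lemma exp_form_integral:
  assumes \<alpha>: "0 < \<alpha>" "\<alpha> < 1" and st: "0 \<le> s" "0 \<le> t"
  shows "(\<integral>\<^sup>+u. \<integral>\<^sup>+v. ennreal (\<bar>u - v\<bar> powr (- \<alpha>) * (exp (- (s * u)) * exp (- (t * v)))) \<partial>nu \<partial>nu)
    = ennreal (exp_form \<alpha> s t)" and "0 \<le> exp_form \<alpha> s t"
proof -
  define A where "A = Gamma (1 - \<alpha>)"
  have A: "0 < A" unfolding A_def using \<alpha> by (intro Gamma_real_pos) simp
  have gam: "(\<integral>\<^sup>+x. ennreal (x powr (- \<alpha>) * exp (- (r * x))) \<partial>nu) = ennreal (A * (1 + r) powr (\<alpha> - 1))" if "0 \<le> r" for r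
    using nu_gamma[of "1 - \<alpha>" r] \<alpha> that by (simp add: A_def)
  show "0 \<le> exp_form \<alpha> s t" unfolding exp_form_def A_def[symmetric] using A st by simp
  have "(\<integral>\<^sup>+u. \<integral>\<^sup>+v. ennreal (\<bar>u - v\<bar> powr (- \<alpha>) * (exp (- (s * u)) * exp (- (t * v)))) \<partial>nu \<partial>nu)
      = ennreal (1 / (2 + (s + t))) * (\<integral>\<^sup>+x. ennreal (x powr (- \<alpha>) * exp (- (t * x))) + ennreal (x powr (- \<alpha>) * exp (- (s * x))) \<partial>nu)"
  proof (rule nu_double_by_min)
    fix u x :: real assume "0 \<le> u" "0 < x"
    have e: "exp (- (r * (u + x))) = exp (- (r * u)) * exp (- (r * x))" for r
      by (simp add: exp_add[symmetric] algebra_simps)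
    have e': "exp (- ((s + t) * u)) = exp (- (s * u)) * exp (- (t * u))"
      by (simp add: exp_add[symmetric] algebra_simps)
    show "ennreal (\<bar>u - (u + x)\<bar> powr (- \<alpha>) * (exp (- (s * u)) * exp (- (t * (u + x)))))
        + ennreal (\<bar>(u + x) - u\<bar> powr (- \<alpha>) * (exp (- (s * (u + x))) * exp (- (t * u))))
        = ennreal (exp (- ((s + t) * u))) * (ennreal (x powr (- \<alpha>) * exp (- (t * x))) + ennreal (x powr (- \<alpha>) * exp (- (s * x))))"
      unfolding e e' using \<open>0 < x\<close>
      by (simp add: ennreal_mult[symmetric] ennreal_plus[symmetric] algebra_simps del: ennreal_plus)
  qed (use st in \<open>auto\<close>)
  also have "(\<integral>\<^sup>+x. ennreal (x powr (- \<alpha>) * exp (- (t * x))) + ennreal (x powr (- \<alpha>) * exp (- (s * x))) \<partial>nu)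
      = ennreal (A * (1 + t) powr (\<alpha> - 1)) + ennreal (A * (1 + s) powr (\<alpha> - 1))"
    using gam[OF st(1)] gam[OF st(2)] by (subst nn_integral_add) auto
  also have "ennreal (1 / (2 + (s + t))) * \<dots> = ennreal (1 / (2 + (s + t)) * (A * (1 + t) powr (\<alpha> - 1) + A * (1 + s) powr (\<alpha> - 1)))"
    using A st
    by (simp only: ennreal_mult ennreal_plus mult_nonneg_nonneg add_nonneg_nonneg powr_ge_zero
        less_imp_le divide_nonneg_nonneg zero_le_one zero_le_numeral)
  also have "1 / (2 + (s + t)) * (A * (1 + t) powr (\<alpha> - 1) + A * (1 + s) powr (\<alpha> - 1)) = exp_form \<alpha> s t"
    unfolding exp_form_def A_def[symmetric] by (simp add: add_divide_distrib algebra_simps)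
  finally show "(\<integral>\<^sup>+u. \<integral>\<^sup>+v. ennreal (\<bar>u - v\<bar> powr (- \<alpha>) * (exp (- (s * u)) * exp (- (t * v)))) \<partial>nu \<partial>nu)
    = ennreal (exp_form \<alpha> s t)" .
qed

text \<open>Split by the smallest variable. If it is the variable \<open>u\<close> that occurs in both kernels, the
  integrand is a product of two Gamma integrands. If it is \<open>v\<close> or \<open>w\<close>, what remains is
  \<open>min_outer_integral\<close>, at the rate of the other one of these two variables.\<close>

lemma exp_sq_integral:
  assumes \<alpha>: "0 < \<alpha>" "\<alpha> < 1" and st: "0 \<le> s" "0 \<le> t"
  shows "(\<integral>\<^sup>+u. \<integral>\<^sup>+v. \<integral>\<^sup>+w. ennreal (\<bar>u - v\<bar> powr (- \<alpha>) * exp (- (s * v))) * ennreal (\<bar>u - w\<bar> powr (- \<alpha>) * exp (- (t * w))) \<partial>nu \<partial>nu \<partial>nu)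
    = ennreal (exp_sq \<alpha> s t)" and "0 \<le> exp_sq \<alpha> s t"
proof -
  let ?F = "\<lambda>u v w. ennreal (\<bar>u - v\<bar> powr (- \<alpha>) * exp (- (s * v))) * ennreal (\<bar>u - w\<bar> powr (- \<alpha>) * exp (- (t * w)))"
  define A where "A = Gamma (1 - \<alpha>)"
  have A: "0 < A" unfolding A_def using \<alpha> by (intro Gamma_real_pos) simp
  let ?h = "\<lambda>t. hyp_term \<alpha> t + A\<^sup>2 * ((1 + t) powr (\<alpha> - 1) * (2 + t) powr (\<alpha> - 1))"
  have gam: "(\<integral>\<^sup>+x. ennreal (x powr (- \<alpha>) * exp (- (r * x))) \<partial>nu) = ennreal (A * (1 + r) powr (\<alpha> - 1))" if "0 \<le> r" for r
    using nu_gamma[of "1 - \<alpha>" r] \<alpha> that by (simp add: A_def)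
  note H = hyp_term_integral(2)[OF \<alpha> st(1)] hyp_term_integral(2)[OF \<alpha> st(2)]
  show "0 \<le> exp_sq \<alpha> s t" unfolding exp_sq_def A_def[symmetric] using H st by simp
  define G1 where "G1 x y = ennreal (x powr (- \<alpha>) * exp (- (s * x))) * ennreal (y powr (- \<alpha>) * exp (- (t * y)))" for x y
  define G2 where "G2 r x y = ennreal (x powr (- \<alpha>) * \<bar>x - y\<bar> powr (- \<alpha>) * exp (- (r * y)))" for r x y
  have G1 [measurable]: "case_prod G1 \<in> borel_measurable (borel \<Otimes>\<^sub>M borel)" unfolding G1_def by measurable
  have G2 [measurable]: "case_prod (G2 r) \<in> borel_measurable (borel \<Otimes>\<^sub>M borel)" for r unfolding G2_def by measurable
  have "(\<integral>\<^sup>+u. \<integral>\<^sup>+v. \<integral>\<^sup>+w. ?F u v w \<partial>nu \<partial>nu \<partial>nu)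
      = ennreal (1 / (3 + (s + t))) * (\<integral>\<^sup>+x. \<integral>\<^sup>+y. G1 x y + G2 t x y + G2 s x y \<partial>nu \<partial>nu)"
  proof (rule nu_triple_by_min)
    fix u x y :: real assume xy: "0 \<le> u" "0 < x" "0 < y"
    have e: "exp (- (r * (u + z))) = exp (- (r * u)) * exp (- (r * z))" for r z
      by (simp add: exp_add[symmetric] algebra_simps)
    have e': "exp (- ((s + t) * u)) = exp (- (s * u)) * exp (- (t * u))"
      by (simp add: exp_add[symmetric] algebra_simps)
    have a: "\<bar>u - (u + x)\<bar> = x" "\<bar>u - (u + y)\<bar> = y" "\<bar>u + x - u\<bar> = x" "\<bar>u + x - (u + y)\<bar> = \<bar>x - y\<bar>"
      using xy by auto
    show "ennreal (\<bar>u - (u + x)\<bar> powr (- \<alpha>) * exp (- (s * (u + x)))) * ennreal (\<bar>u - (u + y)\<bar> powr (- \<alpha>) * exp (- (t * (u + y))))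
        + ennreal (\<bar>u + x - u\<bar> powr (- \<alpha>) * exp (- (s * u))) * ennreal (\<bar>u + x - (u + y)\<bar> powr (- \<alpha>) * exp (- (t * (u + y))))
        + ennreal (\<bar>u + x - (u + y)\<bar> powr (- \<alpha>) * exp (- (s * (u + y)))) * ennreal (\<bar>u + x - u\<bar> powr (- \<alpha>) * exp (- (t * u)))
        = ennreal (exp (- ((s + t) * u))) * (G1 x y + G2 t x y + G2 s x y)"
      unfolding e e' a G1_def G2_def
      by (simp add: ennreal_mult[symmetric] ennreal_plus[symmetric] algebra_simps del: ennreal_plus)
  qed (use st in \<open>auto\<close>)
  also have "(\<integral>\<^sup>+x. \<integral>\<^sup>+y. G1 x y + G2 t x y + G2 s x y \<partial>nu \<partial>nu)
      = (\<integral>\<^sup>+x. \<integral>\<^sup>+y. G1 x y \<partial>nu \<partial>nu) + (\<integral>\<^sup>+x. \<integral>\<^sup>+y. G2 t x y \<partial>nu \<partial>nu) + (\<integral>\<^sup>+x. \<integral>\<^sup>+y. G2 s x y \<partial>nu \<partial>nu)"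
    by (simp add: nn_integral_add)
  also have "(\<integral>\<^sup>+x. \<integral>\<^sup>+y. G1 x y \<partial>nu \<partial>nu) = ennreal (A * (1 + s) powr (\<alpha> - 1)) * ennreal (A * (1 + t) powr (\<alpha> - 1))"
    unfolding G1_def gam[OF st(1), symmetric] gam[OF st(2), symmetric] by (simp add: nn_integral_cmult nn_integral_multc)
  also have "(\<integral>\<^sup>+x. \<integral>\<^sup>+y. G2 t x y \<partial>nu \<partial>nu) = ennreal (?h t)"
    unfolding G2_def A_def by (rule min_outer_integral[OF \<alpha> st(2)])
  also have "(\<integral>\<^sup>+x. \<integral>\<^sup>+y. G2 s x y \<partial>nu \<partial>nu) = ennreal (?h s)"
    unfolding G2_def A_def by (rule min_outer_integral[OF \<alpha> st(1)])
  also have "ennreal (1 / (3 + (s + t))) * (ennreal (A * (1 + s) powr (\<alpha> - 1)) * ennreal (A * (1 + t) powr (\<alpha> - 1))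
      + ennreal (?h t)
      + ennreal (?h s))
    = ennreal (1 / (3 + (s + t)) * (A * (1 + s) powr (\<alpha> - 1) * (A * (1 + t) powr (\<alpha> - 1))
      + (?h t)
      + (?h s)))"
    using A H st
    by (simp only: ennreal_mult ennreal_plus mult_nonneg_nonneg add_nonneg_nonneg powr_ge_zero zero_le_power2
        less_imp_le divide_nonneg_nonneg zero_le_one zero_le_numeral)
  also have "1 / (3 + (s + t)) * (A * (1 + s) powr (\<alpha> - 1) * (A * (1 + t) powr (\<alpha> - 1))
      + (?h t)
      + (?h s)) = exp_sq \<alpha> s t"
    unfolding exp_sq_def A_def[symmetric] by (simp add: add_divide_distrib algebra_simps power2_eq_square)
  finally show "(\<integral>\<^sup>+u. \<integral>\<^sup>+v. \<integral>\<^sup>+w. ?F u v w \<partial>nu \<partial>nu \<partial>nu)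
    = ennreal (exp_sq \<alpha> s t)" .
qed

section \<open>The operator and the enclosure of its top eigenvalue\<close>

lemma riesz_factored_kernel:
  assumes \<alpha>: "0 < \<alpha>" "\<alpha> < 1"
  obtains a C where "factored_kernel nu (lborel :: real measure) (\<lambda>u v. \<bar>u - v\<bar> powr (- \<alpha>)) a C"
proof -
  obtain c where c: "0 < c" and fac: "\<And>u v. u \<noteq> v \<Longrightarrow>
    (\<integral>\<^sup>+w. ennreal (c * (indicator {..<u} w * (u - w) powr (- ((1 + \<alpha>) / 2)))) *
       ennreal (c * (indicator {..<v} w * (v - w) powr (- ((1 + \<alpha>) / 2)))) \<partial>lborel)
      = ennreal (\<bar>u - v\<bar> powr (- \<alpha>))"
    using riesz_factorization[OF \<alpha>] by blast
  define a where "a u w = c * ((if w < u then 1 else 0) * (u - w) powr (- ((1 + \<alpha>) / 2)))" for u w :: real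
  have "factored_kernel nu (lborel :: real measure) (\<lambda>u v. \<bar>u - v\<bar> powr (- \<alpha>)) a (1 + exp 1 * (2 * Gamma (1 - \<alpha>)))"
  proof unfold_locales
    show "(\<lambda>(u, v). \<bar>u - v\<bar> powr (- \<alpha>)) \<in> borel_measurable (nu \<Otimes>\<^sub>M nu)" by measurable
    show "case_prod a \<in> borel_measurable (nu \<Otimes>\<^sub>M lborel)" unfolding a_def by measurable
    show "0 \<le> a u w" for u w using c by (simp add: a_def)
    show "(\<integral>\<^sup>+v. ennreal (\<bar>u - v\<bar> powr (- \<alpha>)) \<partial>nu) \<le> ennreal (1 + exp 1 * (2 * Gamma (1 - \<alpha>)))" for u
      by (rule riesz_kernel_schur_bound[OF \<alpha>])
    show "0 \<le> 1 + exp 1 * (2 * Gamma (1 - \<alpha>))"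
      using \<alpha> by (intro add_nonneg_nonneg mult_nonneg_nonneg less_imp_le[OF Gamma_real_pos]) auto
    show "AE v in nu. (\<integral>\<^sup>+w. ennreal (a u w) * ennreal (a v w) \<partial>lborel) = ennreal (\<bar>u - v\<bar> powr (- \<alpha>))" for u
      using AE_nu_neq[of u]
    proof eventually_elim
      case (elim v)
      have "a u w = c * (indicator {..<u} w * (u - w) powr (- ((1 + \<alpha>) / 2)))" for u w
        by (simp add: a_def indicator_def)
      then show ?case using fac[of u v] elim by simp
    qed
  qed (auto simp: abs_minus_commute)
  then show ?thesis using that by blast
qed

lemma exp_L2:
  assumes "0 \<le> t"
  shows "(\<lambda>u. exp (- (t * u))) \<in> L2 nu"
proof -
  have "(exp (- (t * u)))\<^sup>2 = exp (- ((2 * t) * u))" for u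
    by (simp add: power2_eq_square exp_add[symmetric])
  then have "(\<integral>\<^sup>+u. ennreal ((exp (- (t * u)))\<^sup>2) \<partial>nu) < \<infinity>"
    using nu_exp[of "2 * t"] assms by simp
  then show ?thesis unfolding L2_iff_nn by simp
qed

lemma inner_exp:
  assumes "0 \<le> s" "0 \<le> t"
  shows "l2_inner nu (\<lambda>u. exp (- (s * u))) (\<lambda>u. exp (- (t * u))) = exp_gram s t"
proof -
  have "l2_inner nu (\<lambda>u. exp (- (s * u))) (\<lambda>u. exp (- (t * u)))
      = enn2real (\<integral>\<^sup>+u. ennreal (exp (- (s * u)) * exp (- (t * u))) \<partial>nu)"
    unfolding l2_inner_def by (rule integral_eq_nn_integral) auto
  also have "(\<integral>\<^sup>+u. ennreal (exp (- (s * u)) * exp (- (t * u))) \<partial>nu) = (\<integral>\<^sup>+u. ennreal (exp (- ((s + t) * u))) \<partial>nu)"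
    by (simp add: exp_add[symmetric] algebra_simps)
  finally show ?thesis using assms by (simp add: nu_exp exp_gram_def add.assoc)
qed

context
  fixes \<alpha> :: real
  assumes \<alpha>: "0 < \<alpha>" "\<alpha> < 1"
begin

lemma
  assumes f: "f \<in> L2 nu"
  shows S_op_L2: "S_op \<alpha> f \<in> L2 nu"
    and S_op_nonneg: "0 \<le> l2_inner nu f (S_op \<alpha> f)"
    and S_op_add_AE: "g \<in> L2 nu \<Longrightarrow> AE u in nu. S_op \<alpha> (\<lambda>x. f x + g x) u = S_op \<alpha> f u + S_op \<alpha> g u"
    and S_op_symmetric: "g \<in> L2 nu \<Longrightarrow> l2_inner nu (S_op \<alpha> f) g = l2_inner nu f (S_op \<alpha> g)"
    and S_op_norm_bound: "\<exists>C. \<forall>f\<in>L2 nu. l2_norm nu (S_op \<alpha> f) \<le> C * l2_norm nu f"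
    and S_op_trace_bound: "\<alpha> \<le> 1 / 2 \<Longrightarrow> g \<in> L2 nu \<Longrightarrow>
      l2_inner nu f f = 1 \<Longrightarrow> l2_inner nu g g = 1 \<Longrightarrow> l2_inner nu f g = 0 \<Longrightarrow>
      l2_inner nu f (S_op \<alpha> (S_op \<alpha> (S_op \<alpha> f))) + l2_inner nu g (S_op \<alpha> (S_op \<alpha> (S_op \<alpha> g))) \<le> Q3 \<alpha>"
proof -
  obtain a C where K: "factored_kernel nu (lborel :: real measure) (\<lambda>u v. \<bar>u - v\<bar> powr (- \<alpha>)) a C"
    using riesz_factored_kernel[OF \<alpha>] by blast
  have op: "S_op \<alpha> = factored_kernel.op nu (\<lambda>u v. \<bar>u - v\<bar> powr (- \<alpha>))"
    unfolding fun_eq_iff factored_kernel.op_def[OF K] S_op_def by simp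
  show "S_op \<alpha> f \<in> L2 nu" unfolding op by (rule factored_kernel.op_L2[OF K f])
  show "0 \<le> l2_inner nu f (S_op \<alpha> f)" unfolding op by (rule factored_kernel.op_nonneg[OF K f])
  show "\<exists>C. \<forall>f\<in>L2 nu. l2_norm nu (S_op \<alpha> f) \<le> C * l2_norm nu f"
    unfolding op using factored_kernel.l2_norm_op_le[OF K] by blast
  assume g: "g \<in> L2 nu"
  show "AE u in nu. S_op \<alpha> (\<lambda>x. f x + g x) u = S_op \<alpha> f u + S_op \<alpha> g u"
    unfolding op by (rule factored_kernel.op_add_AE[OF K f g])
  show "l2_inner nu (S_op \<alpha> f) g = l2_inner nu f (S_op \<alpha> g)"
    unfolding op by (rule factored_kernel.op_symmetric[OF K f g])
  assume half: "\<alpha> \<le> 1 / 2" and orth: "l2_inner nu f f = 1" "l2_inner nu g g = 1" "l2_inner nu f g = 0"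
  show "l2_inner nu f (S_op \<alpha> (S_op \<alpha> (S_op \<alpha> f))) + l2_inner nu g (S_op \<alpha> (S_op \<alpha> (S_op \<alpha> g))) \<le> Q3 \<alpha>"
    unfolding op using nu_trace_integral[OF \<alpha>(1) half] Q3_less_a0_cube(1)[OF \<alpha>(1) half] f g orth
    by (intro factored_kernel.trace_bound[OF K]) auto
qed

lemma S_op_cong_AE:
  assumes "AE u in nu. f u = g u" "f \<in> borel_measurable nu" "g \<in> borel_measurable nu"
  shows "S_op \<alpha> f = S_op \<alpha> g"
  unfolding S_op_def using assms by (intro ext integral_cong_AE) auto

lemma S_op_scale: "S_op \<alpha> (\<lambda>x. c * f x) = (\<lambda>u. c * S_op \<alpha> f u)"
  by (simp add: fun_eq_iff S_op_def mult.left_commute)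

text \<open>The action of \<open>S_op\<close> on classes: it is independent of the representative because \<open>S_op\<close> gives
  the same function for almost everywhere equal arguments.\<close>

definition riesz_operator :: "L2nu \<Rightarrow> L2nu" where
  "riesz_operator x = l2_class (S_op \<alpha> (SOME f. f \<in> L2 nu \<and> x = l2_class f))"

lemma riesz_operator_class:
  assumes f: "f \<in> L2 nu"
  shows "riesz_operator (l2_class f) = l2_class (S_op \<alpha> f)"
proof -
  define g where "g = (SOME g. g \<in> L2 nu \<and> l2_class f = l2_class g)"
  have "g \<in> L2 nu \<and> l2_class f = l2_class g"
    unfolding g_def by (rule someI[of _ f]) (use f in simp)
  then have g: "g \<in> L2 nu" and "AE u in nu. f u = g u"
    using l2_class_eq_iff[OF f] by auto
  then have "S_op \<alpha> f = S_op \<alpha> g"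
    by (intro S_op_cong_AE) (auto intro: L2_measurable f)
  then show ?thesis by (simp add: riesz_operator_def g_def)
qed

lemma bounded_linear_riesz_operator: "bounded_linear riesz_operator"
proof -
  obtain C where C: "\<And>f. f \<in> L2 nu \<Longrightarrow> l2_norm nu (S_op \<alpha> f) \<le> C * l2_norm nu f"
    using S_op_norm_bound[OF L2_zero] by blast
  show ?thesis
  proof (rule bounded_linear_intro)
    fix x y :: L2nu and r :: real
    obtain f g where f: "f \<in> L2 nu" "x = l2_class f" and g: "g \<in> L2 nu" "y = l2_class g"
      using l2_class_surj by metis
    have "riesz_operator (x + y) = l2_class (S_op \<alpha> (\<lambda>u. f u + g u))"
      using f g by (simp add: l2_class_add riesz_operator_class L2_add)
    also have "\<dots> = l2_class (\<lambda>u. S_op \<alpha> f u + S_op \<alpha> g u)"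
      using f g by (subst l2_class_eq_iff) (auto intro: S_op_L2 L2_add S_op_add_AE)
    also have "\<dots> = riesz_operator x + riesz_operator y"
      using f g by (simp add: l2_class_add riesz_operator_class S_op_L2)
    finally show "riesz_operator (x + y) = riesz_operator x + riesz_operator y" .
    have "riesz_operator (r *\<^sub>R x) = l2_class (S_op \<alpha> (\<lambda>u. r * f u))"
      using f by (simp add: l2_class_scale riesz_operator_class L2_scale)
    also have "\<dots> = l2_class (\<lambda>u. r * S_op \<alpha> f u)" by (simp only: S_op_scale)
    also have "\<dots> = r *\<^sub>R riesz_operator x"
      using f by (simp add: riesz_operator_class l2_class_scale S_op_L2)
    finally show "riesz_operator (r *\<^sub>R x) = r *\<^sub>R riesz_operator x" .
    show "norm (riesz_operator x) \<le> norm x * C"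
      using f C[of f] by (simp add: riesz_operator_class norm_l2_class S_op_L2 mult.commute)
  qed
qed

lemma riesz_operator_symmetric: "riesz_operator x \<bullet> y = x \<bullet> riesz_operator y"
proof -
  obtain f g where f: "f \<in> L2 nu" "x = l2_class f" and g: "g \<in> L2 nu" "y = l2_class g"
    using l2_class_surj by metis
  then show ?thesis using S_op_symmetric[of f g] by (simp add: riesz_operator_class inner_l2_class S_op_L2)
qed

lemma riesz_operator_nonneg: "0 \<le> x \<bullet> riesz_operator x"
proof -
  obtain f where f: "f \<in> L2 nu" "x = l2_class f" using l2_class_surj by metis
  then show ?thesis using S_op_nonneg[of f] by (simp add: riesz_operator_class inner_l2_class S_op_L2)
qed

lemma riesz_operator_trace_bound:
  assumes half: "\<alpha> \<le> 1 / 2" and xy: "norm x = 1" "norm y = 1" "x \<bullet> y = 0"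
  shows "x \<bullet> riesz_operator (riesz_operator (riesz_operator x))
    + y \<bullet> riesz_operator (riesz_operator (riesz_operator y)) \<le> Q3 \<alpha>"
proof -
  obtain f g where f: "f \<in> L2 nu" "x = l2_class f" and g: "g \<in> L2 nu" "y = l2_class g"
    using l2_class_surj by metis
  have "l2_inner nu f f = 1" "l2_inner nu g g = 1" "l2_inner nu f g = 0"
    using xy f g by (simp_all add: norm_eq_1 inner_l2_class)
  then show ?thesis
    using S_op_trace_bound[OF f(1) half g(1)] f g by (simp add: riesz_operator_class inner_l2_class S_op_L2)
qed

lemma S_eigenvalue_iff: "S_eigenvalue \<alpha> l \<longleftrightarrow> (\<exists>x. x \<noteq> 0 \<and> riesz_operator x = l *\<^sub>R x)"
proof -
  have iff: "riesz_operator (l2_class f) = l *\<^sub>R l2_class f \<longleftrightarrow> (AE u in nu. S_op \<alpha> f u = l * f u)"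
    if "f \<in> L2 nu" for f
    using that by (simp add: riesz_operator_class l2_class_scale l2_class_eq_iff S_op_L2 L2_scale)
  show ?thesis
  proof
    assume "S_eigenvalue \<alpha> l"
    then obtain f where "f \<in> L2 nu" "\<not> (AE u in nu. f u = 0)" "AE u in nu. S_op \<alpha> f u = l * f u"
      unfolding S_eigenvalue_def by blast
    then show "\<exists>x. x \<noteq> 0 \<and> riesz_operator x = l *\<^sub>R x"
      using iff[of f] by (intro exI[of _ "l2_class f"]) (simp add: l2_class_eq_0_iff)
  next
    assume "\<exists>x. x \<noteq> 0 \<and> riesz_operator x = l *\<^sub>R x"
    then obtain x where x: "x \<noteq> 0" "riesz_operator x = l *\<^sub>R x" by blast
    obtain f where f: "f \<in> L2 nu" "x = l2_class f" using l2_class_surj by metis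
    then show "S_eigenvalue \<alpha> l"
      unfolding S_eigenvalue_def using x iff[of f] by (intro bexI[of _ f]) (simp_all add: l2_class_eq_0_iff)
  qed
qed

lemma nn_S_op_exp:
  assumes t: "0 \<le> t"
  shows "ennreal (S_op \<alpha> (\<lambda>v. exp (- (t * v))) u) = (\<integral>\<^sup>+v. ennreal (\<bar>u - v\<bar> powr (- \<alpha>) * exp (- (t * v))) \<partial>nu)"
    and "0 \<le> S_op \<alpha> (\<lambda>v. exp (- (t * v))) u"
proof -
  have "(\<integral>\<^sup>+v. ennreal (\<bar>u - v\<bar> powr (- \<alpha>) * exp (- (t * v))) \<partial>nu) \<le> (\<integral>\<^sup>+v. ennreal (\<bar>u - v\<bar> powr (- \<alpha>)) \<partial>nu)"
    using AE_nu_nonneg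
    by (intro nn_integral_mono_AE, eventually_elim) (use t in \<open>auto intro!: ennreal_leI mult_left_le\<close>)
  also have "\<dots> < \<infinity>"
    using riesz_kernel_schur_bound[OF \<alpha>] by (rule le_less_trans) simp
  finally have fin: "(\<integral>\<^sup>+v. ennreal (\<bar>u - v\<bar> powr (- \<alpha>) * exp (- (t * v))) \<partial>nu) < \<infinity>" .
  have "S_op \<alpha> (\<lambda>v. exp (- (t * v))) u = enn2real (\<integral>\<^sup>+v. ennreal (\<bar>u - v\<bar> powr (- \<alpha>) * exp (- (t * v))) \<partial>nu)"
    unfolding S_op_def by (rule integral_eq_nn_integral) auto
  then show "ennreal (S_op \<alpha> (\<lambda>v. exp (- (t * v))) u) = (\<integral>\<^sup>+v. ennreal (\<bar>u - v\<bar> powr (- \<alpha>) * exp (- (t * v))) \<partial>nu)"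
    and "0 \<le> S_op \<alpha> (\<lambda>v. exp (- (t * v))) u"
    using fin by simp_all
qed

lemma inner_exp_S_exp:
  assumes st: "0 \<le> s" "0 \<le> t"
  shows "l2_inner nu (\<lambda>u. exp (- (s * u))) (S_op \<alpha> (\<lambda>u. exp (- (t * u)))) = exp_form \<alpha> s t"
proof -
  let ?e = "\<lambda>t u. exp (- (t * u)) :: real"
  note [measurable] = L2_measurable[OF S_op_L2[OF exp_L2[OF st(2)]]]
  have "l2_inner nu (?e s) (S_op \<alpha> (?e t)) = enn2real (\<integral>\<^sup>+u. ennreal (?e s u * S_op \<alpha> (?e t) u) \<partial>nu)"
    unfolding l2_inner_def using nn_S_op_exp(2)[OF st(2)] by (intro integral_eq_nn_integral) auto
  also have "(\<integral>\<^sup>+u. ennreal (?e s u * S_op \<alpha> (?e t) u) \<partial>nu)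
      = (\<integral>\<^sup>+u. \<integral>\<^sup>+v. ennreal (\<bar>u - v\<bar> powr (- \<alpha>) * (?e s u * ?e t v)) \<partial>nu \<partial>nu)"
  proof (rule nn_integral_cong)
    fix u
    have "ennreal (?e s u * S_op \<alpha> (?e t) u) = ennreal (?e s u) * (\<integral>\<^sup>+v. ennreal (\<bar>u - v\<bar> powr (- \<alpha>) * ?e t v) \<partial>nu)"
      using nn_S_op_exp[OF st(2), of u] by (simp add: ennreal_mult)
    also have "\<dots> = (\<integral>\<^sup>+v. ennreal (?e s u) * ennreal (\<bar>u - v\<bar> powr (- \<alpha>) * ?e t v) \<partial>nu)"
      by (rule nn_integral_cmult[symmetric]) measurable
    finally show "ennreal (?e s u * S_op \<alpha> (?e t) u) = (\<integral>\<^sup>+v. ennreal (\<bar>u - v\<bar> powr (- \<alpha>) * (?e s u * ?e t v)) \<partial>nu)"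
      by (simp add: ennreal_mult[symmetric] mult_ac)
  qed
  finally show ?thesis using exp_form_integral[OF \<alpha> st] by simp
qed

lemma inner_S_exp_S_exp:
  assumes st: "0 \<le> s" "0 \<le> t"
  shows "l2_inner nu (S_op \<alpha> (\<lambda>u. exp (- (s * u)))) (S_op \<alpha> (\<lambda>u. exp (- (t * u)))) = exp_sq \<alpha> s t"
proof -
  let ?e = "\<lambda>t u. exp (- (t * u)) :: real"
  note [measurable] = L2_measurable[OF S_op_L2[OF exp_L2[OF st(1)]]] L2_measurable[OF S_op_L2[OF exp_L2[OF st(2)]]]
  have "l2_inner nu (S_op \<alpha> (?e s)) (S_op \<alpha> (?e t)) = enn2real (\<integral>\<^sup>+u. ennreal (S_op \<alpha> (?e s) u * S_op \<alpha> (?e t) u) \<partial>nu)"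
    unfolding l2_inner_def using nn_S_op_exp(2)[OF st(1)] nn_S_op_exp(2)[OF st(2)]
    by (intro integral_eq_nn_integral) auto
  also have "(\<integral>\<^sup>+u. ennreal (S_op \<alpha> (?e s) u * S_op \<alpha> (?e t) u) \<partial>nu)
      = (\<integral>\<^sup>+u. \<integral>\<^sup>+v. \<integral>\<^sup>+w. ennreal (\<bar>u - v\<bar> powr (- \<alpha>) * ?e s v) * ennreal (\<bar>u - w\<bar> powr (- \<alpha>) * ?e t w) \<partial>nu \<partial>nu \<partial>nu)"
  proof (rule nn_integral_cong)
    fix u
    have "ennreal (S_op \<alpha> (?e s) u * S_op \<alpha> (?e t) u)
        = (\<integral>\<^sup>+v. ennreal (\<bar>u - v\<bar> powr (- \<alpha>) * ?e s v) \<partial>nu) * (\<integral>\<^sup>+w. ennreal (\<bar>u - w\<bar> powr (- \<alpha>) * ?e t w) \<partial>nu)"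
      using nn_S_op_exp[OF st(1), of u] nn_S_op_exp[OF st(2), of u] by (simp only: ennreal_mult)
    also have "\<dots> = (\<integral>\<^sup>+v. ennreal (\<bar>u - v\<bar> powr (- \<alpha>) * ?e s v) * (\<integral>\<^sup>+w. ennreal (\<bar>u - w\<bar> powr (- \<alpha>) * ?e t w) \<partial>nu) \<partial>nu)"
      by (rule nn_integral_multc[symmetric]) measurable
    also have "\<dots> = (\<integral>\<^sup>+v. \<integral>\<^sup>+w. ennreal (\<bar>u - v\<bar> powr (- \<alpha>) * ?e s v) * ennreal (\<bar>u - w\<bar> powr (- \<alpha>) * ?e t w) \<partial>nu \<partial>nu)"
      by (intro nn_integral_cong nn_integral_cmult[symmetric]) measurable
    finally show "ennreal (S_op \<alpha> (?e s) u * S_op \<alpha> (?e t) u)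
      = (\<integral>\<^sup>+v. \<integral>\<^sup>+w. ennreal (\<bar>u - v\<bar> powr (- \<alpha>) * ?e s v) * ennreal (\<bar>u - w\<bar> powr (- \<alpha>) * ?e t w) \<partial>nu \<partial>nu)" .
  qed
  finally show ?thesis using exp_sq_integral[OF \<alpha> st] by simp
qed

end

lemma L2_sum:
  fixes n :: nat
  assumes "\<And>i. i < n \<Longrightarrow> f i \<in> L2 nu"
  shows "(\<lambda>u. \<Sum>i<n. c i * f i u) \<in> L2 nu \<and> l2_class (\<lambda>u. \<Sum>i<n. c i * f i u) = (\<Sum>i<n. c i *\<^sub>R l2_class (f i))"
  using assms
proof (induction n)
  case 0
  then show ?case using L2_zero[of nu] l2_class_eq_0_iff[of "\<lambda>_. 0"] by simp
next
  case (Suc n)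
  then have IH: "(\<lambda>u. \<Sum>i<n. c i * f i u) \<in> L2 nu" "l2_class (\<lambda>u. \<Sum>i<n. c i * f i u) = (\<Sum>i<n. c i *\<^sub>R l2_class (f i))"
    by auto
  have fn: "(\<lambda>u. c n * f n u) \<in> L2 nu" "c n *\<^sub>R l2_class (f n) = l2_class (\<lambda>u. c n * f n u)"
    using Suc.prems[of n] by (auto simp: L2_scale l2_class_scale)
  show ?case using L2_add[OF IH(1) fn(1)] l2_class_add[OF IH(1) fn(1)] IH(2) fn(2) by simp
qed

theorem proposition6p5:
  fixes \<alpha> \<theta> \<sigma>2 \<beta> :: real and h :: "real \<Rightarrow> real"
  assumes "0 < \<alpha>" and "\<alpha> \<le> 1 / 2"
    and "h \<in> L2 nu" and "l2_norm nu h = 1"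
    and "\<theta> = l2_inner nu h (S_op \<alpha> h)"
    and "\<sigma>2 = (l2_norm nu (\<lambda>u. S_op \<alpha> h u - \<theta> * h u))\<^sup>2"
    and "\<beta> = root 3 (Q3 \<alpha> - \<theta> ^ 3)"
  shows "(\<theta> > \<beta> \<longrightarrow> \<theta> \<le> lambda_max \<alpha> \<and> lambda_max \<alpha> \<le> \<theta> + \<sigma>2 / (\<theta> - \<beta>))
    \<and> (\<theta> \<ge> a0 \<alpha> \<longrightarrow> \<theta> > \<beta>)
    \<and> (\<forall>(n :: nat) (c :: nat \<Rightarrow> real) (t :: nat \<Rightarrow> real).
         (\<forall>i<n. t i \<ge> 0) \<and> (AE u in nu. h u = (\<Sum>i<n. c i * exp (- (t i * u)))) \<longrightarrow>
           (\<Sum>i<n. \<Sum>j<n. c i * c j * exp_gram (t i) (t j)) = 1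
         \<and> \<theta> = (\<Sum>i<n. \<Sum>j<n. c i * c j * exp_form \<alpha> (t i) (t j))
         \<and> \<sigma>2 = (\<Sum>i<n. \<Sum>j<n. c i * c j * exp_sq \<alpha> (t i) (t j))
                 - (\<Sum>i<n. \<Sum>j<n. c i * c j * exp_form \<alpha> (t i) (t j))\<^sup>2
         \<and> \<beta> = root 3 (Q3 \<alpha> - (\<Sum>i<n. \<Sum>j<n. c i * c j * exp_form \<alpha> (t i) (t j)) ^ 3))"
proof -
  have \<alpha>: "0 < \<alpha>" "\<alpha> < 1" using assms by auto
  note Q3 = Q3_less_a0_cube[OF assms(1,2)]
  define T where "T = riesz_operator \<alpha>"
  define x where "x = l2_class h"
  have nx: "norm x = 1" using assms by (simp add: x_def norm_l2_class)
  have Tx: "T x = l2_class (S_op \<alpha> h)" using assms by (simp add: x_def T_def riesz_operator_class[OF \<alpha>])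
  have Sh: "S_op \<alpha> h \<in> L2 nu" using assms by (simp add: S_op_L2[OF \<alpha>])
  have \<theta>: "\<theta> = x \<bullet> T x"
    using inner_l2_class[OF assms(3) Sh] by (simp add: Tx x_def[symmetric] assms(5))
  have \<sigma>2: "\<sigma>2 = (norm (T x - \<theta> *\<^sub>R x))\<^sup>2"
  proof -
    have "T x - \<theta> *\<^sub>R x = l2_class (\<lambda>u. S_op \<alpha> h u - \<theta> * h u)"
      unfolding Tx unfolding x_def using assms(3) Sh by (simp add: l2_class_scale l2_class_diff L2_scale)
    then show ?thesis using assms(3) Sh by (simp add: assms(6) norm_l2_class L2_diff L2_scale)
  qed
  interpret T: bounded_linear T unfolding T_def by (rule bounded_linear_riesz_operator[OF \<alpha>])
  have sym: "T y \<bullet> z = y \<bullet> T z" for y z unfolding T_def by (rule riesz_operator_symmetric[OF \<alpha>])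
  have enclosure: "\<theta> \<le> lambda_max \<alpha> \<and> lambda_max \<alpha> \<le> \<theta> + \<sigma>2 / (\<theta> - \<beta>)" if sep: "\<beta> < \<theta>"
  proof -
    obtain f l where f: "norm f = 1" "T f = l *\<^sub>R f" and top: "\<And>y m. y \<noteq> 0 \<Longrightarrow> T y = m *\<^sub>R y \<Longrightarrow> m \<le> l"
      and l: "\<theta> \<le> l" "(l - \<theta>) * (\<theta> - \<beta>) \<le> (norm (T x - \<theta> *\<^sub>R x))\<^sup>2"
    proof (rule kato_temple_from_trace_bound[OF T.bounded_linear_axioms sym _ _ nx \<theta> assms(7) sep])
      show "0 \<le> y \<bullet> T y" for y unfolding T_def by (rule riesz_operator_nonneg[OF \<alpha>])
      show "f \<bullet> T (T (T f)) + g \<bullet> T (T (T g)) \<le> Q3 \<alpha>"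
        if "norm f = 1" "norm g = 1" "f \<bullet> g = 0" for f g
        unfolding T_def by (rule riesz_operator_trace_bound[OF \<alpha> assms(2) that])
    qed (use Q3 in auto)
    have "f \<noteq> 0" using f by auto
    have "lambda_max \<alpha> = l"
      unfolding lambda_max_def S_eigenvalue_iff[OF \<alpha>] T_def[symmetric]
      using f \<open>f \<noteq> 0\<close> top by (intro Greatest_equality) auto
    moreover have "l - \<theta> \<le> \<sigma>2 / (\<theta> - \<beta>)" using l(2) sep by (simp add: \<sigma>2 pos_le_divide_eq)
    ultimately show ?thesis using l(1) by simp
  qed
  have separation: "\<beta> < \<theta>" if "a0 \<alpha> \<le> \<theta>"
  proof -
    have "\<beta> ^ 3 = Q3 \<alpha> - \<theta> ^ 3" by (simp add: assms(7) odd_real_root_pow)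
    moreover have "a0 \<alpha> ^ 3 \<le> \<theta> ^ 3" using that by (simp add: cube_le_cube_iff)
    ultimately have "\<beta> ^ 3 < \<theta> ^ 3" using Q3(2) by linarith
    then show ?thesis by (simp add: cube_less_cube_iff)
  qed
  have formulas: "(\<Sum>i<n. \<Sum>j<n. c i * c j * exp_gram (t i) (t j)) = 1
         \<and> \<theta> = (\<Sum>i<n. \<Sum>j<n. c i * c j * exp_form \<alpha> (t i) (t j))
         \<and> \<sigma>2 = (\<Sum>i<n. \<Sum>j<n. c i * c j * exp_sq \<alpha> (t i) (t j)) - \<theta>\<^sup>2"
    if t: "\<forall>i<n. t i \<ge> 0" and h: "AE u in nu. h u = (\<Sum>i<n. c i * exp (- (t i * u)))"
    for n :: nat and c t :: "nat \<Rightarrow> real"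
  proof -
    define e where "e i = l2_class (\<lambda>u. exp (- (t i * u)))" for i
    have eL2: "(\<lambda>u. exp (- (t i * u))) \<in> L2 nu" if "i < n" for i using t that by (intro exp_L2) auto
    have Te: "T (e i) = l2_class (S_op \<alpha> (\<lambda>u. exp (- (t i * u))))" if "i < n" for i
      using eL2[OF that] by (simp add: T_def e_def riesz_operator_class[OF \<alpha>])
    have SeL2: "S_op \<alpha> (\<lambda>u. exp (- (t i * u))) \<in> L2 nu" if "i < n" for i
      using eL2[OF that] by (rule S_op_L2[OF \<alpha>])
    have sumL2: "(\<lambda>u. \<Sum>i<n. c i * exp (- (t i * u))) \<in> L2 nu"
      and class_sum: "l2_class (\<lambda>u. \<Sum>i<n. c i * exp (- (t i * u))) = (\<Sum>i<n. c i *\<^sub>R e i)"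
      using L2_sum[of n "\<lambda>i u. exp (- (t i * u))" c] eL2 unfolding e_def by auto
    have xe: "x = (\<Sum>i<n. c i *\<^sub>R e i)"
      unfolding x_def class_sum[symmetric] using h l2_class_eq_iff[OF assms(3) sumL2] by blast
    have Txe: "T x = (\<Sum>i<n. c i *\<^sub>R T (e i))" unfolding xe by (simp add: T.sum T.scaleR)
    have bilinear: "(\<Sum>i<n. c i *\<^sub>R p i) \<bullet> (\<Sum>j<n. c j *\<^sub>R q j) = (\<Sum>i<n. \<Sum>j<n. c i * c j * (p i \<bullet> q j))"
      for p q :: "nat \<Rightarrow> L2nu"
      unfolding inner_sum_left by (simp add: inner_sum_right sum_distrib_left mult_ac)
    have "(\<Sum>i<n. \<Sum>j<n. c i * c j * exp_gram (t i) (t j)) = x \<bullet> x"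
      unfolding xe bilinear using t eL2 by (intro sum.cong refl) (auto simp: e_def inner_l2_class inner_exp)
    moreover have "(\<Sum>i<n. \<Sum>j<n. c i * c j * exp_form \<alpha> (t i) (t j)) = x \<bullet> T x"
      unfolding Txe unfolding xe bilinear using t eL2 SeL2
      by (intro sum.cong refl) (auto simp: Te, simp add: e_def inner_l2_class inner_exp_S_exp[OF \<alpha>])
    moreover have "(\<Sum>i<n. \<Sum>j<n. c i * c j * exp_sq \<alpha> (t i) (t j)) = T x \<bullet> T x"
      unfolding Txe bilinear using t SeL2
      by (intro sum.cong refl) (auto simp: Te inner_l2_class inner_S_exp_S_exp[OF \<alpha>])
    moreover have "x \<bullet> x = 1" using nx by (simp add: norm_eq_1)
    moreover have "\<sigma>2 = T x \<bullet> T x - \<theta>\<^sup>2"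
      unfolding \<sigma>2 power2_norm_eq_inner using \<open>x \<bullet> x = 1\<close>
      by (simp add: inner_simps inner_commute \<theta> power2_eq_square algebra_simps)
    ultimately show ?thesis using \<theta> by simp
  qed
  show ?thesis
  proof (intro conjI impI allI)
    fix n :: nat and c t :: "nat \<Rightarrow> real"
    assume "(\<forall>i<n. t i \<ge> 0) \<and> (AE u in nu. h u = (\<Sum>i<n. c i * exp (- (t i * u))))"
    then have F: "(\<Sum>i<n. \<Sum>j<n. c i * c j * exp_gram (t i) (t j)) = 1"
      "\<theta> = (\<Sum>i<n. \<Sum>j<n. c i * c j * exp_form \<alpha> (t i) (t j))"
      "\<sigma>2 = (\<Sum>i<n. \<Sum>j<n. c i * c j * exp_sq \<alpha> (t i) (t j)) - \<theta>\<^sup>2"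
      using formulas[of n t c] by blast+
    show "(\<Sum>i<n. \<Sum>j<n. c i * c j * exp_gram (t i) (t j)) = 1" by (rule F(1))
    show "\<theta> = (\<Sum>i<n. \<Sum>j<n. c i * c j * exp_form \<alpha> (t i) (t j))" by (rule F(2))
    show "\<sigma>2 = (\<Sum>i<n. \<Sum>j<n. c i * c j * exp_sq \<alpha> (t i) (t j))
        - (\<Sum>i<n. \<Sum>j<n. c i * c j * exp_form \<alpha> (t i) (t j))\<^sup>2"
      unfolding F(2)[symmetric] by (rule F(3))
    show "\<beta> = root 3 (Q3 \<alpha> - (\<Sum>i<n. \<Sum>j<n. c i * c j * exp_form \<alpha> (t i) (t j)) ^ 3)"
      unfolding F(2)[symmetric] by (rule assms(7))
  qed (use enclosure separation in auto)
qed

end
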